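(* For every constant $\epsilon>0$ there is a distributed algorithm for the unit height throughput maximization problem on line-networks with windows with approximation ratio $(4+\epsilon)$, i.e. it outputs a feasible solution $S$ with $p(S)\ge p(\mathrm{Opt})/(4+\epsilon)$. Its number of communication rounds is $O\!\left(T_{MIS}\,\log\frac{1}{\epsilon}\,\log\frac{L_{\max}}{L_{\min}}\,\log\frac{p_{\max}}{p_{\min}}\right)$.
   Context: Line-networks with windows, unit height: the timeline consists of discrete timeslots $1,\dots,n$. There is a set $\mathcal{T}$ of $r$ resources, each offering bandwidth $1$ at every timeslot. There are $m$ processors. Each processor $P$ owns one demand $a$ with a release time $\mathrm{rt}(a)$, a deadline $\mathrm{dl}(a)$, a processing time $\rho(a)$ and a profit $p(a)>0$, and it has a set $\mathrm{Acc}(P)\subseteq\mathcal{T}$ of accessible resources. A demand instance of $a$ consists of a resource $T\in\mathrm{Acc}(P)$ together with an interval of $\rho(a)$ consecutive timeslots contained in $[\mathrm{rt}(a),\mathrm{dl}(a)]$; it has the profit of $a$. A feasible solution selects at most one instance per demand such that any two selected instances on the same resource occupy disjoint sets of timeslots. Its profit is the sum of profits. $\mathrm{Opt}$ is an optimal solution. $p_{\max},p_{\min}$ are the maximum and minimum profits, and $L_{\max},L_{\min}$ are the maximum and minimum lengths of demand instances. Distributed model: synchronous message passing. Processors communicate directly iff they have a common accessible resource. Local computation is polynomial. $T_{MIS}$ is the number of rounds needed to compute a maximal independent set in an arbitrary graph with $N=nmr$ vertices. *)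

theory Defs
  imports Complex_Main
begin

subsection \<open>Local computation\<close>

text \<open>
  Data handled by a processor: binary trees whose leaves carry real numbers.  Profits are arbitrary
  reals, so local computation is measured as usual over the reals: every arithmetic operation,
  comparison and constructor costs one step.
\<close>

datatype val = Null | Num real | Pair val val

definition vlist :: "val list \<Rightarrow> val" where
  "vlist xs = foldr Pair xs Null"

primrec loop_count :: "val \<Rightarrow> nat" where
  "loop_count Null = 0"
| "loop_count (Num a) = nat \<lfloor>a\<rfloor>"
| "loop_count (Pair x xs) = Suc (loop_count xs)"

fun num_op :: "(real \<Rightarrow> real \<Rightarrow> val) \<Rightarrow> val \<Rightarrow> val" where
  "num_op f (Pair (Num a) (Num b)) = f a b"
| "num_op f _ = Null"

text \<open>
  Programs of type \<^typ>\<open>val \<Rightarrow> val\<close>.  \<open>Null\<close> is false, everything else is true.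
  \<open>Repeat p\<close> takes a pair of a counter (a number, or a list whose length counts) and a start
  value, and iterates \<open>p\<close> on the start value.  Such bounded loops
  lose nothing for polynomially many steps, since a polynomial clock can be computed by nested
  loops; they make every program total.
\<close>

datatype prog =
    Id | Const val | First | Second | IsNum | IsPair
  | Add | Sub | Mul | Div | Less
  | Tuple prog prog | Seq prog prog | Cond prog prog prog | Repeat prog

primrec eval :: "prog \<Rightarrow> val \<Rightarrow> val" where
  "eval Id x = x"
| "eval (Const c) x = c"
| "eval First x = (case x of Pair a b \<Rightarrow> a | _ \<Rightarrow> Null)"
| "eval Second x = (case x of Pair a b \<Rightarrow> b | _ \<Rightarrow> Null)"
| "eval IsNum x = (case x of Num a \<Rightarrow> Num 1 | _ \<Rightarrow> Null)"
| "eval IsPair x = (case x of Pair a b \<Rightarrow> Num 1 | _ \<Rightarrow> Null)"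
| "eval Add x = num_op (\<lambda>a b. Num (a + b)) x"
| "eval Sub x = num_op (\<lambda>a b. Num (a - b)) x"
| "eval Mul x = num_op (\<lambda>a b. Num (a * b)) x"
| "eval Div x = num_op (\<lambda>a b. Num (a / b)) x"
| "eval Less x = num_op (\<lambda>a b. if a < b then Num 1 else Null) x"
| "eval (Tuple p q) x = Pair (eval p x) (eval q x)"
| "eval (Seq p q) x = eval q (eval p x)"
| "eval (Cond b p q) x = (if eval b x \<noteq> Null then eval p x else eval q x)"
| "eval (Repeat p) x = (case x of Pair c s \<Rightarrow> (eval p ^^ loop_count c) s | _ \<Rightarrow> Null)"

primrec cost :: "prog \<Rightarrow> val \<Rightarrow> nat" where
  "cost Id x = 1"
| "cost (Const c) x = 1"
| "cost First x = 1"
| "cost Second x = 1"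
| "cost IsNum x = 1"
| "cost IsPair x = 1"
| "cost Add x = 1"
| "cost Sub x = 1"
| "cost Mul x = 1"
| "cost Div x = 1"
| "cost Less x = 1"
| "cost (Tuple p q) x = 1 + cost p x + cost q x"
| "cost (Seq p q) x = 1 + cost p x + cost q (eval p x)"
| "cost (Cond b p q) x = 1 + cost b x + (if eval b x \<noteq> Null then cost p x else cost q x)"
| "cost (Repeat p) x = (case x of
      Pair c s \<Rightarrow> 1 + (\<Sum>i<loop_count c. cost p ((eval p ^^ i) s)) | _ \<Rightarrow> 1)"


subsection \<open>Synchronous message passing\<close>

text \<open>
  The nodes of a network are identified by distinct naturals.  In every round each node broadcasts
  \<open>send\<close> of its state to its neighbours and then applies \<open>step\<close> to its state and the received
  messages (tagged with the senders, in increasing order of identifiers).  A node has halted, with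
  the value of \<open>out\<close> as its output, as soon as that value is not \<open>Null\<close>.  From then on its state
  is frozen, so outputs are irrevocable; neighbours that are still running can still see its last message.
  All nodes run the same programs and initially a node knows nothing but its own input.
\<close>

record algorithm =
  send :: prog
  step :: prog
  out :: prog

record network =
  nodes :: "nat set"
  linked :: "nat \<Rightarrow> nat \<Rightarrow> bool"
  input :: "nat \<Rightarrow> val"

definition halted :: "algorithm \<Rightarrow> val \<Rightarrow> bool" where
  "halted A s \<longleftrightarrow> eval (out A) s \<noteq> Null"

definition inbox :: "algorithm \<Rightarrow> network \<Rightarrow> (nat \<Rightarrow> val) \<Rightarrow> nat \<Rightarrow> val" where
  "inbox A G st v =
     vlist (map (\<lambda>u. Pair (Num (real u)) (eval (send A) (st u)))
                (sorted_list_of_set {u \<in> nodes G. linked G u v}))"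

primrec state :: "algorithm \<Rightarrow> network \<Rightarrow> nat \<Rightarrow> nat \<Rightarrow> val" where
  "state A G 0 = input G"
| "state A G (Suc t) = (\<lambda>v.
     if halted A (state A G t v) then state A G t v
     else eval (step A) (Pair (state A G t v) (inbox A G (state A G t) v)))"

definition node_output :: "algorithm \<Rightarrow> network \<Rightarrow> nat \<Rightarrow> nat \<Rightarrow> val" where
  "node_output A G t v = eval (out A) (state A G t v)"

definition finished :: "algorithm \<Rightarrow> network \<Rightarrow> nat \<Rightarrow> bool" where
  "finished A G t \<longleftrightarrow> (\<forall>v\<in>nodes G. halted A (state A G t v))"

definition local_cost_le :: "algorithm \<Rightarrow> network \<Rightarrow> nat \<Rightarrow> bool" where
  "local_cost_le A G B \<longleftrightarrow> (\<forall>v\<in>nodes G. \<forall>t. let s = state A G t v in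
     cost (send A) s \<le> B \<and> cost (out A) s \<le> B \<and>
     (\<not> halted A s \<longrightarrow> cost (step A) (Pair s (inbox A G (state A G t) v)) \<le> B))"


subsection \<open>Distributed computation of maximal independent sets\<close>

definition simple_graph :: "nat set \<Rightarrow> (nat \<Rightarrow> nat \<Rightarrow> bool) \<Rightarrow> bool" where
  "simple_graph V E \<longleftrightarrow> (\<forall>u\<in>V. \<not> E u u) \<and> (\<forall>u\<in>V. \<forall>v\<in>V. E u v \<longrightarrow> E v u)"

definition independent_set :: "nat set \<Rightarrow> (nat \<Rightarrow> nat \<Rightarrow> bool) \<Rightarrow> nat set \<Rightarrow> bool" where
  "independent_set V E S \<longleftrightarrow> S \<subseteq> V \<and> (\<forall>u\<in>S. \<forall>v\<in>S. \<not> E u v)"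

definition maximal_independent_set :: "nat set \<Rightarrow> (nat \<Rightarrow> nat \<Rightarrow> bool) \<Rightarrow> nat set \<Rightarrow> bool" where
  "maximal_independent_set V E S \<longleftrightarrow>
     independent_set V E S \<and> (\<forall>S'. independent_set V E S' \<and> S \<subseteq> S' \<longrightarrow> S' = S)"

text \<open>A node knows the number of nodes and its own identifier, but not its neighbours.\<close>

definition mis_network :: "nat \<Rightarrow> (nat \<Rightarrow> nat \<Rightarrow> bool) \<Rightarrow> network" where
  "mis_network N E =
     \<lparr>nodes = {..<N}, linked = E, input = (\<lambda>v. Pair (Num (real N)) (Num (real v)))\<rparr>"

text \<open>
  \<open>M\<close> computes, with polynomial local computation, a maximal independent set of an arbitrary graph
  with \<open>N\<close> vertices in \<open>T N\<close> rounds.  The vertices with output \<open>Num 1\<close> form the set.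
\<close>

definition mis_algorithm :: "algorithm \<Rightarrow> (nat \<Rightarrow> nat) \<Rightarrow> bool" where
  "mis_algorithm M T \<longleftrightarrow>
     (\<forall>N E. simple_graph {..<N} E \<longrightarrow>
        finished M (mis_network N E) (T N) \<and>
        maximal_independent_set {..<N} E {v. v < N \<and> node_output M (mis_network N E) (T N) v = Num 1}) \<and>
     (\<exists>c k. \<forall>N E. simple_graph {..<N} E \<longrightarrow> local_cost_le M (mis_network N E) (c * N ^ k))"


subsection \<open>Line-networks with windows, unit height\<close>

text \<open>
  Processors are \<open>0, \<dots>, m - 1\<close>, resources \<open>0, \<dots>, r - 1\<close>, timeslots \<open>1, \<dots>, n\<close>.
  The demand owned by processor \<open>P\<close> is identified with \<open>P\<close>.
\<close>

record line_network =
  slots_n :: nat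
  procs_m :: nat
  ress_r :: nat
  rt :: "nat \<Rightarrow> nat"
  dl :: "nat \<Rightarrow> nat"
  ptime :: "nat \<Rightarrow> nat"
  profit :: "nat \<Rightarrow> real"
  Acc :: "nat \<Rightarrow> nat set"

definition wf_line :: "line_network \<Rightarrow> bool" where
  "wf_line I \<longleftrightarrow> procs_m I \<ge> 1 \<and>
     (\<forall>P<procs_m I. 1 \<le> rt I P \<and> dl I P \<le> slots_n I \<and> 1 \<le> ptime I P \<and> 0 < profit I P
        \<and> Acc I P \<subseteq> {..<ress_r I})"

text \<open>\<open>(P, R, s)\<close> stands for executing demand \<open>P\<close> on resource \<open>R\<close> from timeslot \<open>s\<close> on.\<close>

type_synonym dinst = "nat \<times> nat \<times> nat"

fun demand_of :: "dinst \<Rightarrow> nat" where "demand_of (P, R, s) = P"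
fun resource_of :: "dinst \<Rightarrow> nat" where "resource_of (P, R, s) = R"
fun occupied :: "line_network \<Rightarrow> dinst \<Rightarrow> nat set" where
  "occupied I (P, R, s) = {s..<s + ptime I P}"

definition instances :: "line_network \<Rightarrow> dinst set" where
  "instances I = {(P, R, s) | P R s. P < procs_m I \<and> R \<in> Acc I P \<and>
                    occupied I (P, R, s) \<subseteq> {rt I P..dl I P}}"

definition feasible :: "line_network \<Rightarrow> dinst set \<Rightarrow> bool" where
  "feasible I S \<longleftrightarrow> S \<subseteq> instances I \<and>
     (\<forall>d\<in>S. \<forall>d'\<in>S. d \<noteq> d' \<longrightarrow> demand_of d \<noteq> demand_of d' \<and>
        (resource_of d = resource_of d' \<longrightarrow> occupied I d \<inter> occupied I d' = {}))"

definition total_profit :: "line_network \<Rightarrow> dinst set \<Rightarrow> real" where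
  "total_profit I S = (\<Sum>d\<in>S. profit I (demand_of d))"

definition opt_profit :: "line_network \<Rightarrow> real" where
  "opt_profit I = Max (total_profit I ` {S. feasible I S})"

definition p_max :: "line_network \<Rightarrow> real" where
  "p_max I = Max (profit I ` {..<procs_m I})"

definition p_min :: "line_network \<Rightarrow> real" where
  "p_min I = Min (profit I ` {..<procs_m I})"

text \<open>
  If there is no demand instance at all, \<open>L_max\<close> and \<open>L_min\<close> are unspecified; this does no harm
  below because \<open>lg\<close> is bounded from below by 1.
\<close>

definition L_max :: "line_network \<Rightarrow> nat" where
  "L_max I = Max ((\<lambda>d. card (occupied I d)) ` instances I)"

definition L_min :: "line_network \<Rightarrow> nat" where
  "L_min I = Min ((\<lambda>d. card (occupied I d)) ` instances I)"

text \<open>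
  The usual convention for logarithms inside asymptotic bounds: a factor never drops below 1
  (all profits may be equal, all lengths may be equal, \<open>\<epsilon>\<close> may exceed 1).
\<close>

definition lg :: "real \<Rightarrow> real" where
  "lg x = max 1 (log 2 x)"

text \<open>
  A processor initially knows \<open>n\<close>, \<open>m\<close>, \<open>r\<close>, its identifier, its own demand and its accessible
  resources; it knows neither the other processors nor the extremal profits and lengths.
\<close>

definition line_comm :: "line_network \<Rightarrow> network" where
  "line_comm I =
     \<lparr>nodes = {..<procs_m I},
      linked = (\<lambda>P Q. P \<noteq> Q \<and> Acc I P \<inter> Acc I Q \<noteq> {}),
      input = (\<lambda>P. vlist
        [Num (real (slots_n I)), Num (real (procs_m I)), Num (real (ress_r I)), Num (real P),
         Num (real (rt I P)), Num (real (dl I P)), Num (real (ptime I P)), Num (profit I P),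
         vlist (map (\<lambda>R. Num (real R)) (sorted_list_of_set (Acc I P)))])\<rparr>"

text \<open>
  A processor selects the instance of its demand on resource \<open>R\<close> starting at \<open>s\<close> by the output
  \<open>Pair (Num R) (Num s)\<close>; any other output different from \<open>Null\<close> rejects its demand.
\<close>

definition solution :: "algorithm \<Rightarrow> line_network \<Rightarrow> nat \<Rightarrow> dinst set" where
  "solution A I t = {(P, R, s) | P R s. P < procs_m I \<and>
     node_output A (line_comm I) t P = Pair (Num (real R)) (Num (real s))}"

definition poly_local :: "algorithm \<Rightarrow> bool" where
  "poly_local A \<longleftrightarrow> (\<exists>c k. \<forall>I. wf_line I \<longrightarrow>
     local_cost_le A (line_comm I) (c * (slots_n I + procs_m I + ress_r I) ^ k))"

end

theory Submission
  imports Defs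
begin

text \<open>
  The algorithm raises the dual variables of the linear programming relaxation in steps.  In every step
  each demand instance whose dual constraint is still unsatisfied and whose key (length class, then the
  logarithm of its relative slack) is minimal among the conflicting unsatisfied instances is active, a
  maximal independent set of active instances is computed by \<open>M\<close>, and its members become tight by a
  quarter of their slack going to the demand and to three critical points.  The keys order length
  classes and slack levels without any global coordination.  An instance that survives a step with
  its key unchanged was hit by a raised instance of less than half its profit, hence each key is exhausted
  after logarithmically many steps.  Finally the raised instances are selected greedily in reverse order.

  No processor knows the running time of \<open>M\<close>, the extremal lengths or the extremal profits.  Therefore
  a processor advances whenever no running neighbour is behind it, and broadcasts its current and its
  previous data.  The global run then proceeds at least as fast as a synchronized one.

  A program whose loops all run at most \<open>B\<close> times costs at most a polynomial in \<open>B\<close> that depends on the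
  program only; so for the local cost it suffices to bound the lengths of the lists that occur, and the
  cost of the calls of \<open>M\<close>.
\<close>

section \<open>Cost bounds for programs\<close>

text \<open>The ratio 4 is the number of dual variables that one raise increases. The midpoint is
  among them because a conflicting instance may lie strictly inside the raised one; restricting the
  length ratio to 2 forces it to cover the midpoint, which is why keys compare lengths before
  slacks. The base 9/8 of the slack levels is just fine enough: a raise costs the survivor a quarter
  of the raised slack, while relative slacks on one level differ by a factor below 9/8, which leaves
  the raised instance less than half of the survivor's profit. With \<theta> = \<epsilon> / (4 +
  \<epsilon>), accepting a constraint whose slack is at most a fraction \<theta> of its profit turns
  4 into 4 + \<epsilon>, and O(log (1/\<epsilon>)) levels reach down to \<theta>. The time bound has
  no additive term, yet \<open>T_MIS\<close> may vanish for fewer than two vertices. That case is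
  answered on the bare input, without communication; otherwise \<open>T_MIS\<close> is at least 1
  and absorbs all bookkeeping rounds.\<close>

primrec loops_le :: "nat \<Rightarrow> prog \<Rightarrow> val \<Rightarrow> bool" where
  "loops_le B Id x = True"
| "loops_le B (Const c) x = True"
| "loops_le B First x = True"
| "loops_le B Second x = True"
| "loops_le B IsNum x = True"
| "loops_le B IsPair x = True"
| "loops_le B Add x = True"
| "loops_le B Sub x = True"
| "loops_le B Mul x = True"
| "loops_le B Div x = True"
| "loops_le B Less x = True"
| "loops_le B (Tuple p q) x = (loops_le B p x \<and> loops_le B q x)"
| "loops_le B (Seq p q) x = (loops_le B p x \<and> loops_le B q (eval p x))"
| "loops_le B (Cond b p q) x = (loops_le B b x \<and>
     (if eval b x \<noteq> Null then loops_le B p x else loops_le B q x))"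
| "loops_le B (Repeat p) x = (case x of
      Pair c s \<Rightarrow> loop_count c \<le> B \<and> (\<forall>i<loop_count c. loops_le B p ((eval p ^^ i) s)) | _ \<Rightarrow> True)"

primrec cost_bound :: "nat \<Rightarrow> prog \<Rightarrow> nat" where
  "cost_bound B Id = 1"
| "cost_bound B (Const c) = 1"
| "cost_bound B First = 1"
| "cost_bound B Second = 1"
| "cost_bound B IsNum = 1"
| "cost_bound B IsPair = 1"
| "cost_bound B Add = 1"
| "cost_bound B Sub = 1"
| "cost_bound B Mul = 1"
| "cost_bound B Div = 1"
| "cost_bound B Less = 1"
| "cost_bound B (Tuple p q) = 1 + cost_bound B p + cost_bound B q"
| "cost_bound B (Seq p q) = 1 + cost_bound B p + cost_bound B q"
| "cost_bound B (Cond b p q) = 1 + cost_bound B b + cost_bound B p + cost_bound B q"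
| "cost_bound B (Repeat p) = 1 + B * cost_bound B p"

lemma cost_le_cost_bound: "loops_le B p x \<Longrightarrow> cost p x \<le> cost_bound B p"
proof (induction p arbitrary: x)
  case (Tuple p1 p2)
  then show ?case by (simp add: add_mono)
next
  case (Seq p1 p2)
  then show ?case by (simp add: add_mono)
next
  case (Cond b p q)
  have "cost b x \<le> cost_bound B b" using Cond by auto
  moreover have "eval b x \<noteq> Null \<Longrightarrow> cost p x \<le> cost_bound B p" using Cond by auto
  moreover have "eval b x = Null \<Longrightarrow> cost q x \<le> cost_bound B q" using Cond by auto
  ultimately show ?case by auto
next
  case (Repeat p)
  show ?case
  proof (cases x)
    case (Pair c s)
    have "(\<Sum>i<loop_count c. cost p ((eval p ^^ i) s)) \<le> (\<Sum>i<loop_count c. cost_bound B p)"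
      using Repeat Pair by (intro sum_mono) auto
    also have "\<dots> \<le> B * cost_bound B p" using Repeat.prems Pair by simp
    finally show ?thesis using Pair by simp
  qed auto
qed auto

lemma cost_pos: "0 < cost p x"
  by (cases p; cases x) auto

text \<open>Every instruction costs at least 1, so a loop that stays within cost \<open>B\<close>
  runs at most \<open>B\<close> times. This converse brings in \<open>M\<close>, of which only the
  total cost is known.\<close>

lemma loops_le_cost: "cost p x \<le> B \<Longrightarrow> loops_le B p x"
proof (induction p arbitrary: x)
  case (Repeat p)
  show ?case
  proof (cases x)
    case (Pair c s)
    let ?f = "\<lambda>i. cost p ((eval p ^^ i) s)"
    have *: "(\<Sum>i<loop_count c. ?f i) \<le> B" using Repeat.prems Pair by simp
    have "loop_count c = (\<Sum>i<loop_count c. 1)" by simp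
    also have "\<dots> \<le> (\<Sum>i<loop_count c. ?f i)"
      using cost_pos by (intro sum_mono) (simp add: Suc_leI)
    finally have 1: "loop_count c \<le> B" using * by simp
    have "?f i \<le> B" if "i < loop_count c" for i
    proof -
      have "?f i \<le> (\<Sum>i<loop_count c. ?f i)" using that by (intro member_le_sum) auto
      then show ?thesis using * by simp
    qed
    then show ?thesis using 1 Pair Repeat.IH by simp
  qed auto
qed auto

lemma poly_bound_mono:
  fixes x :: nat
  assumes "x \<le> c * (B + 1) ^ k" "k \<le> K"
  shows "x \<le> c * (B + 1) ^ K"
  using assms by (meson le_add2 mult_le_mono2 order_trans power_increasing)

text \<open>The base \<open>B + 1\<close> never drops below 1, so two exponents can both be raised
  to their sum; \<open>Repeat\<close> alone multiplies by a factor \<open>B\<close>.\<close>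

lemma cost_bound_poly: "\<exists>c k. \<forall>B. cost_bound B p \<le> c * (B + 1) ^ k"
proof (induction p)
  case (Tuple p q)
  then obtain c k c' k' where *: "\<And>B. cost_bound B p \<le> c * (B + 1) ^ k"
    "\<And>B. cost_bound B q \<le> c' * (B + 1) ^ k'" by blast
  have "cost_bound B (Tuple p q) \<le> (1 + c + c') * (B + 1) ^ (k + k')" for B
  proof -
    define Q where "Q = (B + 1) ^ (k + k')"
    have "cost_bound B p \<le> c * Q" "cost_bound B q \<le> c' * Q" "1 \<le> Q"
      using poly_bound_mono[OF *(1)[of B], of "k + k'"] poly_bound_mono[OF *(2)[of B], of "k + k'"]
        one_le_power[of "B + 1"] unfolding Q_def by (simp_all del: One_nat_def)
    then have "cost_bound B (Tuple p q) \<le> (1 + c + c') * Q" by (simp add: algebra_simps)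
    then show ?thesis by (simp add: Q_def)
  qed
  then show ?case by blast
next
  case (Seq p q)
  then obtain c k c' k' where *: "\<And>B. cost_bound B p \<le> c * (B + 1) ^ k"
    "\<And>B. cost_bound B q \<le> c' * (B + 1) ^ k'" by blast
  have "cost_bound B (Seq p q) \<le> (1 + c + c') * (B + 1) ^ (k + k')" for B
  proof -
    define Q where "Q = (B + 1) ^ (k + k')"
    have "cost_bound B p \<le> c * Q" "cost_bound B q \<le> c' * Q" "1 \<le> Q"
      using poly_bound_mono[OF *(1)[of B], of "k + k'"] poly_bound_mono[OF *(2)[of B], of "k + k'"]
        one_le_power[of "B + 1"] unfolding Q_def by (simp_all del: One_nat_def)
    then have "cost_bound B (Seq p q) \<le> (1 + c + c') * Q" by (simp add: algebra_simps)
    then show ?thesis by (simp add: Q_def)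
  qed
  then show ?case by blast
next
  case (Cond b p q)
  then obtain c k c' k' c'' k'' where *: "\<And>B. cost_bound B p \<le> c * (B + 1) ^ k"
    "\<And>B. cost_bound B q \<le> c' * (B + 1) ^ k'" "\<And>B. cost_bound B b \<le> c'' * (B + 1) ^ k''" by blast
  have "cost_bound B (Cond b p q) \<le> (1 + c'' + c + c') * (B + 1) ^ (k + k' + k'')" for B
  proof -
    define Q where "Q = (B + 1) ^ (k + k' + k'')"
    have "cost_bound B p \<le> c * Q" "cost_bound B q \<le> c' * Q" "cost_bound B b \<le> c'' * Q" "1 \<le> Q"
      unfolding Q_def
      using poly_bound_mono[OF *(1)[of B], of "k + k' + k''"] poly_bound_mono[OF *(2)[of B], of "k + k' + k''"]
        poly_bound_mono[OF *(3)[of B], of "k + k' + k''"] one_le_power[of "B + 1"] by (simp_all del: One_nat_def)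
    then have "cost_bound B (Cond b p q) \<le> (1 + c'' + c + c') * Q" by (simp add: algebra_simps)
    then show ?thesis by (simp add: Q_def)
  qed
  then show ?case by blast
next
  case (Repeat p)
  then obtain c k where *: "\<And>B. cost_bound B p \<le> c * (B + 1) ^ k" by blast
  have "cost_bound B (Repeat p) \<le> (1 + c) * (B + 1) ^ (Suc k)" for B
  proof -
    have "B * cost_bound B p \<le> (B + 1) * (c * (B + 1) ^ k)" using * by (intro mult_le_mono) auto
    moreover have "1 \<le> (B + 1) ^ Suc k" by (rule one_le_power) simp
    ultimately have "1 + B * cost_bound B p \<le> (B + 1) ^ Suc k + (B + 1) * (c * (B + 1) ^ k)"
      by (rule add_mono[rotated])
    also have "\<dots> = (1 + c) * (B + 1) ^ (Suc k)" by (simp add: algebra_simps)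
    finally show ?thesis by simp
  qed
  then show ?case by blast
qed (rule exI[of _ 1], rule exI[of _ 0], simp)+


section \<open>Program combinators\<close>

text \<open>Loop bound and result are stated together because the loops of a later program depend on
  the value computed by an earlier one.\<close>

definition runs :: "nat \<Rightarrow> prog \<Rightarrow> val \<Rightarrow> val \<Rightarrow> bool" where
  "runs B p x y \<longleftrightarrow> loops_le B p x \<and> eval p x = y"

lemma runs_Seq: "runs B p x y \<Longrightarrow> runs B q y z \<Longrightarrow> runs B (Seq p q) x z"
  by (auto simp: runs_def)

lemma runs_Tuple: "runs B p x y \<Longrightarrow> runs B q x z \<Longrightarrow> runs B (Tuple p q) x (Pair y z)"
  by (auto simp: runs_def)

definition vbool :: "bool \<Rightarrow> val" where
  "vbool b = (if b then Num 1 else Null)"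

lemma vbool_eq_Null [simp]: "vbool b = Null \<longleftrightarrow> \<not> b" "Null = vbool b \<longleftrightarrow> \<not> b"
  by (simp_all add: vbool_def)

lemma vbool_eq_iff [simp]: "vbool a = vbool b \<longleftrightarrow> a = b"
  by (simp add: vbool_def)

lemma runs_Cond:
  "runs B b x (vbool t) \<Longrightarrow> (t \<Longrightarrow> runs B p x y) \<Longrightarrow> (\<not> t \<Longrightarrow> runs B q x z) \<Longrightarrow>
   runs B (Cond b p q) x (if t then y else z)"
  by (auto simp: runs_def)

primrec loopfree :: "prog \<Rightarrow> bool" where
  "loopfree Id = True"
| "loopfree (Const c) = True"
| "loopfree First = True"
| "loopfree Second = True"
| "loopfree IsNum = True"
| "loopfree IsPair = True"
| "loopfree Add = True"
| "loopfree Sub = True"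
| "loopfree Mul = True"
| "loopfree Div = True"
| "loopfree Less = True"
| "loopfree (Tuple p q) = (loopfree p \<and> loopfree q)"
| "loopfree (Seq p q) = (loopfree p \<and> loopfree q)"
| "loopfree (Cond b p q) = (loopfree b \<and> loopfree p \<and> loopfree q)"
| "loopfree (Repeat p) = False"

lemma loopfree_loops_le: "loopfree p \<Longrightarrow> loops_le B p x"
  by (induction p arbitrary: x) auto

lemma runs_loopfree: "loopfree p \<Longrightarrow> eval p x = y \<Longrightarrow> runs B p x y"
  by (simp add: runs_def loopfree_loops_le)

lemma vlist_simps: "vlist [] = Null" "vlist (x # xs) = Pair x (vlist xs)"
  by (simp_all add: vlist_def)

lemma vlist_eq_Null [simp]: "vlist xs = Null \<longleftrightarrow> xs = []" "Null = vlist xs \<longleftrightarrow> xs = []"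
  by (cases xs; simp add: vlist_simps)+

lemma loop_count_vlist [simp]: "loop_count (vlist xs) = length xs"
  by (induction xs) (auto simp: vlist_simps)

primrec sel :: "nat \<Rightarrow> prog" where
  "sel 0 = First"
| "sel (Suc k) = Seq Second (sel k)"

lemma eval_sel [simp]: "k < length xs \<Longrightarrow> eval (sel k) (vlist xs) = xs ! k"
proof (induction k arbitrary: xs)
  case 0
  then show ?case by (cases xs) (auto simp: vlist_simps)
next
  case (Suc k)
  then show ?case by (cases xs) (auto simp: vlist_simps)
qed

lemma loopfree_sel [simp]: "loopfree (sel k)"
  by (induction k) auto

primrec tup :: "prog list \<Rightarrow> prog" where
  "tup [] = Const Null"
| "tup (p # ps) = Tuple p (tup ps)"

lemma eval_tup [simp]: "eval (tup ps) x = vlist (map (\<lambda>p. eval p x) ps)"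
  by (induction ps) (auto simp: vlist_simps)

lemma loopfree_tup [simp]: "loopfree (tup ps) \<longleftrightarrow> (\<forall>p\<in>set ps. loopfree p)"
  by (induction ps) auto

definition letp :: "prog \<Rightarrow> prog \<Rightarrow> prog" where
  "letp p q = Seq (Tuple p Id) q"

lemma eval_letp [simp]: "eval (letp p q) x = eval q (Pair (eval p x) x)"
  by (simp add: letp_def)

lemma loopfree_letp [simp]: "loopfree (letp p q) \<longleftrightarrow> loopfree p \<and> loopfree q"
  by (simp add: letp_def)

lemma runs_letp: "runs B p x y \<Longrightarrow> runs B q (Pair y x) z \<Longrightarrow> runs B (letp p q) x z"
  by (auto simp: runs_def letp_def)

definition notp :: "prog \<Rightarrow> prog" where
  "notp p = Cond p (Const Null) (Const (Num 1))"

definition andp :: "prog \<Rightarrow> prog \<Rightarrow> prog" where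
  "andp p q = Cond p q (Const Null)"

definition orp :: "prog \<Rightarrow> prog \<Rightarrow> prog" where
  "orp p q = Cond p (Const (Num 1)) q"

definition lessp :: "prog \<Rightarrow> prog \<Rightarrow> prog" where
  "lessp p q = Seq (Tuple p q) Less"

definition eqp :: "prog \<Rightarrow> prog \<Rightarrow> prog" where
  "eqp p q = notp (orp (lessp p q) (lessp q p))"

definition arithp :: "prog \<Rightarrow> prog \<Rightarrow> prog \<Rightarrow> prog" where
  "arithp f p q = Seq (Tuple p q) f"

lemma loopfree_boolean [simp]:
  "loopfree (notp p) = loopfree p"
  "loopfree (andp p q) = (loopfree p \<and> loopfree q)"
  "loopfree (orp p q) = (loopfree p \<and> loopfree q)"
  "loopfree (lessp p q) = (loopfree p \<and> loopfree q)"
  "loopfree (eqp p q) = (loopfree p \<and> loopfree q)"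
  "loopfree (arithp f p q) = (loopfree f \<and> loopfree p \<and> loopfree q)"
  by (auto simp: notp_def andp_def orp_def lessp_def eqp_def arithp_def)

lemma eval_notp [simp]: "eval (notp p) x = vbool (eval p x = Null)"
  by (simp add: notp_def vbool_def)

lemma eval_andp [simp]: "eval q x = vbool b \<Longrightarrow> eval (andp p q) x = vbool (eval p x \<noteq> Null \<and> b)"
  by (simp add: andp_def vbool_def)

lemma eval_orp [simp]: "eval q x = vbool b \<Longrightarrow> eval (orp p q) x = vbool (eval p x \<noteq> Null \<or> b)"
  by (simp add: orp_def vbool_def)

lemma eval_lessp [simp]:
  "eval p x = Num a \<Longrightarrow> eval q x = Num b \<Longrightarrow> eval (lessp p q) x = vbool (a < b)"
  by (simp add: lessp_def vbool_def)

lemma eval_eqp [simp]: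
  "eval p x = Num a \<Longrightarrow> eval q x = Num b \<Longrightarrow> eval (eqp p q) x = vbool (a = b)"
  by (simp add: eqp_def) (auto simp: not_less)

lemma eval_arithp [simp]:
  "eval p x = Num a \<Longrightarrow> eval q x = Num b \<Longrightarrow> eval (arithp Add p q) x = Num (a + b)"
  "eval p x = Num a \<Longrightarrow> eval q x = Num b \<Longrightarrow> eval (arithp Sub p q) x = Num (a - b)"
  "eval p x = Num a \<Longrightarrow> eval q x = Num b \<Longrightarrow> eval (arithp Mul p q) x = Num (a * b)"
  by (simp_all add: arithp_def)

lemma runs_andp:
  "runs B p x (vbool a) \<Longrightarrow> (a \<Longrightarrow> runs B q x (vbool b)) \<Longrightarrow> runs B (andp p q) x (vbool (a \<and> b))"
  by (auto simp: runs_def andp_def vbool_def)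

section \<open>Loops over lists and numbers\<close>

text \<open>\<open>foldp b\<close> expects \<open>Pair list (Pair accumulator environment)\<close>.\<close>

definition foldp :: "prog \<Rightarrow> prog" where
  "foldp b = Seq (Seq (Tuple First Id) (Repeat
     (Tuple (Seq First Second)
        (Tuple (Seq (Tuple (Seq First First) Second) b) (Seq Second Second)))))
     (Seq Second First)"

text \<open>The list is its own loop counter, since \<open>loop_count\<close> of a list is its
  length. The encoders \<open>ex\<close> and \<open>ea\<close> allow the body to be specified on
  abstract elements and accumulators.\<close>

lemma runs_foldp:
  assumes b: "\<And>x a. x \<in> set xs \<Longrightarrow> runs B b (Pair (ex x) (Pair (ea a) e)) (ea (f x a))"
    and len: "length xs \<le> B"
  shows "runs B (foldp b) (Pair (vlist (map ex xs)) (Pair (ea a) e)) (ea (fold f xs a))"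
proof -
  define body where "body = Tuple (Seq First Second)
        (Tuple (Seq (Tuple (Seq First First) Second) b) (Seq Second Second))"
  let ?s = "\<lambda>i. Pair (vlist (map ex (drop i xs))) (Pair (ea (fold f (take i xs) a)) e)"
  have step: "runs B body (?s i) (?s (Suc i))" if i: "i < length xs" for i
  proof -
    have d: "drop i xs = xs ! i # drop (Suc i) xs" using i by (simp add: Cons_nth_drop_Suc)
    have t: "take (Suc i) xs = take i xs @ [xs ! i]" using i by (simp add: take_Suc_conv_app_nth)
    have "runs B b (Pair (ex (xs ! i)) (Pair (ea (fold f (take i xs) a)) e))
      (ea (f (xs ! i) (fold f (take i xs) a)))" using i by (intro b) auto
    then show ?thesis by (simp add: runs_def d t vlist_simps body_def)
  qed
  have iter: "(eval body ^^ i) (?s 0) = ?s i" if "i \<le> length xs" for i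
    using that
  proof (induction i)
    case (Suc i)
    then have "(eval body ^^ Suc i) (?s 0) = eval body (?s i)" by simp
    also have "\<dots> = ?s (Suc i)" using step[of i] Suc.prems by (auto simp: runs_def)
    finally show ?case .
  qed simp
  have "loops_le B body ((eval body ^^ i) (?s 0))" if "i < length xs" for i
    using step[OF that] iter[of i] that by (auto simp: runs_def)
  then show ?thesis using len iter[of "length xs"]
    by (simp add: runs_def foldp_def flip: body_def)
qed

definition revp :: prog where
  "revp = Seq (Tuple Id (Tuple (Const Null) (Const Null)))
     (foldp (Tuple First (Seq Second First)))"

definition appendp :: prog where
  "appendp = Seq (Tuple (Seq First revp) (Tuple Second (Const Null)))
     (foldp (Tuple First (Seq Second First)))"

lemma runs_consfold:
  assumes "length xs \<le> B"
  shows "runs B (foldp (Tuple First (Seq Second First)))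
     (Pair (vlist xs) (Pair (vlist ys) e)) (vlist (rev xs @ ys))"
proof -
  have "runs B (foldp (Tuple First (Seq Second First)))
     (Pair (vlist (map id xs)) (Pair (vlist ys) e)) (vlist (fold Cons xs ys))"
    by (rule runs_foldp[OF _ assms]) (simp add: runs_def vlist_simps)
  moreover have "fold Cons xs ys = rev xs @ ys" by (induction xs arbitrary: ys) auto
  ultimately show ?thesis by simp
qed

lemma runs_revp: "length xs \<le> B \<Longrightarrow> runs B revp (vlist xs) (vlist (rev xs))"
  using runs_consfold[of xs B "[]" Null] by (simp add: revp_def runs_def vlist_simps)

lemma runs_appendp: "length xs \<le> B \<Longrightarrow> runs B appendp (Pair (vlist xs) (vlist ys)) (vlist (xs @ ys))"
  using runs_consfold[of "rev xs" B ys Null] runs_revp[of xs B]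
  by (simp add: appendp_def runs_def)

text \<open>\<open>bindp b\<close> expects \<open>Pair list environment\<close>.\<close>

definition bindp :: "prog \<Rightarrow> prog" where
  "bindp b = Seq (Seq (Tuple First (Tuple (Const Null) Second))
     (foldp (Seq (Tuple (Seq (Tuple First (Seq Second Second)) b)
                    (Tuple (Seq Second First) (Const Null)))
        (foldp (Tuple First (Seq Second First)))))) revp"

text \<open>The result is accumulated in reverse and turned around at the end. The inner loop runs
  over \<open>f x\<close> and the final one over the whole result, hence the bound on the length of
  the concatenation.\<close>

lemma runs_bindp:
  assumes b: "\<And>x. x \<in> set xs \<Longrightarrow> runs B b (Pair (ex x) e) (vlist (map ey (f x)))"
    and len: "length xs \<le> B" "length (concat (map f xs)) \<le> B"
  shows "runs B (bindp b) (Pair (vlist (map ex xs)) e) (vlist (map ey (concat (map f xs))))"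
proof -
  let ?g = "\<lambda>x a. rev (f x) @ a"
  let ?b = "Seq (Tuple (Seq (Tuple First (Seq Second Second)) b)
                    (Tuple (Seq Second First) (Const Null)))
        (foldp (Tuple First (Seq Second First)))"
  have fold: "fold ?g xs a = rev (concat (map f xs)) @ a" for a
    by (induction xs arbitrary: a) auto
  have "runs B ?b (Pair (ex x) (Pair (vlist (map ey a)) e)) (vlist (map ey (?g x a)))"
    if x: "x \<in> set xs" for x a
  proof -
    obtain us vs where "xs = us @ x # vs" using x by (meson split_list)
    then have "length (map ey (f x)) \<le> B" using len(2) by simp
    from runs_consfold[OF this, of "map ey a" Null] b[OF x]
    show ?thesis by (simp add: runs_def rev_map)
  qed
  from runs_foldp[where ea = "\<lambda>a. vlist (map ey a)" and f = ?g and a = "[]", OF this len(1)]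
  have "runs B (foldp ?b) (Pair (vlist (map ex xs)) (Pair Null e))
      (vlist (map ey (rev (concat (map f xs)))))" by (simp add: fold vlist_simps)
  moreover have "runs B revp (vlist (map ey (rev (concat (map f xs)))))
      (vlist (map ey (concat (map f xs))))"
    using runs_revp[of "map ey (rev (concat (map f xs)))" B] len(2)
    by (simp only: length_map length_rev rev_map[symmetric] rev_rev_ident)
  ultimately show ?thesis by (simp add: bindp_def runs_def)
qed

lemma concat_filter: "concat (map (\<lambda>x. if P x then [g x] else []) xs) = map g (filter P xs)"
  by (induction xs) auto

lemma runs_bindp_filter:
  assumes b: "\<And>x. x \<in> set xs \<Longrightarrow> runs B b (Pair (ex x) e) (if P x then vlist [ey (g x)] else Null)"
    and len: "length xs \<le> B"
  shows "runs B (bindp b) (Pair (vlist (map ex xs)) e) (vlist (map ey (map g (filter P xs))))"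
proof -
  have "runs B b (Pair (ex x) e) (vlist (map ey (if P x then [g x] else [])))" if "x \<in> set xs" for x
    using b[OF that] by (auto simp: vlist_simps split: if_splits)
  from runs_bindp[where f = "\<lambda>x. if P x then [g x] else []", OF this len] len
  show ?thesis unfolding concat_filter by (simp add: le_trans[OF length_filter_le])
qed

definition allp :: "prog \<Rightarrow> prog" where
  "allp b = Seq (Tuple First (Tuple (Const (Num 1)) Second))
     (foldp (andp (Seq Second First) (Seq (Tuple First (Seq Second Second)) b)))"

lemma runs_allp:
  assumes b: "\<And>x. x \<in> set xs \<Longrightarrow> runs B b (Pair (ex x) e) (vbool (P x))"
    and len: "length xs \<le> B"
  shows "runs B (allp b) (Pair (vlist (map ex xs)) e) (vbool (\<forall>x\<in>set xs. P x))"
proof -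
  let ?b = "andp (Seq Second First) (Seq (Tuple First (Seq Second Second)) b)"
  have "runs B ?b (Pair (ex x) (Pair (vbool a) e)) (vbool (a \<and> P x))" if "x \<in> set xs" for x a
    by (rule runs_andp) (use b[OF that] in \<open>auto simp: runs_def\<close>)
  from runs_foldp[where ea = vbool and f = "\<lambda>x a. a \<and> P x" and a = True, OF this len]
  have "runs B (foldp ?b) (Pair (vlist (map ex xs)) (Pair (vbool True) e))
     (vbool (fold (\<lambda>x a. a \<and> P x) xs True))" .
  moreover have "fold (\<lambda>x a. a \<and> P x) xs t \<longleftrightarrow> t \<and> (\<forall>x\<in>set xs. P x)" for t
    by (induction xs arbitrary: t) auto
  ultimately show ?thesis by (simp add: allp_def runs_def vbool_def)
qed

definition sump :: "prog \<Rightarrow> prog" where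
  "sump b = Seq (Tuple First (Tuple (Const (Num 0)) Second))
     (foldp (arithp Add (Seq Second First) (Seq (Tuple First (Seq Second Second)) b)))"

lemma runs_sump:
  assumes b: "\<And>x. x \<in> set xs \<Longrightarrow> runs B b (Pair (ex x) e) (Num (g x))"
    and len: "length xs \<le> B"
  shows "runs B (sump b) (Pair (vlist (map ex xs)) e) (Num (\<Sum>x\<leftarrow>xs. g x))"
proof -
  let ?b = "arithp Add (Seq Second First) (Seq (Tuple First (Seq Second Second)) b)"
  have "runs B ?b (Pair (ex x) (Pair (Num a) e)) (Num (a + g x))" if "x \<in> set xs" for x a
    using b[OF that] by (auto simp: runs_def arithp_def)
  from runs_foldp[where ea = Num and f = "\<lambda>x a. a + g x" and a = 0, OF this len]
  have "runs B (foldp ?b) (Pair (vlist (map ex xs)) (Pair (Num 0) e))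
     (Num (fold (\<lambda>x a. a + g x) xs 0))" .
  moreover have "fold (\<lambda>x a. a + g x) xs t = t + (\<Sum>x\<leftarrow>xs. g x)" for t
    by (induction xs arbitrary: t) auto
  ultimately show ?thesis by (simp add: sump_def runs_def)
qed

text \<open>The number serves both as loop counter and as countdown; consing while counting down
  yields an increasing list.\<close>

definition rangep :: prog where
  "rangep = Seq (Seq (Tuple Id (Tuple Id (Const Null)))
     (Repeat (Seq (Tuple (arithp Sub First (Const (Num 1))) Second) (Tuple First Id)))) Second"

lemma runs_rangep:
  assumes "k \<le> B"
  shows "runs B rangep (Num (real k)) (vlist (map (\<lambda>i. Num (real i)) [0..<k]))"
proof -
  let ?b = "Seq (Tuple (arithp Sub First (Const (Num 1))) Second) (Tuple First Id)"
  have iter: "(eval ?b ^^ i) (Pair (Num (real k)) Null) =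
     Pair (Num (real (k - i))) (vlist (map (\<lambda>i. Num (real i)) [k - i..<k]))" if "i \<le> k" for i
    using that
  proof (induction i)
    case (Suc i)
    then have "[k - Suc i..<k] = (k - Suc i) # [k - i..<k]"
      by (metis Suc_diff_Suc Suc_le_lessD diff_Suc_less less_le_trans upt_conv_Cons zero_less_Suc Suc_leD diff_less)
    then show ?case using Suc by (simp add: vlist_simps of_nat_diff)
  qed (simp add: vlist_simps)
  show ?thesis using iter[of k] assms
    by (simp add: rangep_def runs_def loopfree_loops_le del: eval.simps(12,13))
       (simp add: loopfree_loops_le)
qed

text \<open>\<open>powcountp q\<close> expects \<open>Pair counter (Pair a x)\<close>.\<close>

definition powcountp :: "real \<Rightarrow> prog" where
  "powcountp q = Seq (Seq (Tuple First (Seq Second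
        (Tuple First (Tuple Second (Const (Num 0))))))
     (Repeat (letp (arithp Mul First (Const (Num q)))
        (Tuple First (Tuple (Seq Second (Seq Second First))
           (Cond (lessp (Seq Second (Seq Second First)) First)
              (Seq Second (Seq Second Second))
              (arithp Add (Seq Second (Seq Second Second)) (Const (Num 1)))))))))
     (Seq Second Second)"

text \<open>The machine offers no logarithm. Counting the exponents whose power still fits replaces
  a rounded logarithm.\<close>

lemma runs_powcountp:
  assumes "k \<le> B"
  shows "runs B (powcountp q) (Pair (Num (real k)) (Pair (Num a) (Num x)))
    (Num (real (card {j\<in>{1..k}. a * q ^ j \<le> x})))"
proof -
  let ?b = "letp (arithp Mul First (Const (Num q)))
        (Tuple First (Tuple (Seq Second (Seq Second First))
           (Cond (lessp (Seq Second (Seq Second First)) First)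
              (Seq Second (Seq Second Second))
              (arithp Add (Seq Second (Seq Second Second)) (Const (Num 1))))))"
  have iter: "(eval ?b ^^ i) (Pair (Num a) (Pair (Num x) (Num 0))) =
     Pair (Num (a * q ^ i)) (Pair (Num x) (Num (real (card {j\<in>{1..i}. a * q ^ j \<le> x}))))" for i
  proof (induction i)
    case (Suc i)
    have "{j\<in>{1..Suc i}. a * q ^ j \<le> x} =
      (if a * q ^ Suc i \<le> x then insert (Suc i) {j\<in>{1..i}. a * q ^ j \<le> x} else {j\<in>{1..i}. a * q ^ j \<le> x})"
      by (auto simp: le_Suc_eq simp del: power_Suc)
    then show ?case using Suc by (simp add: mult_ac)
  qed simp
  have lf: "loopfree ?b" by simp
  show ?thesis using assms loopfree_loops_le[OF lf] iter[of k]
    by (simp only: powcountp_def runs_def loops_le.simps eval.simps val.case loop_count.simps) simp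
qed

section \<open>Conflicts and critical points\<close>

fun start_of :: "dinst \<Rightarrow> nat" where "start_of (P, R, s) = s"

definition len_of :: "line_network \<Rightarrow> dinst \<Rightarrow> nat" where
  "len_of I d = ptime I (demand_of d)"

definition end_of :: "line_network \<Rightarrow> dinst \<Rightarrow> nat" where
  "end_of I d = start_of d + len_of I d"

definition pft :: "line_network \<Rightarrow> dinst \<Rightarrow> real" where
  "pft I d = profit I (demand_of d)"

definition conflict :: "line_network \<Rightarrow> dinst \<Rightarrow> dinst \<Rightarrow> bool" where
  "conflict I d e \<longleftrightarrow> d \<noteq> e \<and> (demand_of d = demand_of e \<or>
     resource_of d = resource_of e \<and> start_of d < end_of I e \<and> start_of e < end_of I d)"

lemma conflict_sym: "conflict I d e \<longleftrightarrow> conflict I e d"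
  by (auto simp: conflict_def)

lemma conflict_irrefl [simp]: "\<not> conflict I d d"
  by (simp add: conflict_def)

text \<open>
  The coefficient of the dual increment of \<open>e\<close> in the dual constraint of \<open>d\<close>.  The increment goes to
  the demand variable and to three critical points of \<open>e\<close>: its first slot, its last slot and the real
  midpoint \<open>start_of e + len_of I e / 2\<close>.  An instance is viewed as a half-open real
  interval, so that no rounding is necessary.
\<close>

definition hits :: "line_network \<Rightarrow> dinst \<Rightarrow> dinst \<Rightarrow> real" where
  "hits I e d = of_bool (demand_of e = demand_of d) +
     of_bool (resource_of e = resource_of d \<and> start_of d \<le> start_of e \<and> start_of e < end_of I d) +
     of_bool (resource_of e = resource_of d \<and> 2 * start_of d \<le> 2 * start_of e + len_of I e
        \<and> 2 * start_of e + len_of I e < 2 * end_of I d) +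
     of_bool (resource_of e = resource_of d \<and> start_of d < end_of I e \<and> end_of I e \<le> end_of I d)"

lemma hits_nonneg [simp]: "0 \<le> hits I e d"
  by (simp add: hits_def)

text \<open>Every critical point of \<open>e\<close> lies inside \<open>e\<close>, so an instance
  that contains one on the same resource overlaps \<open>e\<close>.\<close>

lemma hits_zero:
  assumes "0 < len_of I e" "e \<noteq> d" "\<not> conflict I e d"
  shows "hits I e d = 0"
  using assms by (auto simp: hits_def conflict_def end_of_def)

lemma hits_self: "0 < len_of I d \<Longrightarrow> hits I d d = 4"
  by (simp add: hits_def end_of_def)

text \<open>If no end of \<open>e\<close> falls into \<open>d\<close>, then \<open>d\<close> lies
  strictly inside \<open>e\<close>, and being at least half as long it covers the midpoint. This is
  the source of the factor 2 in the length classes.\<close>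

lemma hits_ge_1:
  assumes "conflict I e d" "len_of I e \<le> 2 * len_of I d"
  shows "1 \<le> hits I e d"
proof (cases "demand_of e = demand_of d")
  case False
  then have *: "resource_of e = resource_of d" "start_of d < end_of I e" "start_of e < end_of I d"
    using assms(1) by (auto simp: conflict_def)
  then consider "start_of d \<le> start_of e" | "end_of I e \<le> end_of I d"
    | "start_of e < start_of d" "end_of I d < end_of I e" by linarith
  then show ?thesis
  proof cases
    case 3
    have "2 * start_of d \<le> 2 * start_of e + len_of I e \<and> 2 * start_of e + len_of I e < 2 * end_of I d"
      using 3 assms(2) by (auto simp: end_of_def)
    then show ?thesis using * by (simp add: hits_def)
  qed (use * in \<open>simp_all add: hits_def\<close>)
qed (simp add: hits_def)

lemma sum_of_bool_le_1:
  assumes "finite S" "\<And>x y. x \<in> S \<Longrightarrow> y \<in> S \<Longrightarrow> Q x \<Longrightarrow> Q y \<Longrightarrow> x = y"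
  shows "(\<Sum>x\<in>S. of_bool (Q x)) \<le> (1::real)"
proof (cases "\<exists>x\<in>S. Q x")
  case True
  then obtain x where x: "x \<in> S" "Q x" by blast
  have "(\<Sum>y\<in>S. of_bool (Q y)) = (\<Sum>y\<in>S. if y = x then 1 else 0 :: real)"
    by (rule sum.cong) (use assms(2) x in auto)
  then show ?thesis using assms(1) x by simp
qed auto

text \<open>Each of the four terms refers to a demand or to one point of a resource. Two distinct
  instances that share it conflict, so within a conflict-free set each term contributes at most
  1.\<close>

lemma sum_hits_le_4:
  assumes "finite S" "\<And>d d'. d \<in> S \<Longrightarrow> d' \<in> S \<Longrightarrow> \<not> conflict I d d'"
  shows "(\<Sum>d\<in>S. hits I e d) \<le> 4"
proof -
  have 1: "(\<Sum>d\<in>S. of_bool (Q d)) \<le> (1::real)"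
    if "\<And>x y. x \<noteq> y \<Longrightarrow> Q x \<Longrightarrow> Q y \<Longrightarrow> conflict I x y" for Q
    by (rule sum_of_bool_le_1[OF assms(1)]) (use assms(2) that in blast)
  have "(\<Sum>d\<in>S. hits I e d) \<le> 1 + 1 + 1 + 1"
    unfolding hits_def sum.distrib
    by (rule add_mono[OF add_mono[OF add_mono[OF 1 1] 1] 1]) (auto simp: conflict_def)
  then show ?thesis by simp
qed

section \<open>Instances and feasibility in terms of end points\<close>

lemma len_of_pos: "wf_line I \<Longrightarrow> d \<in> instances I \<Longrightarrow> 0 < len_of I d"
  by (auto simp: wf_line_def instances_def len_of_def Suc_le_eq)

lemma mem_instances_iff:
  assumes "wf_line I"
  shows "(P, R, s) \<in> instances I \<longleftrightarrow> P < procs_m I \<and> R \<in> Acc I P \<and> rt I P \<le> s \<and> s + ptime I P \<le> Suc (dl I P)"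
proof (cases "P < procs_m I")
  case True
  then have p: "ptime I P \<ge> 1" using assms by (auto simp: wf_line_def)
  have "{s..<s + ptime I P} \<subseteq> {rt I P..dl I P} \<longleftrightarrow> rt I P \<le> s \<and> s + ptime I P \<le> Suc (dl I P)"
  proof
    assume a: "{s..<s + ptime I P} \<subseteq> {rt I P..dl I P}"
    have "s \<in> {s..<s + ptime I P}" "s + ptime I P - 1 \<in> {s..<s + ptime I P}" using p by auto
    then have "s \<in> {rt I P..dl I P}" "s + ptime I P - 1 \<in> {rt I P..dl I P}" using a by blast+
    then show "rt I P \<le> s \<and> s + ptime I P \<le> Suc (dl I P)" using p by auto
  qed auto
  then show ?thesis using True by (auto simp: instances_def)
qed (auto simp: instances_def)

lemma instances_bounds:
  assumes "wf_line I" "(P, R, s) \<in> instances I"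
  shows "P < procs_m I" "R < ress_r I" "1 \<le> s" "s \<le> slots_n I" "ptime I P \<le> slots_n I"
proof -
  have "P < procs_m I" "R \<in> Acc I P" and *: "rt I P \<le> s" "s + ptime I P \<le> Suc (dl I P)"
    using assms by (auto simp: mem_instances_iff)
  moreover have "1 \<le> rt I P" "dl I P \<le> slots_n I" "1 \<le> ptime I P" "Acc I P \<subseteq> {..<ress_r I}"
    using assms(1) \<open>P < procs_m I\<close> by (auto simp: wf_line_def)
  ultimately show "P < procs_m I" "R < ress_r I" "1 \<le> s" "s \<le> slots_n I" "ptime I P \<le> slots_n I"
    by auto
qed

lemma finite_instances: "wf_line I \<Longrightarrow> finite (instances I)"
proof (rule finite_subset)
  assume wf: "wf_line I"
  show "instances I \<subseteq> {..<procs_m I} \<times> {..<ress_r I} \<times> {..slots_n I}"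
    using instances_bounds[OF wf] by auto
qed simp

text \<open>Positive lengths turn disjointness of slot sets into a comparison of end points, so
  feasible solutions are the independent sets of the conflict relation.\<close>

lemma feasible_iff:
  assumes "wf_line I"
  shows "feasible I S \<longleftrightarrow> S \<subseteq> instances I \<and> (\<forall>d\<in>S. \<forall>d'\<in>S. \<not> conflict I d d')"
proof -
  have "(d \<noteq> d' \<longrightarrow> demand_of d \<noteq> demand_of d' \<and>
        (resource_of d = resource_of d' \<longrightarrow> occupied I d \<inter> occupied I d' = {})) \<longleftrightarrow> \<not> conflict I d d'"
    if d: "d \<in> instances I" "d' \<in> instances I" for d d'
  proof -
    have occ: "occupied I d = {start_of d..<end_of I d}" for d
      by (cases d) (simp add: end_of_def len_of_def)
    have "0 < len_of I d" "0 < len_of I d'" using len_of_pos assms d by auto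
    then show ?thesis unfolding occ conflict_def
      by (auto simp: end_of_def)
  qed
  then show ?thesis unfolding feasible_def by blast
qed


section \<open>Counting powers\<close>

text \<open>The exponents that fit form an initial segment because the powers increase. Their number
  is thus the integer part of the logarithm of \<open>x / a\<close> to base \<open>q\<close>, capped
  at \<open>K\<close>.\<close>

lemma card_powers:
  fixes a q x :: real and K :: nat
  assumes "0 < a" "1 < q" "a \<le> x"
  defines "c \<equiv> card {j\<in>{1..K}. a * q ^ j \<le> x}"
  shows "a * q ^ c \<le> x" "c < K \<Longrightarrow> x < a * q ^ Suc c" "c \<le> K"
proof -
  let ?S = "{j\<in>{1..K}. a * q ^ j \<le> x}"
  have mono: "a * q ^ j \<le> x" if "a * q ^ k \<le> x" "j \<le> k" for j k
    using that assms(1,2) by (meson less_imp_le mult_left_mono order_trans power_increasing)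
  have "\<exists>k\<le>K. ?S = {1..k} \<and> a * q ^ k \<le> x"
  proof (induction K)
    case (Suc K)
    then obtain k where k: "k \<le> K" "{j\<in>{1..K}. a * q ^ j \<le> x} = {1..k}" "a * q ^ k \<le> x" by blast
    show ?case
    proof (cases "a * q ^ Suc K \<le> x")
      case True
      then have "{j\<in>{1..Suc K}. a * q ^ j \<le> x} = {1..Suc K}" using mono[OF True] by auto
      then show ?thesis using True by blast
    next
      case False
      then have "{j\<in>{1..Suc K}. a * q ^ j \<le> x} = {j\<in>{1..K}. a * q ^ j \<le> x}"
        by (auto simp: le_Suc_eq simp del: power_Suc)
      then show ?thesis using k by (metis le_Suc_eq)
    qed
  qed (use assms(3) in auto)
  then obtain k where k: "k \<le> K" "?S = {1..k}" "a * q ^ k \<le> x" by blast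
  then have c: "c = k" by (simp add: c_def)
  show "a * q ^ c \<le> x" "c \<le> K" using k c by auto
  show "x < a * q ^ Suc c" if "c < K"
  proof (rule ccontr)
    assume "\<not> x < a * q ^ Suc c"
    then have "Suc k \<in> ?S" using that c by auto
    moreover have "Suc k \<notin> {1..k}" by simp
    ultimately show False using k(2) by blast
  qed
qed

lemma card_powers_mono:
  fixes a q x :: real
  assumes "x \<le> y" "b \<le> a" "0 \<le> q"
  shows "card {j\<in>{1..K}. a * q ^ j \<le> x} \<le> card {j\<in>{1..K}. b * q ^ j \<le> y}"
proof (rule card_mono)
  have "b * q ^ j \<le> a * q ^ j" for j using assms by (simp add: mult_right_mono)
  then show "{j\<in>{1..K}. a * q ^ j \<le> x} \<subseteq> {j\<in>{1..K}. b * q ^ j \<le> y}"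
    using assms(1) by (auto intro: order_trans)
qed simp

definition len_class :: "nat \<Rightarrow> nat \<Rightarrow> nat" where
  "len_class n l = card {j\<in>{1..n}. 1 * 2 ^ j \<le> real l}"

text \<open>The cap \<open>n\<close> is out of reach since \<open>l \<le> n < 2 ^ n\<close>, so the
  class is exactly the integer part of the binary logarithm.\<close>

lemma len_class:
  assumes "1 \<le> l" "l \<le> n"
  shows "2 ^ len_class n l \<le> l" "l < 2 ^ Suc (len_class n l)"
proof -
  note * = card_powers[of 1 2 "real l" n, folded len_class_def]
  show 1: "2 ^ len_class n l \<le> l" using * assms by (simp flip: of_nat_power of_nat_le_iff)
  have "len_class n l \<noteq> n"
  proof
    assume "len_class n l = n"
    then have "2 ^ n \<le> l" using 1 by simp
    then show False using assms(2) less_exp[of n] by linarith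
  qed
  then have "real l < 2 * 2 ^ len_class n l" using * assms by simp
  then have "real l < real (2 * 2 ^ len_class n l)" by simp
  then show "l < 2 ^ Suc (len_class n l)" by (simp only: of_nat_less_iff power_Suc)
qed

lemma len_class_mono: "l \<le> l' \<Longrightarrow> len_class n l \<le> len_class n l'"
  unfolding len_class_def by (rule card_powers_mono) auto


section \<open>The primal-dual schedule\<close>

locale schedule =
  fixes I :: line_network and mis :: "dinst set \<Rightarrow> dinst set" and \<theta> :: real and b :: nat
  assumes wf: "wf_line I"
    and mis_subset: "A \<subseteq> instances I \<Longrightarrow> mis A \<subseteq> A"
    and mis_independent: "A \<subseteq> instances I \<Longrightarrow> d \<in> mis A \<Longrightarrow> e \<in> mis A \<Longrightarrow> \<not> conflict I d e"
    and mis_maximal: "A \<subseteq> instances I \<Longrightarrow> d \<in> A \<Longrightarrow> d \<in> mis A \<or> (\<exists>e\<in>mis A. conflict I e d)"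
    and \<theta>: "0 < \<theta>" "\<theta> < 1" "1 \<le> \<theta> * (9/8) ^ Suc b"
begin

definition unsat :: "(dinst \<Rightarrow> real) \<Rightarrow> dinst set" where
  "unsat sl = {d \<in> instances I. \<theta> * pft I d < sl d}"

definition level :: "real \<Rightarrow> real \<Rightarrow> nat" where
  "level x p = card {j\<in>{1..b}. x * (9/8) ^ j \<le> p}"

text \<open>Levels are at most \<open>b\<close>, so the radix \<open>Suc b\<close> makes the
  comparison lexicographic. A shrinking slack raises the level, hence keys never decrease over
  time.\<close>

definition key :: "(dinst \<Rightarrow> real) \<Rightarrow> dinst \<Rightarrow> nat" where
  "key sl d = len_class (slots_n I) (len_of I d) * Suc b + level (sl d) (pft I d)"

definition active :: "(dinst \<Rightarrow> real) \<Rightarrow> dinst set" where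
  "active sl = {d \<in> unsat sl. \<forall>e\<in>unsat sl. conflict I e d \<longrightarrow> key sl d \<le> key sl e}"

text \<open>Only the slacks of the dual constraints are tracked, not the dual variables: raising
  \<open>e\<close> adds \<open>slack i e / 4\<close> to four variables, and
  \<open>hits I e d\<close> counts how many of them occur in the constraint of
  \<open>d\<close>.\<close>

primrec slack :: "nat \<Rightarrow> dinst \<Rightarrow> real" where
  "slack 0 d = pft I d"
| "slack (Suc i) d = slack i d - (\<Sum>e\<in>mis (active (slack i)). slack i e / 4 * hits I e d)"

declare slack.simps [simp del]

abbreviation "U i \<equiv> unsat (slack i)"
abbreviation "Act i \<equiv> active (slack i)"
abbreviation "K i \<equiv> key (slack i)"

definition Z :: "nat \<Rightarrow> dinst set" where
  "Z i = mis (active (slack i))"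

lemma slack_Suc: "slack (Suc i) d = slack i d - (\<Sum>e\<in>Z i. slack i e / 4 * hits I e d)"
  by (simp add: Z_def slack.simps)

lemma U_inst: "U i \<subseteq> instances I" by (auto simp: unsat_def)
lemma Act_U: "Act i \<subseteq> U i" by (auto simp: active_def)
lemma Act_inst: "Act i \<subseteq> instances I" using U_inst Act_U by blast
lemma Z_Act: "Z i \<subseteq> Act i" using mis_subset[OF Act_inst] by (simp add: Z_def)
lemma Z_U: "Z i \<subseteq> U i" using Z_Act Act_U by blast
lemma Z_inst: "Z i \<subseteq> instances I" using Z_Act Act_inst by blast

lemma Z_indep: "d \<in> Z i \<Longrightarrow> e \<in> Z i \<Longrightarrow> \<not> conflict I d e"
  using mis_independent[OF Act_inst] by (simp add: Z_def)

lemma Z_maximal: "d \<in> Act i \<Longrightarrow> d \<in> Z i \<or> (\<exists>e\<in>Z i. conflict I e d)"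
  using mis_maximal[OF Act_inst] by (simp add: Z_def)

lemma finite_Z: "finite (Z i)"
  using finite_instances[OF wf] Z_inst finite_subset by blast

lemma pft_pos: "d \<in> instances I \<Longrightarrow> 0 < pft I d"
  using wf by (auto simp: wf_line_def instances_def pft_def)

lemma U_pos:
  assumes "d \<in> U i"
  shows "0 < slack i d"
proof -
  have "0 < \<theta> * pft I d" using assms pft_pos[of d] \<theta>(1) by (simp add: unsat_def)
  also have "\<dots> < slack i d" using assms by (simp add: unsat_def)
  finally show ?thesis .
qed

lemma raise_nonneg:
  assumes "e \<in> Z i"
  shows "0 \<le> slack i e / 4 * hits I e d"
proof -
  have "0 < slack i e" using U_pos Z_U assms by blast
  then show ?thesis by simp
qed

lemma slack_antimono1: "slack (Suc i) d \<le> slack i d"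
  using sum_nonneg[of "Z i" "\<lambda>e. slack i e / 4 * hits I e d"] raise_nonneg[of _ i d]
  unfolding slack_Suc by simp

lemma slack_antimono: "i \<le> j \<Longrightarrow> slack j d \<le> slack i d"
  by (rule lift_Suc_antimono_le[of "\<lambda>i. slack i d"]) (rule slack_antimono1)

lemma U_antimono: "i \<le> j \<Longrightarrow> U j \<subseteq> U i"
  using slack_antimono by (auto simp: unsat_def intro: less_le_trans)

lemma key_mono: "i \<le> j \<Longrightarrow> K i d \<le> K j d"
  using slack_antimono unfolding key_def level_def
  by (intro add_left_mono card_powers_mono) auto

lemma level_le: "level x p \<le> b"
proof -
  have "level x p \<le> card {1..b}" unfolding level_def by (rule card_mono) auto
  then show ?thesis by simp
qed

lemma key_div: "K i d div Suc b = len_class (slots_n I) (len_of I d)"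
  using level_le[of "slack i d" "pft I d"]
  by (simp add: key_def del: mult_Suc_right)

lemma key_mod: "K i d mod Suc b = level (slack i d) (pft I d)"
  using level_le[of "slack i d" "pft I d"]
  by (simp add: key_def del: mult_Suc_right)

text \<open>Below the cap \<open>b\<close> both bounds are those of the counted powers. At the cap
  the upper one comes from \<open>d\<close> being unsatisfied: the slack exceeds \<theta> times the
  profit, and \<open>\<theta> * (9/8) ^ Suc b\<close> is at least 1.\<close>

lemma level_bounds:
  assumes "d \<in> U i"
  shows "slack i d * (9/8) ^ level (slack i d) (pft I d) \<le> pft I d"
    "pft I d < slack i d * (9/8) ^ Suc (level (slack i d) (pft I d))"
proof -
  have p: "0 < slack i d" "slack i d \<le> pft I d"
    using U_pos[OF assms] slack_antimono[of 0 i d] by (auto simp: slack.simps)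
  note * = card_powers[of "slack i d" "9/8" "pft I d" b, folded level_def]
  show "slack i d * (9/8) ^ level (slack i d) (pft I d) \<le> pft I d" using * p by simp
  show "pft I d < slack i d * (9/8) ^ Suc (level (slack i d) (pft I d))"
  proof (cases "level (slack i d) (pft I d) < b")
    case False
    then have l: "level (slack i d) (pft I d) = b" using level_le by (meson le_neq_implies_less)
    have "0 < pft I d" using p by linarith
    then have "pft I d * 1 \<le> pft I d * (\<theta> * (9/8) ^ Suc b)" using \<theta>(3) by (intro mult_left_mono) auto
    also have "\<dots> = \<theta> * pft I d * (9/8) ^ Suc b" by simp
    also have "\<dots> < slack i d * (9/8) ^ Suc b" using assms by (auto simp: unsat_def)
    finally show ?thesis using l by simp
  qed (use * p in simp)
qed

text \<open>Lengths within one class differ by a factor below 2, so an instance whose class is not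
  above that of \<open>d\<close> is less than twice as long as \<open>d\<close>.\<close>

lemma class_hits:
  assumes "conflict I e d" "e \<in> instances I" "d \<in> instances I"
    "len_class (slots_n I) (len_of I e) \<le> len_class (slots_n I) (len_of I d)"
  shows "1 \<le> hits I e d"
proof (rule hits_ge_1[OF assms(1)])
  have "1 \<le> len_of I x \<and> len_of I x \<le> slots_n I" if "x \<in> instances I" for x
    using that len_of_pos[OF wf that] instances_bounds(5)[OF wf]
    by (cases x) (auto simp: len_of_def Suc_le_eq)
  then have e: "len_of I e < 2 ^ Suc (len_class (slots_n I) (len_of I e))"
    and d: "2 ^ len_class (slots_n I) (len_of I d) \<le> len_of I d"
    using len_class assms(2,3) by auto
  have "(2::nat) ^ Suc (len_class (slots_n I) (len_of I e)) \<le> 2 ^ Suc (len_class (slots_n I) (len_of I d))"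
    using assms(4) by (intro power_increasing) auto
  then show "len_of I e \<le> 2 * len_of I d" using e d unfolding power_Suc by linarith
qed

text \<open>Members of \<open>Z i\<close> do not conflict, so the only raise that reaches
  \<open>d\<close> is its own. All four raised variables occur in its constraint: four quarters of
  its slack.\<close>

lemma raised_slack:
  assumes "d \<in> Z i"
  shows "slack (Suc i) d = 0"
proof -
  have "(\<Sum>e\<in>Z i. slack i e / 4 * hits I e d) = (\<Sum>e\<in>Z i. if e = d then slack i d else 0)"
  proof (rule sum.cong)
    fix e assume e: "e \<in> Z i"
    have "0 < len_of I e" using len_of_pos[OF wf] Z_inst e by blast
    then show "slack i e / 4 * hits I e d = (if e = d then slack i d else 0)"
      using hits_zero[of I e d] hits_self[of I d] Z_indep[OF e assms] by auto
  qed simp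
  then show ?thesis using assms finite_Z by (simp add: slack_Suc)
qed

lemma raised_sat: "d \<in> Z i \<Longrightarrow> i < j \<Longrightarrow> d \<notin> U j"
  using raised_slack[of d i] slack_antimono[of "Suc i" j d] U_pos[of d j] by fastforce

lemma Z_unique: "d \<in> Z i \<Longrightarrow> d \<in> Z j \<Longrightarrow> i = j"
  using raised_sat Z_U by (metis linorder_neqE_nat subsetD)

lemma slack_drop:
  assumes "e \<in> Z i"
  shows "slack (Suc i) d \<le> slack i d - slack i e / 4 * hits I e d"
  using member_le_sum[of e "Z i" "\<lambda>e. slack i e / 4 * hits I e d"] raise_nonneg[of _ i d]
    finite_Z assms unfolding slack_Suc by simp

text \<open>If a raise in its neighbourhood does not move \<open>d\<close> out of its key, then the profit of the raised
  instance is less than half of that of \<open>d\<close>; hence a key is exhausted after logarithmically many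
  steps.\<close>

lemma profit_doubling:
  assumes "\<forall>d\<in>U i0. k \<le> K i0 d" "d \<in> U (i0 + x)" "K (i0 + x) d = k"
  shows "2 ^ x * p_min I \<le> pft I d"
  using assms(2,3)
proof (induction x arbitrary: d)
  case 0
  then have "demand_of d < procs_m I" by (auto simp: unsat_def instances_def)
  then show ?case by (auto simp: p_min_def pft_def intro!: Min_le)
next
  case (Suc x)
  let ?i = "i0 + x"
  have ge: "k \<le> K ?i e" if "e \<in> U ?i" for e
    using that assms(1) U_antimono[of i0 ?i] key_mono[of i0 ?i e] by force
  have d: "d \<in> U ?i" "d \<in> U (Suc ?i)" using Suc.prems U_antimono[of ?i "Suc ?i"] by auto
  then have kd: "K ?i d = k" using ge[of d] key_mono[of ?i "Suc ?i" d] Suc.prems by simp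
  \<comment> \<open>\<open>d\<close> has the least key that is left, hence was active; still
    unsatisfied afterwards, it was not raised itself. Maximality then supplies a raised instance in
    conflict with it, whose key can only be \<open>k\<close> as well.\<close>
  then have "d \<in> Act ?i" using d ge by (auto simp: active_def)
  moreover have "d \<notin> Z ?i" using raised_sat[of d ?i "Suc ?i"] d by auto
  ultimately obtain e where e: "e \<in> Z ?i" "conflict I e d" using Z_maximal by blast
  have eU: "e \<in> U ?i" using e Z_U by blast
  have "e \<in> Act ?i" using e Z_Act by blast
  then have "K ?i e \<le> K ?i d" using d e(2) conflict_sym by (auto simp: active_def)
  then have ke: "K ?i e = k" using ge[OF eU] kd by simp
  have IH: "2 ^ x * p_min I \<le> pft I e" by (rule Suc.IH[OF eU ke])
  have lev: "level (slack ?i d) (pft I d) = k mod Suc b" "level (slack ?i e) (pft I e) = k mod Suc b"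
    "level (slack (Suc ?i) d) (pft I d) = k mod Suc b"
    using key_mod[of ?i d] key_mod[of ?i e] key_mod[of "Suc ?i" d] kd ke Suc.prems by simp_all
  define g :: real where "g = (9/8) ^ (k mod Suc b)"
  have g: "0 < g" by (simp add: g_def)
  have 1: "slack ?i d * g \<le> pft I d" "pft I d < slack (Suc ?i) d * (9/8 * g)"
    "pft I e < slack ?i e * (9/8 * g)"
    using level_bounds[OF d(1)] level_bounds[OF d(2)] level_bounds[OF eU] unfolding lev g_def by simp_all
  have "1 \<le> hits I e d"
    using class_hits[OF e(2)] eU d U_inst key_div[of ?i d] key_div[of ?i e] kd ke by force
  then have "slack ?i e / 4 * 1 \<le> slack ?i e / 4 * hits I e d"
    using U_pos[OF eU] by (intro mult_left_mono) auto
  then have "slack (Suc ?i) d \<le> slack ?i d - slack ?i e / 4" using slack_drop[OF e(1), of d] by simp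
  then have "slack (Suc ?i) d * g \<le> (slack ?i d - slack ?i e / 4) * g" using g by (intro mult_right_mono) auto
  \<comment> \<open>Here 9/8 yields the factor 2: multiplied by \<open>g\<close>, the bounds say
    that 8/9 of the profit of \<open>d\<close> is below this profit minus 2/9 of the profit of
    \<open>e\<close>.\<close>
  then have "2 * pft I e \<le> pft I d" using 1 by (simp add: algebra_simps)
  then show ?case using IH by simp
qed

section \<open>Number of steps of the schedule\<close>

definition steps_per_key :: nat where
  "steps_per_key = nat \<lfloor>log 2 (p_max I / p_min I)\<rfloor> + 1"

lemma p_min_pos: "0 < p_min I"
proof -
  have "p_min I \<in> profit I ` {..<procs_m I}" unfolding p_min_def
    by (rule Min_in) (use wf in \<open>auto simp: wf_line_def lessThan_empty_iff\<close>)
  then show ?thesis using wf by (auto simp: wf_line_def)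
qed

lemma pft_le_max: "d \<in> instances I \<Longrightarrow> pft I d \<le> p_max I"
  unfolding p_max_def pft_def by (rule Max_ge) (auto simp: instances_def)

lemma p_min_le_max: "p_min I \<le> p_max I"
proof -
  have "0 < procs_m I" using wf by (auto simp: wf_line_def)
  then have "p_min I \<le> profit I 0" "profit I 0 \<le> p_max I"
    unfolding p_min_def p_max_def by (auto intro: Min_le Max_ge)
  then show ?thesis by simp
qed

lemma p_max_less: "p_max I < 2 ^ steps_per_key * p_min I"
proof -
  let ?r = "p_max I / p_min I"
  have r: "1 \<le> ?r" using p_min_pos p_min_le_max by simp
  have "log 2 ?r < real steps_per_key" unfolding steps_per_key_def using r by simp linarith
  then have "?r < 2 powr real steps_per_key" using r by (simp add: log_less_iff)
  then have "?r < 2 ^ steps_per_key" by (simp add: powr_realpow)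
  then show ?thesis using p_min_pos by (simp add: divide_less_eq)
qed

text \<open>An instance that kept the key \<open>k\<close> through all these steps would have a
  profit above \<open>p_max I\<close>.\<close>

lemma key_clear:
  assumes "\<forall>d\<in>U i. k \<le> K i d"
  shows "\<forall>d\<in>U (i + steps_per_key). Suc k \<le> K (i + steps_per_key) d"
proof
  fix d assume d: "d \<in> U (i + steps_per_key)"
  have "k \<le> K (i + steps_per_key) d"
    using d assms U_antimono[of i "i + steps_per_key"] key_mono[of i "i + steps_per_key" d] by force
  moreover have "K (i + steps_per_key) d \<noteq> k"
    using profit_doubling[OF assms d] pft_le_max[of d] d U_inst p_max_less by fastforce
  ultimately show "Suc k \<le> K (i + steps_per_key) d" by simp
qed

text \<open>One block of \<open>steps_per_key\<close> steps for each key: \<open>Suc b\<close>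
  levels for every length class between those of the extremal lengths. Without instances these
  lengths are unspecified, hence the case distinction.\<close>

definition num_steps :: nat where
  "num_steps = (if instances I = {} then 0 else
     (len_class (slots_n I) (L_max I) - len_class (slots_n I) (L_min I) + 1) * Suc b * steps_per_key)"

lemma card_occupied: "card (occupied I d) = len_of I d"
  by (cases d) (simp add: len_of_def)

lemma len_bounds:
  assumes "d \<in> instances I"
  shows "L_min I \<le> len_of I d" "len_of I d \<le> L_max I"
  using assms finite_instances[OF wf] unfolding L_min_def L_max_def card_occupied
  by (auto intro: Min_le Max_ge)

text \<open>Each block of steps lifts the lower bound on the keys of unsatisfied instances by one.
  After the last block it exceeds every possible key.\<close>

lemma U_num_steps: "U num_steps = {}"
proof (cases "instances I = {}")
  case True
  then show ?thesis by (simp add: unsat_def)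
next
  case False
  let ?lc = "len_class (slots_n I)"
  let ?k = "?lc (L_min I) * Suc b"
  have base: "\<forall>d\<in>U 0. ?k \<le> K 0 d"
  proof
    fix d assume "d \<in> U 0"
    then have "?lc (L_min I) \<le> ?lc (len_of I d)"
      using U_inst len_bounds by (intro len_class_mono) blast
    then have "?k \<le> ?lc (len_of I d) * Suc b" by (intro mult_le_mono1)
    then show "?k \<le> K 0 d" unfolding key_def by linarith
  qed
  have "\<forall>d\<in>U (y * steps_per_key). ?k + y \<le> K (y * steps_per_key) d" for y
  proof (induction y)
    case (Suc y)
    from key_clear[OF this] show ?case by (simp add: add.commute)
  qed (use base in simp)
  from this[of "(?lc (L_max I) - ?lc (L_min I) + 1) * Suc b"]
  have *: "\<forall>d\<in>U num_steps. ?k + (?lc (L_max I) - ?lc (L_min I) + 1) * Suc b \<le> K num_steps d"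
    using False by (simp add: num_steps_def)
  have "L_min I \<le> L_max I" using len_bounds False by (meson ex_in_conv order_trans)
  then have "?lc (L_min I) \<le> ?lc (L_max I)" by (rule len_class_mono)
  then have "?k + (?lc (L_max I) - ?lc (L_min I) + 1) * Suc b = Suc (?lc (L_max I)) * Suc b"
    by (auto dest!: le_Suc_ex simp: algebra_simps)
  then have *: "\<forall>d\<in>U num_steps. Suc (?lc (L_max I)) * Suc b \<le> K num_steps d" using * by metis
  show ?thesis
  proof (rule ccontr)
    assume "U num_steps \<noteq> {}"
    then obtain d where d: "d \<in> U num_steps" by blast
    then have "?lc (len_of I d) \<le> ?lc (L_max I)"
      using U_inst len_bounds by (intro len_class_mono) blast
    then have "?lc (len_of I d) * Suc b \<le> ?lc (L_max I) * Suc b" by (intro mult_le_mono1)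
    then have "K num_steps d \<le> ?lc (L_max I) * Suc b + b"
      unfolding key_def using level_le add_mono by blast
    moreover have "Suc (?lc (L_max I)) * Suc b \<le> K num_steps d" using * d by blast
    ultimately show False by simp
  qed
qed

lemma U_empty: "num_steps \<le> i \<Longrightarrow> U i = {}"
  using U_num_steps U_antimono by blast

text \<open>Classes are rounded binary logarithms, so their number is at most 1, or 2 plus the
  logarithm of the length ratio. As \<open>lg\<close> is at least 1, this is within 3 times the
  \<open>lg\<close> of the ratio; the profits give a factor 2 in the same way, and 6 is the
  product.\<close>

lemma num_steps_le:
  "real num_steps \<le> 6 * real (Suc b) * lg (real (L_max I) / real (L_min I)) * lg (p_max I / p_min I)"
proof (cases "instances I = {}")
  case True
  then show ?thesis by (simp add: num_steps_def lg_def)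
next
  case False
  let ?lc = "len_class (slots_n I)"
  have fin: "finite ((\<lambda>d. card (occupied I d)) ` instances I)" "(\<lambda>d. card (occupied I d)) ` instances I \<noteq> {}"
    using finite_instances[OF wf] False by auto
  obtain d1 d2 where d: "d1 \<in> instances I" "L_max I = len_of I d1" "d2 \<in> instances I" "L_min I = len_of I d2"
    using Max_in[OF fin] Min_in[OF fin] unfolding L_min_def L_max_def card_occupied by auto
  have "1 \<le> len_of I x \<and> len_of I x \<le> slots_n I" if "x \<in> instances I" for x
    using that len_of_pos[OF wf that] instances_bounds(5)[OF wf]
    by (cases x) (auto simp: len_of_def Suc_le_eq)
  then have b1: "1 \<le> L_max I" "L_max I \<le> slots_n I" "1 \<le> L_min I" "L_min I \<le> slots_n I" using d by auto
  then have *: "2 ^ ?lc (L_max I) \<le> L_max I" "L_min I < 2 ^ Suc (?lc (L_min I))" using len_class by auto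
  let ?r = "real (L_max I) / real (L_min I)"
  have "real (?lc (L_max I)) \<le> log 2 (real (L_max I))"
    using *(1) b1 by (intro le_log_of_power) (simp_all flip: of_nat_power of_nat_le_iff)
  moreover have "log 2 (real (L_min I)) < real (Suc (?lc (L_min I)))"
    using *(2) b1 by (intro log_of_power_less) (simp_all del: power_Suc)
  moreover have "log 2 ?r = log 2 (real (L_max I)) - log 2 (real (L_min I))"
    using b1 by (simp add: log_divide)
  ultimately have "real (?lc (L_max I) - ?lc (L_min I) + 1) \<le> 2 + log 2 ?r \<or> ?lc (L_max I) - ?lc (L_min I) = 0"
    by linarith
  then have 1: "real (?lc (L_max I) - ?lc (L_min I) + 1) \<le> 3 * lg ?r" unfolding lg_def by auto
  have "1 \<le> p_max I / p_min I" using p_min_pos p_min_le_max by simp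
  then have "0 \<le> log 2 (p_max I / p_min I)" by (subst zero_le_log_cancel_iff) auto
  then have "real steps_per_key \<le> log 2 (p_max I / p_min I) + 1"
    unfolding steps_per_key_def by (simp add: of_nat_nat)
  moreover have "log 2 (p_max I / p_min I) \<le> lg (p_max I / p_min I)" "1 \<le> lg (p_max I / p_min I)"
    by (auto simp: lg_def)
  ultimately have 2: "real steps_per_key \<le> 2 * lg (p_max I / p_min I)" by linarith
  have "real num_steps = real (?lc (L_max I) - ?lc (L_min I) + 1) * real (Suc b) * real steps_per_key"
    by (simp only: num_steps_def False if_False of_nat_mult)
  also have "\<dots> \<le> (3 * lg ?r) * real (Suc b) * (2 * lg (p_max I / p_min I))"
    using 1 2 by (intro mult_mono) (auto simp: lg_def)
  finally show ?thesis by (simp add: algebra_simps)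
qed

section \<open>Approximation ratio by weak duality and charging\<close>

lemma slack_sum: "slack N d = pft I d - (\<Sum>i<N. \<Sum>e\<in>Z i. slack i e / 4 * hits I e d)"
  by (induction N) (simp_all add: slack.simps(1) slack_Suc)

text \<open>Let D be the sum of \<open>slack i e / 4\<close> over all raises. Each constraint of
  \<open>Opt\<close> received at least 1 - \<theta> of its profit and each raise meets
  \<open>Opt\<close> with total weight at most 4, so 1 - \<theta> times the profit of
  \<open>Opt\<close> is at most 4 D. Conversely D is at most the profit of \<open>S\<close>: every
  raise is charged to a member of \<open>S\<close> that is the raised instance itself or a
  conflicting one raised later, and no member is charged more than its profit.\<close>

lemma approximation:
  assumes S: "S \<subseteq> (\<Union>i. Z i)" "finite S"
    and cover: "\<And>i e. e \<in> Z i \<Longrightarrow> e \<in> S \<or> (\<exists>d\<in>S. \<exists>j. d \<in> Z j \<and> i < j \<and> conflict I e d)"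
    and Opt: "feasible I Opt"
  shows "(1 - \<theta>) / 4 * total_profit I Opt \<le> total_profit I S"
proof -
  have Opt': "Opt \<subseteq> instances I" "\<And>d d'. d \<in> Opt \<Longrightarrow> d' \<in> Opt \<Longrightarrow> \<not> conflict I d d'"
    using Opt feasible_iff[OF wf, of Opt] by auto
  have finOpt: "finite Opt" using Opt'(1) finite_instances[OF wf] by (rule finite_subset)
  let ?N = num_steps
  have pos: "0 \<le> slack i e / 4" if "e \<in> Z i" for i e
  proof -
    have "0 < slack i e" using U_pos Z_U that by blast
    then show ?thesis by simp
  qed
  have "(1 - \<theta>) * pft I d \<le> (\<Sum>i<?N. \<Sum>e\<in>Z i. slack i e / 4 * hits I e d)" if "d \<in> Opt" for d
  proof -
    have "d \<notin> U ?N" using U_num_steps by simp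
    then have "slack ?N d \<le> \<theta> * pft I d" using that Opt'(1) by (auto simp: unsat_def)
    then show ?thesis unfolding slack_sum[of ?N d] by (simp add: algebra_simps)
  qed
  then have "(\<Sum>d\<in>Opt. (1 - \<theta>) * pft I d) \<le> (\<Sum>d\<in>Opt. \<Sum>i<?N. \<Sum>e\<in>Z i. slack i e / 4 * hits I e d)"
    by (rule sum_mono)
  also have "\<dots> = (\<Sum>i<?N. \<Sum>d\<in>Opt. \<Sum>e\<in>Z i. slack i e / 4 * hits I e d)" by (rule sum.swap)
  also have "\<dots> = (\<Sum>i<?N. \<Sum>e\<in>Z i. \<Sum>d\<in>Opt. slack i e / 4 * hits I e d)"
    by (intro sum.cong refl sum.swap)
  also have "\<dots> = (\<Sum>i<?N. \<Sum>e\<in>Z i. slack i e / 4 * (\<Sum>d\<in>Opt. hits I e d))"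
    by (simp only: sum_distrib_left)
  also have "\<dots> \<le> (\<Sum>i<?N. \<Sum>e\<in>Z i. slack i e / 4 * 4)"
    by (intro sum_mono mult_left_mono sum_hits_le_4[OF finOpt Opt'(2)] pos)
  finally have 1: "(1 - \<theta>) * total_profit I Opt \<le> 4 * (\<Sum>i<?N. \<Sum>e\<in>Z i. slack i e / 4)"
    by (simp add: total_profit_def pft_def sum_distrib_left)
  define later where "later = (\<lambda>i e d. e = d \<or> conflict I e d \<and> (\<exists>j. d \<in> Z j \<and> i < j))"
  have "(\<Sum>i<?N. \<Sum>e\<in>Z i. slack i e / 4) \<le> (\<Sum>i<?N. \<Sum>e\<in>Z i. \<Sum>d\<in>S. slack i e / 4 * of_bool (later i e d))"
  proof (intro sum_mono)
    fix i e assume e: "e \<in> Z i"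
    obtain d where d: "d \<in> S" "later i e d" using cover[OF e] unfolding later_def by blast
    have "slack i e / 4 = slack i e / 4 * of_bool (later i e d)" using d by simp
    also have "\<dots> \<le> (\<Sum>d\<in>S. slack i e / 4 * of_bool (later i e d))"
      using S(2) d(1) pos[OF e] by (intro member_le_sum) auto
    finally show "slack i e / 4 \<le> (\<Sum>d\<in>S. slack i e / 4 * of_bool (later i e d))" .
  qed
  also have "\<dots> = (\<Sum>i<?N. \<Sum>d\<in>S. \<Sum>e\<in>Z i. slack i e / 4 * of_bool (later i e d))"
    by (intro sum.cong refl sum.swap)
  also have "\<dots> = (\<Sum>d\<in>S. \<Sum>i<?N. \<Sum>e\<in>Z i. slack i e / 4 * of_bool (later i e d))" by (rule sum.swap)
  also have "\<dots> \<le> (\<Sum>d\<in>S. pft I d)"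
  proof (rule sum_mono)
    fix d assume "d \<in> S"
    then obtain j where j: "d \<in> Z j" using S by blast
    have jN: "j < ?N" using j Z_U U_empty[of j] by (metis empty_iff not_less subsetD)
    have inner: "(\<Sum>e\<in>Z i. slack i e / 4 * of_bool (later i e d)) \<le>
       (if i = j then slack j d else if i < j then \<Sum>e\<in>Z i. slack i e / 4 * hits I e d else 0)" for i
    proof (cases "i < j")
      case True
      have "of_bool (later i e d) \<le> hits I e d" if e: "e \<in> Z i" for e
      proof (cases "later i e d")
        case True
        have "e \<noteq> d" using Z_unique[of d i j] j e \<open>i < j\<close> by auto
        then have c: "conflict I e d" using True by (auto simp: later_def)
        \<comment> \<open>\<open>d\<close> was still unsatisfied in step \<open>i\<close>, so
          activity of \<open>e\<close> puts its length class at or below that of \<open>d\<close>.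
          The raise of \<open>e\<close> therefore took at least \<open>slack i e / 4\<close> from
          the slack of \<open>d\<close>.\<close>
        have "d \<in> U i" using j Z_U U_antimono[of i j] \<open>i < j\<close> by auto
        then have "K i e \<le> K i d" using e Z_Act c conflict_sym[of I e d] by (auto simp: active_def)
        then have "K i e div Suc b \<le> K i d div Suc b" by (rule div_le_mono)
        then have "1 \<le> hits I e d"
          using class_hits[OF c] e j Z_inst unfolding key_div by blast
        then show ?thesis by simp
      qed simp
      then have "(\<Sum>e\<in>Z i. slack i e / 4 * of_bool (later i e d)) \<le> (\<Sum>e\<in>Z i. slack i e / 4 * hits I e d)"
        using pos by (intro sum_mono mult_left_mono)
      then show ?thesis using True by simp
    next
      case False
      have "later i e d \<longleftrightarrow> i = j \<and> e = d" if e: "e \<in> Z i" for e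
        using False Z_unique[OF j] e by (auto simp: later_def)
      then have "(\<Sum>e\<in>Z i. slack i e / 4 * of_bool (later i e d)) =
        (\<Sum>e\<in>Z i. if e = d then slack i e / 4 * of_bool (i = j) else 0)"
        by (intro sum.cong) auto
      also have "\<dots> = (if i = j then slack j d / 4 else 0)" using j finite_Z[of i] by auto
      also have "\<dots> \<le> (if i = j then slack j d else 0)" using pos[OF j] by auto
      finally show ?thesis using False by auto
    qed
    have "(\<Sum>i<?N. \<Sum>e\<in>Z i. slack i e / 4 * of_bool (later i e d)) \<le>
      (\<Sum>i<?N. if i = j then slack j d else if i < j then \<Sum>e\<in>Z i. slack i e / 4 * hits I e d else 0)"
      by (intro sum_mono inner)
    also have "\<dots> = (\<Sum>i<?N. if i = j then slack j d else 0) +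
       (\<Sum>i<?N. if i < j then \<Sum>e\<in>Z i. slack i e / 4 * hits I e d else 0)"
      unfolding sum.distrib[symmetric] by (intro sum.cong) auto
    also have "(\<Sum>i<?N. if i < j then \<Sum>e\<in>Z i. slack i e / 4 * hits I e d else 0) =
       (\<Sum>i<j. \<Sum>e\<in>Z i. slack i e / 4 * hits I e d)"
      using jN by (intro sum.mono_neutral_cong_right) auto
    also have "(\<Sum>i<?N. if i = j then slack j d else 0) = slack j d" using jN by simp
    \<comment> \<open>The raises before step \<open>j\<close> are exactly what the slack of
      \<open>d\<close> has lost by then; with the remaining slack they add up to the profit.\<close>
    also have "slack j d + (\<Sum>i<j. \<Sum>e\<in>Z i. slack i e / 4 * hits I e d) = pft I d"
      unfolding slack_sum[of j d] by simp
    finally show "(\<Sum>i<?N. \<Sum>e\<in>Z i. slack i e / 4 * of_bool (later i e d)) \<le> pft I d" .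
  qed
  finally show ?thesis using 1 by (simp add: total_profit_def pft_def)
qed

end

section \<open>Local synchronization\<close>

definition own :: "line_network \<Rightarrow> nat \<Rightarrow> dinst list" where
  "own I P = concat (map (\<lambda>R. map (\<lambda>s. (P, R, s))
     (filter (\<lambda>s. rt I P \<le> s \<and> s + ptime I P \<le> Suc (dl I P)) [0..<Suc (slots_n I)]))
     (sorted_list_of_set (Acc I P)))"

lemma finite_Acc: "wf_line I \<Longrightarrow> P < procs_m I \<Longrightarrow> finite (Acc I P)"
  by (auto simp: wf_line_def intro: finite_subset)

lemma set_own:
  assumes "wf_line I" "P < procs_m I"
  shows "set (own I P) = {d \<in> instances I. demand_of d = P}"
proof -
  have *: "(Q, R, s) \<in> set (own I P) \<longleftrightarrow> Q = P \<and> R \<in> Acc I P \<and> rt I P \<le> s \<and>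
      s + ptime I P \<le> Suc (dl I P) \<and> s < Suc (slots_n I)" for Q R s
    using finite_Acc[OF assms] by (auto simp: own_def simp del: upt_Suc)
  have "(Q, R, s) \<in> set (own I P) \<longleftrightarrow> (Q, R, s) \<in> instances I \<and> Q = P" for Q R s
    using assms(2) instances_bounds(4)[OF assms(1), of P R s]
    unfolding * mem_instances_iff[OF assms(1)] by auto
  then show ?thesis by auto
qed

lemma distinct_own: "distinct (own I P)"
proof -
  have *: "distinct (concat (map (\<lambda>R. map (\<lambda>s. (P, R, s)) (f R)) xs))"
    if "distinct xs" "\<And>R. distinct (f R)" for f :: "nat \<Rightarrow> nat list" and xs
    using that by (induction xs) (auto simp: distinct_map inj_on_def)
  show ?thesis unfolding own_def by (rule *) auto
qed

definition nb :: "line_network \<Rightarrow> nat \<Rightarrow> nat \<Rightarrow> bool" where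
  "nb I P Q \<longleftrightarrow> P < procs_m I \<and> Q < procs_m I \<and> P \<noteq> Q \<and> Acc I P \<inter> Acc I Q \<noteq> {}"

lemma nb_sym: "nb I P Q \<longleftrightarrow> nb I Q P"
  by (auto simp: nb_def)

text \<open>Instances of different demands conflict only on a common resource, so all competitors of
  an instance are within one hop.\<close>

lemma conflict_nb:
  assumes "d \<in> instances I" "e \<in> instances I" "conflict I d e" "demand_of d \<noteq> demand_of e"
  shows "nb I (demand_of d) (demand_of e)"
  using assms by (auto simp: conflict_def nb_def instances_def)

text \<open>
  \<open>At i j\<close>: in step \<open>i\<close> of the schedule, where \<open>j = 0\<close> announces the instances raised so far,
  \<open>j = 1\<close> announces the unsatisfied instances, and \<open>j + 2\<close> is round \<open>j\<close> of the computation of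
  an independent set.  \<open>Fin k rest ch\<close>: no unsatisfied instance since step \<open>k\<close>, the raised
  instances in \<open>rest\<close> are still undecided, \<open>ch\<close> is the selected instance.
\<close>

datatype pst = At nat nat | Fin nat "(dinst \<times> nat) list" "dinst option"

definition before :: "nat \<Rightarrow> nat \<Rightarrow> nat \<Rightarrow> nat \<Rightarrow> bool" where
  "before i j i' j' \<longleftrightarrow> i < i' \<or> i = i' \<and> j < j'"

text \<open>\<open>stop P i\<close> is the last position of \<open>P\<close> in step
  \<open>i\<close>. It varies with the processor, since only the halting of its own simulated
  vertices is visible to \<open>P\<close>; \<open>T\<close> bounds it uniformly for the time
  analysis. The 2 stands for the positions 0 and 1.\<close>

locale sync = schedule +
  fixes stop :: "nat \<Rightarrow> nat \<Rightarrow> nat" and T :: nat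
  assumes stop: "2 \<le> stop P i" "stop P i \<le> T + 2"
begin

text \<open>The latest step comes first, so reading from the head is the reverse order needed for
  the greedy selection.\<close>

primrec raised :: "nat \<Rightarrow> nat \<Rightarrow> (dinst \<times> nat) list" where
  "raised P 0 = []"
| "raised P (Suc i) = map (\<lambda>d. (d, i)) (filter (\<lambda>d. d \<in> Z i) (own I P)) @ raised P i"

definition waits :: "(nat \<Rightarrow> pst) \<Rightarrow> nat \<Rightarrow> nat \<Rightarrow> nat \<Rightarrow> bool" where
  "waits X P i j \<longleftrightarrow> (\<exists>Q i' j'. nb I Q P \<and> X Q = At i' j' \<and> before i' j' i j)"

text \<open>Lists are sorted by decreasing step, so the head bounds everything a neighbour may still
  select. Equality is harmless: instances raised in the same step do not conflict.\<close>

definition ready :: "(nat \<Rightarrow> pst) \<Rightarrow> nat \<Rightarrow> nat \<Rightarrow> bool" where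
  "ready X P \<tau> \<longleftrightarrow> (\<forall>Q. nb I Q P \<longrightarrow> (\<exists>k r c. X Q = Fin k r c \<and> (c \<noteq> None \<or> r = [] \<or> snd (hd r) \<le> \<tau>)))"

definition blocked :: "(nat \<Rightarrow> pst) \<Rightarrow> nat \<Rightarrow> dinst \<Rightarrow> bool" where
  "blocked X P d \<longleftrightarrow> (\<exists>Q k r e. nb I Q P \<and> X Q = Fin k r (Some e) \<and> conflict I e d)"

definition pstep :: "(nat \<Rightarrow> pst) \<Rightarrow> nat \<Rightarrow> pst" where
  "pstep X P = (case X P of
     At i j \<Rightarrow> if waits X P i j then At i j
       else if j = 0 then (if \<forall>d\<in>set (own I P). d \<notin> U i then Fin i (raised P i) None else At i 1)
       else if j < stop P i then At i (Suc j) else At (Suc i) 0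
   | Fin k r c \<Rightarrow> (case r of [] \<Rightarrow> X P
       | e # r' \<Rightarrow> if c \<noteq> None \<or> \<not> ready X P (snd e) then X P
           else if blocked X P (fst e) then Fin k r' None else Fin k r' (Some (fst e))))"

primrec conf :: "nat \<Rightarrow> nat \<Rightarrow> pst" where
  "conf 0 = (\<lambda>P. At 0 0)"
| "conf (Suc t) = pstep (conf t)"

declare conf.simps(2) [simp del]

lemma pstep_At:
  assumes "X P = At i j"
  obtains (stay) "waits X P i j" "pstep X P = At i j"
  | (fin) "\<not> waits X P i j" "j = 0" "\<forall>d\<in>set (own I P). d \<notin> U i" "pstep X P = Fin i (raised P i) None"
  | (start) "\<not> waits X P i j" "j = 0" "\<exists>d\<in>set (own I P). d \<in> U i" "pstep X P = At i (Suc 0)"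
  | (round) "\<not> waits X P i j" "0 < j" "j < stop P i" "pstep X P = At i (Suc j)"
  | (next_step) "\<not> waits X P i j" "0 < j" "stop P i \<le> j" "pstep X P = At (Suc i) 0"
proof -
  note X = assms pstep_def pst.case
  consider "waits X P i j" | "\<not> waits X P i j" "j = 0" "\<forall>d\<in>set (own I P). d \<notin> U i"
    | "\<not> waits X P i j" "j = 0" "\<exists>d\<in>set (own I P). d \<in> U i"
    | "\<not> waits X P i j" "0 < j" "j < stop P i" | "\<not> waits X P i j" "0 < j" "stop P i \<le> j"
    by (meson not_gr_zero not_le)
  then show thesis
  proof cases
    case 1
    show ?thesis by (rule stay) (use 1 in \<open>simp_all add: X\<close>)
  next
    case 2
    show ?thesis by (rule fin) (use 2 in \<open>simp_all add: X\<close>)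
  next
    case 3
    show ?thesis by (rule start) (use 3 in \<open>simp_all add: X\<close>)
  next
    case 4
    show ?thesis by (rule round) (use 4 in \<open>simp_all add: X\<close>)
  next
    case 5
    show ?thesis by (rule next_step) (use 5 in \<open>simp_all add: X\<close>)
  qed
qed

lemma pstep_Fin:
  assumes "X P = Fin k r c"
  obtains (stay) "pstep X P = X P" "c \<noteq> None \<or> r = [] \<or> \<not> ready X P (snd (hd r))"
  | (drop) d \<tau> r' where "c = None" "r = (d, \<tau>) # r'" "ready X P \<tau>" "blocked X P d" "pstep X P = Fin k r' None"
  | (pick) d \<tau> r' where "c = None" "r = (d, \<tau>) # r'" "ready X P \<tau>" "\<not> blocked X P d" "pstep X P = Fin k r' (Some d)"
proof -
  note X = assms pstep_def pst.case
  consider "c \<noteq> None \<or> r = [] \<or> \<not> ready X P (snd (hd r))"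
    | d \<tau> r' where "c = None" "r = (d, \<tau>) # r'" "ready X P \<tau>" "blocked X P d"
    | d \<tau> r' where "c = None" "r = (d, \<tau>) # r'" "ready X P \<tau>" "\<not> blocked X P d"
    by (metis list.exhaust_sel prod.collapse)
  then show thesis
  proof cases
    case 1
    show ?thesis by (rule stay) (use 1 in \<open>auto simp: X split: list.split\<close>)
  next
    case (2 d \<tau> r')
    show ?thesis by (rule drop[OF 2]) (use 2 in \<open>simp add: X\<close>)
  next
    case (3 d \<tau> r')
    show ?thesis by (rule pick[OF 3]) (use 3 in \<open>simp add: X\<close>)
  qed
qed

lemma set_raised: "P < procs_m I \<Longrightarrow>
  (d, \<tau>) \<in> set (raised P k) \<longleftrightarrow> demand_of d = P \<and> d \<in> Z \<tau> \<and> \<tau> < k"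
proof (induction k)
  case (Suc k)
  have "d \<in> set (filter (\<lambda>d. d \<in> Z k) (own I P)) \<longleftrightarrow> demand_of d = P \<and> d \<in> Z k"
    using set_own[OF wf Suc.prems] Z_inst[of k] by auto
  then have "(d, \<tau>) \<in> (\<lambda>d. (d, k)) ` set (filter (\<lambda>d. d \<in> Z k) (own I P)) \<longleftrightarrow>
      demand_of d = P \<and> d \<in> Z k \<and> \<tau> = k" by auto
  then show ?case using Suc.IH[OF Suc.prems] by (simp add: less_Suc_eq) blast
qed simp

text \<open>Two instances of one demand conflict, so a processor raises at most one instance per
  step and the order is strict.\<close>

lemma raised_sorted:
  assumes "P < procs_m I"
  shows "sorted_wrt (\<lambda>a b. snd b < snd a) (raised P k)"
proof (induction k)
  case (Suc k)
  define f where "f = filter (\<lambda>d. d \<in> Z k) (own I P)"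
  have *: "d = e" if "d \<in> set f" "e \<in> set f" for d e
    using that Z_indep[of d k e] set_own[OF wf assms] by (simp add: f_def conflict_def)
  have dist: "distinct f" unfolding f_def using distinct_own by simp
  have f: "f = [] \<or> (\<exists>d. f = [d])"
  proof (cases f)
    case (Cons d f')
    note d = Cons
    show ?thesis
    proof (cases f')
      case (Cons e g)
      then show ?thesis using *[of d e] dist d by simp
    qed (use d in blast)
  qed simp
  have lt: "snd a < k" if "a \<in> set (raised P k)" for a
    using that set_raised[OF assms, of "fst a" "snd a" k] by simp
  show ?case using f Suc lt by (auto simp flip: f_def)
qed simp

text \<open>A processor leaves a position only when no running neighbour is before it, so neighbours are
  never more than one move apart.\<close>

definition inv1 :: "(nat \<Rightarrow> pst) \<Rightarrow> bool" where
  "inv1 X \<longleftrightarrow>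
    (\<forall>P i j. P < procs_m I \<longrightarrow> X P = At i j \<longrightarrow> j \<le> stop P i \<and> i \<le> num_steps \<and> (0 < j \<longrightarrow> i < num_steps)) \<and>
    (\<forall>P k r c. P < procs_m I \<longrightarrow> X P = Fin k r c \<longrightarrow> k \<le> num_steps \<and> (\<forall>d\<in>set (own I P). d \<notin> U k)) \<and>
    (\<forall>P Q i j i' j'. nb I P Q \<longrightarrow> X P = At i j \<longrightarrow> X Q = At i' (Suc j') \<longrightarrow> \<not> before i j i' j') \<and>
    (\<forall>P Q i j i'. nb I P Q \<longrightarrow> X P = At i j \<longrightarrow> X Q = At (Suc i') 0 \<longrightarrow> \<not> before i j i' (stop Q i')) \<and>
    (\<forall>P Q i j k r c. nb I P Q \<longrightarrow> X P = At i j \<longrightarrow> X Q = Fin k r c \<longrightarrow> k \<le> i)"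

lemma inv1_At: "inv1 X \<Longrightarrow> P < procs_m I \<Longrightarrow> X P = At i j \<Longrightarrow>
    j \<le> stop P i \<and> i \<le> num_steps \<and> (0 < j \<longrightarrow> i < num_steps)"
  by (simp add: inv1_def)

lemma inv1_Fin: "inv1 X \<Longrightarrow> P < procs_m I \<Longrightarrow> X P = Fin k r c \<Longrightarrow>
    k \<le> num_steps \<and> (\<forall>d\<in>set (own I P). d \<notin> U k)"
  by (simp add: inv1_def)

lemma inv1_nb:
  assumes "inv1 X" "nb I P Q" "X P = At i j"
  shows "X Q = At i' (Suc j') \<Longrightarrow> \<not> before i j i' j'"
    "X Q = At (Suc i') 0 \<Longrightarrow> \<not> before i j i' (stop Q i')"
    "X Q = Fin k r c \<Longrightarrow> k \<le> i"
proof -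
  show "X Q = At i' (Suc j') \<Longrightarrow> \<not> before i j i' j'" using assms by (simp add: inv1_def)
  show "X Q = At (Suc i') 0 \<Longrightarrow> \<not> before i j i' (stop Q i')" using assms by (simp add: inv1_def)
  show "X Q = Fin k r c \<Longrightarrow> k \<le> i" using assms by (simp add: inv1_def)
qed

lemma inv1_init: "inv1 (conf 0)"
  by (auto simp: inv1_def before_def)

lemma pstep_At_ge:
  assumes "pstep X P = At i' j'"
  obtains i j where "X P = At i j" "\<not> before i' j' i j"
proof (cases "X P")
  case (At i j)
  from At show ?thesis
  proof (cases rule: pstep_At)
  qed (use assms At that in \<open>auto simp: before_def\<close>)
next
  case (Fin k r c)
  then show ?thesis by (cases rule: pstep_Fin) (use assms Fin in simp_all)
qed

text \<open>The last three clauses concern the position that \<open>Q\<close> left in its last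
  proper move: \<open>(i', j')\<close> before \<open>(i', Suc j')\<close>,
  \<open>(i', stop Q i')\<close> before \<open>(Suc i', 0)\<close>, and step \<open>k\<close> before
  finishing. \<open>Q\<close> could leave it only when no running neighbour was behind, and
  positions never move back.\<close>

lemma inv1_step:
  assumes inv: "inv1 X"
  shows "inv1 (pstep X)"
  unfolding inv1_def
proof (intro conjI allI impI)
  fix P i j assume P: "P < procs_m I" and "pstep X P = At i j"
  then obtain i0 j0 where X: "X P = At i0 j0" by (rule_tac pstep_At_ge) auto
  have *: "j0 \<le> stop P i0" "i0 \<le> num_steps" "0 < j0 \<Longrightarrow> i0 < num_steps"
    using inv1_At[OF inv P X] by simp_all
  have "i0 < num_steps" if "\<exists>d\<in>set (own I P). d \<in> U i0"
    using that U_empty[of i0] by (metis empty_iff not_less)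
  then have "j \<le> stop P i \<and> i \<le> num_steps \<and> (0 < j \<longrightarrow> i < num_steps)"
    using X stop(1)[of P i0] * \<open>pstep X P = At i j\<close> by (cases rule: pstep_At[of X P i0 j0, OF X]) auto
  then show "j \<le> stop P i" "i \<le> num_steps" "0 < j \<Longrightarrow> i < num_steps" by auto
next
  fix P k r c assume P: "P < procs_m I" and p: "pstep X P = Fin k r c"
  have "k \<le> num_steps \<and> (\<forall>d\<in>set (own I P). d \<notin> U k)"
  proof (cases "X P")
    case (At i j)
    then have "i \<le> num_steps" using inv1_At[OF inv P] by blast
    from At this show ?thesis using p by (cases rule: pstep_At) auto
  next
    case (Fin k' r' c')
    have *: "k' \<le> num_steps \<and> (\<forall>d\<in>set (own I P). d \<notin> U k')" by (rule inv1_Fin[OF inv P Fin])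
    from Fin show ?thesis by (cases rule: pstep_Fin) (use Fin p * in auto)
  qed
  then show "k \<le> num_steps" "\<forall>d\<in>set (own I P). d \<notin> U k" by auto
next
  fix P Q i j i' j' assume PQ: "nb I P Q" and P: "pstep X P = At i j" and Q: "pstep X Q = At i' (Suc j')"
  obtain i0 j0 where P0: "X P = At i0 j0" "\<not> before i j i0 j0" using P by (rule pstep_At_ge)
  obtain i1 j1 where Q0: "X Q = At i1 j1" using Q by (rule pstep_At_ge)
  have w: "\<not> before i0 j0 i1 j1" if "\<not> waits X Q i1 j1"
    using that PQ P0(1) unfolding waits_def by blast
  have "\<not> before i0 j0 i' j'"
    using Q0
  proof (cases rule: pstep_At)
    case stay
    then have "X Q = At i' (Suc j')" using Q Q0 by simp
    then show ?thesis using inv1_nb[OF inv PQ P0(1)] by blast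
  qed (use Q w in auto)
  then show "\<not> before i j i' j'" using P0(2) by (auto simp: before_def)
next
  fix P Q i j i' assume PQ: "nb I P Q" and P: "pstep X P = At i j" and Q: "pstep X Q = At (Suc i') 0"
  obtain i0 j0 where P0: "X P = At i0 j0" "\<not> before i j i0 j0" using P by (rule pstep_At_ge)
  obtain i1 j1 where Q0: "X Q = At i1 j1" using Q by (rule pstep_At_ge)
  have w: "\<not> before i0 j0 i1 j1" if "\<not> waits X Q i1 j1"
    using that PQ P0(1) unfolding waits_def by blast
  have "\<not> before i0 j0 i' (stop Q i')"
    using Q0
  proof (cases rule: pstep_At)
    case stay
    then have "X Q = At (Suc i') 0" using Q Q0 by simp
    then show ?thesis using inv1_nb[OF inv PQ P0(1)] by blast
  next
    case next_step
    then show ?thesis using Q w by (auto simp: before_def)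
  qed (use Q w in auto)
  then show "\<not> before i j i' (stop Q i')" using P0(2) by (auto simp: before_def)
next
  fix P Q i j k r c assume PQ: "nb I P Q" and P: "pstep X P = At i j" and Q: "pstep X Q = Fin k r c"
  obtain i0 j0 where P0: "X P = At i0 j0" "\<not> before i j i0 j0" using P by (rule pstep_At_ge)
  have "k \<le> i0"
  proof (cases "X Q")
    case (At i1 j1)
    have w: "\<not> before i0 j0 i1 j1" if "\<not> waits X Q i1 j1"
      using that PQ P0(1) At unfolding waits_def by blast
    from At show ?thesis using Q w by (cases rule: pstep_At) (auto simp: before_def)
  next
    case (Fin k' r' c')
    have *: "k' \<le> i0" by (rule inv1_nb(3)[OF inv PQ P0(1) Fin])
    from Fin show ?thesis by (cases rule: pstep_Fin) (use Fin Q * in auto)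
  qed
  then show "k \<le> i" using P0(2) by (auto simp: before_def)
qed

lemma inv1_conf: "inv1 (conf t)"
  by (induction t) (auto simp only: conf.simps(2) inv1_init inv1_step)

section \<open>Greedy selection in reverse order\<close>

definition later_blocker :: "(nat \<Rightarrow> pst) \<Rightarrow> dinst \<times> nat \<Rightarrow> bool" where
  "later_blocker X a \<longleftrightarrow> (\<exists>Q k r d j. Q < procs_m I \<and> X Q = Fin k r (Some d) \<and> d \<in> Z j \<and> snd a < j \<and>
     conflict I (fst a) d)"

text \<open>The first two clauses cut the list of raised instances into dropped ones, the selected
  one and the rest; dropped ones are blocked by a choice raised strictly later, as the charging
  argument demands. The third says that a choice is made only when the neighbours have settled
  everything raised later, the fourth that choices of neighbours are compatible.\<close>

definition inv2 :: "(nat \<Rightarrow> pst) \<Rightarrow> bool" where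
  "inv2 X \<longleftrightarrow>
    (\<forall>P k r. P < procs_m I \<longrightarrow> X P = Fin k r None \<longrightarrow>
      (\<exists>dr. raised P k = dr @ r \<and> (\<forall>a\<in>set dr. later_blocker X a))) \<and>
    (\<forall>P k r d. P < procs_m I \<longrightarrow> X P = Fin k r (Some d) \<longrightarrow>
      (\<exists>dr j. raised P k = dr @ (d, j) # r \<and> (\<forall>a\<in>set dr. later_blocker X a))) \<and>
    (\<forall>P Q k r d j. nb I P Q \<longrightarrow> X Q = Fin k r (Some d) \<longrightarrow> d \<in> Z j \<longrightarrow>
      (\<exists>k' r' c'. X P = Fin k' r' c' \<and> (c' = None \<longrightarrow> (\<forall>a\<in>set r'. snd a \<le> j)))) \<and>
    (\<forall>P Q k r d k' r' e. nb I P Q \<longrightarrow> X P = Fin k r (Some d) \<longrightarrow> X Q = Fin k' r' (Some e) \<longrightarrow>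
      \<not> conflict I d e)"

lemma inv2_None: "inv2 X \<Longrightarrow> P < procs_m I \<Longrightarrow> X P = Fin k r None \<Longrightarrow>
    \<exists>dr. raised P k = dr @ r \<and> (\<forall>a\<in>set dr. later_blocker X a)"
  by (simp add: inv2_def del: split_paired_All split_paired_Ex)

lemma inv2_Some: "inv2 X \<Longrightarrow> P < procs_m I \<Longrightarrow> X P = Fin k r (Some d) \<Longrightarrow>
    \<exists>dr j. raised P k = dr @ (d, j) # r \<and> (\<forall>a\<in>set dr. later_blocker X a)"
  by (simp add: inv2_def del: split_paired_All split_paired_Ex)

lemma inv2_nb_Some: "inv2 X \<Longrightarrow> nb I P Q \<Longrightarrow> X Q = Fin k r (Some d) \<Longrightarrow> d \<in> Z j \<Longrightarrow>
    \<exists>k' r' c'. X P = Fin k' r' c' \<and> (c' = None \<longrightarrow> (\<forall>a\<in>set r'. snd a \<le> j))"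
  by (simp add: inv2_def del: split_paired_All split_paired_Ex)

lemma inv2_nb_conflict: "inv2 X \<Longrightarrow> nb I P Q \<Longrightarrow> X P = Fin k r (Some d) \<Longrightarrow> X Q = Fin k' r' (Some e) \<Longrightarrow>
    \<not> conflict I d e"
  by (simp add: inv2_def del: split_paired_All split_paired_Ex)

lemma inv2_init: "inv2 (conf 0)"
  by (auto simp: inv2_def)

lemma pstep_keeps_choice: "X P = Fin k r (Some d) \<Longrightarrow> pstep X P = Fin k r (Some d)"
  by (auto simp: pstep_def split: list.split)

lemma later_blocker_step: "later_blocker X a \<Longrightarrow> later_blocker (pstep X) a"
  unfolding later_blocker_def using pstep_keeps_choice by blast

lemma inv2_rest:
  assumes "inv2 X" "P < procs_m I" "X P = Fin k r None"
  shows "sorted_wrt (\<lambda>a b. snd b < snd a) r" "\<And>d j. (d, j) \<in> set r \<Longrightarrow> demand_of d = P \<and> d \<in> Z j \<and> j < k"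
proof -
  obtain dr where dr: "raised P k = dr @ r" using inv2_None[OF assms] by blast
  then show "sorted_wrt (\<lambda>a b. snd b < snd a) r" using raised_sorted[OF assms(2), of k]
    by (simp add: sorted_wrt_append)
  fix d j assume "(d, j) \<in> set r"
  then have "(d, j) \<in> set (raised P k)" using dr by simp
  then show "demand_of d = P \<and> d \<in> Z j \<and> j < k" using set_raised[OF assms(2)] by blast
qed

lemma inv2_chosen:
  assumes "inv2 X" "P < procs_m I" "X P = Fin k r (Some d)"
  obtains j where "d \<in> Z j" "demand_of d = P" "j < k" "\<And>a. a \<in> set r \<Longrightarrow> snd a < j"
proof -
  obtain dr j where dr: "raised P k = dr @ (d, j) # r" using inv2_Some[OF assms] by blast
  then have "(d, j) \<in> set (raised P k)" by simp
  then have "demand_of d = P \<and> d \<in> Z j \<and> j < k" using set_raised[OF assms(2)] by blast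
  moreover have "snd a < j" if "a \<in> set r" for a
    using raised_sorted[OF assms(2), of k] that unfolding dr by (auto simp: sorted_wrt_append)
  ultimately show ?thesis using that by blast
qed

lemma ready_rest:
  assumes inv: "inv2 X" and "ready X P \<tau>" "nb I Q P"
  obtains k r c where "X Q = Fin k r c" "c = None \<Longrightarrow> \<forall>a\<in>set r. snd a \<le> \<tau>"
proof -
  obtain k r c where *: "X Q = Fin k r c" "c \<noteq> None \<or> r = [] \<or> snd (hd r) \<le> \<tau>"
    using assms(2,3) unfolding ready_def by blast
  have "\<forall>a\<in>set r. snd a \<le> \<tau>" if "c = None"
  proof (cases r)
    case (Cons b r')
    have "Q < procs_m I" using assms(3) by (simp add: nb_def)
    then have "sorted_wrt (\<lambda>a b. snd b < snd a) (b # r')" using inv2_rest(1)[OF inv] *(1) that Cons by blast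
    then show ?thesis using * that Cons by force
  qed simp
  then show ?thesis using that * by blast
qed

lemma inv2_step:
  assumes inv: "inv2 X"
  shows "inv2 (pstep X)"
  unfolding inv2_def
proof (intro conjI allI impI)
  fix P k r assume P: "P < procs_m I" and p: "pstep X P = Fin k r None"
  show "\<exists>dr. raised P k = dr @ r \<and> (\<forall>a\<in>set dr. later_blocker (pstep X) a)"
  proof (cases "X P")
    case (At i j)
    from At show ?thesis using p by (cases rule: pstep_At) auto
  next
    case (Fin k' r0 c)
    from Fin show ?thesis
    proof (cases rule: pstep_Fin)
      case stay
      then have "X P = Fin k r None" using p by simp
      then obtain dr where "raised P k = dr @ r" "\<forall>a\<in>set dr. later_blocker X a"
        using inv2_None[OF inv P] by blast
      then show ?thesis using later_blocker_step by blast
    next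
      case (drop d \<tau> r')
      then have k: "k' = k" "r' = r" and X: "X P = Fin k ((d, \<tau>) # r) None" using p Fin by auto
      obtain dr where dr: "raised P k = dr @ (d, \<tau>) # r" "\<forall>a\<in>set dr. later_blocker X a"
        using inv2_None[OF inv P X] by blast
      obtain Q kq rq e where Q: "nb I Q P" "X Q = Fin kq rq (Some e)" "conflict I e d"
        using drop(4) unfolding blocked_def by blast
      have Qm: "Q < procs_m I" using Q(1) by (simp add: nb_def)
      obtain j where j: "e \<in> Z j" using inv2_chosen[OF inv Qm Q(2)] by blast
      have "nb I P Q" using Q(1) nb_sym by blast
      then obtain k2 r2 c2 where X2: "X P = Fin k2 r2 c2" "c2 = None \<longrightarrow> (\<forall>a\<in>set r2. snd a \<le> j)"
        using inv2_nb_Some[OF inv _ Q(2) j] by blast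
      then have "r2 = (d, \<tau>) # r" "c2 = None" using X by simp_all
      then have "\<tau> \<le> j" using X2(2) by simp
      moreover have "d \<in> Z \<tau>" using inv2_rest(2)[OF inv P X] by simp
      \<comment> \<open>The third clause of the invariant only gives \<tau> \<le> j; equality is
        excluded because instances raised in one step do not conflict.\<close>
      then have "\<tau> \<noteq> j" using Z_indep j Q(3) by blast
      ultimately have "\<tau> < j" by simp
      moreover have "conflict I d e" using Q(3) conflict_sym by blast
      ultimately have "later_blocker X (d, \<tau>)"
        using Qm Q(2) j unfolding later_blocker_def fst_conv snd_conv by blast
      then have "\<forall>a\<in>set (dr @ [(d, \<tau>)]). later_blocker (pstep X) a"
        using dr(2) later_blocker_step by auto
      moreover have "raised P k = (dr @ [(d, \<tau>)]) @ r" using dr by simp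
      ultimately show ?thesis by blast
    qed (use p in auto)
  qed
next
  fix P k r d assume P: "P < procs_m I" and p: "pstep X P = Fin k r (Some d)"
  show "\<exists>dr j. raised P k = dr @ (d, j) # r \<and> (\<forall>a\<in>set dr. later_blocker (pstep X) a)"
  proof (cases "X P")
    case (At i j)
    from At show ?thesis using p by (cases rule: pstep_At) auto
  next
    case (Fin k' r0 c)
    from Fin show ?thesis
    proof (cases rule: pstep_Fin)
      case stay
      then have "X P = Fin k r (Some d)" using p by simp
      then obtain dr j where "raised P k = dr @ (d, j) # r" "\<forall>a\<in>set dr. later_blocker X a"
        using inv2_Some[OF inv P] by blast
      then show ?thesis using later_blocker_step by blast
    next
      case (pick d' \<tau> r')
      then have "X P = Fin k ((d, \<tau>) # r) None" using p Fin by auto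
      then obtain dr where dr: "raised P k = dr @ (d, \<tau>) # r" "\<forall>a\<in>set dr. later_blocker X a"
        using inv2_None[OF inv P] by blast
      then show ?thesis using later_blocker_step by blast
    qed (use p in auto)
  qed
next
  fix P Q k r d j assume PQ: "nb I P Q" and q: "pstep X Q = Fin k r (Some d)" and d: "d \<in> Z j"
  have PQm: "P < procs_m I" "Q < procs_m I" using PQ by (auto simp: nb_def)
  have "\<exists>k' r' c'. X P = Fin k' r' c' \<and> (c' = None \<longrightarrow> (\<forall>a\<in>set r'. snd a \<le> j))"
  proof (cases "X Q")
    case (At i j)
    from At show ?thesis using q by (cases rule: pstep_At) auto
  next
    case (Fin k' r0 c)
    from Fin show ?thesis
    proof (cases rule: pstep_Fin)
      case stay
      then have "X Q = Fin k r (Some d)" using q by simp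
      then show ?thesis using inv2_nb_Some[OF inv PQ _ d] by blast
    next
      case (pick d' \<tau> r')
      then have X: "X Q = Fin k ((d, \<tau>) # r) None" and "ready X Q \<tau>" using q Fin by auto
      have "d \<in> Z \<tau>" using inv2_rest(2)[OF inv PQm(2) X] by simp
      then have "\<tau> = j" using d Z_unique by blast
      then show ?thesis using ready_rest[OF inv \<open>ready X Q \<tau>\<close> PQ] by metis
    qed (use q in auto)
  qed
  then obtain k' r' c' where P: "X P = Fin k' r' c'" "c' = None \<longrightarrow> (\<forall>a\<in>set r'. snd a \<le> j)" by blast
  from P(1) show "\<exists>k' r' c'. pstep X P = Fin k' r' c' \<and> (c' = None \<longrightarrow> (\<forall>a\<in>set r'. snd a \<le> j))"
    by (cases rule: pstep_Fin) (use P in auto)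
next
  fix P Q k r d k' r' e
  assume PQ: "nb I P Q" and p: "pstep X P = Fin k r (Some d)" and q: "pstep X Q = Fin k' r' (Some e)"
  have PQm: "P < procs_m I" "Q < procs_m I" using PQ by (auto simp: nb_def)
  have new: "(\<exists>k r. X P = Fin k r (Some d)) \<or>
      (\<exists>k r \<tau>. X P = Fin k ((d, \<tau>) # r) None \<and> ready X P \<tau> \<and> \<not> blocked X P d)"
    if p: "pstep X P = Fin k r (Some d)" for P k r d
  proof (cases "X P")
    case (At i j)
    from At show ?thesis using p by (cases rule: pstep_At) auto
  next
    case (Fin k' r0 c)
    from Fin show ?thesis by (cases rule: pstep_Fin) (use p Fin in auto)
  qed
  show "\<not> conflict I d e"
    using new[OF p]
  proof (elim disjE exE conjE)
    fix k r assume P: "X P = Fin k r (Some d)"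
    show ?thesis using new[OF q]
    proof (elim disjE exE conjE)
      fix k' r' assume "X Q = Fin k' r' (Some e)"
      then show ?thesis by (rule inv2_nb_conflict[OF inv PQ P])
    next
      fix k' r' \<tau> assume "\<not> blocked X Q e"
      then show ?thesis using PQ P unfolding blocked_def by blast
    qed
  next
    fix k r \<tau> assume P: "X P = Fin k ((d, \<tau>) # r) None" "ready X P \<tau>" "\<not> blocked X P d"
    show ?thesis using new[OF q]
    proof (elim disjE exE conjE)
      fix k' r' assume "X Q = Fin k' r' (Some e)"
      then show ?thesis using P(3) PQ nb_sym conflict_sym unfolding blocked_def by blast
    next
      fix k' r' \<tau>' assume Q: "X Q = Fin k' ((e, \<tau>') # r') None" "ready X Q \<tau>'"
      \<comment> \<open>Both processors choose in the same round, so neither sees the other's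
        choice. Mutual readiness forces the same step, where independence applies.\<close>
      have "\<tau>' \<le> \<tau>" using P(2) Q(1) PQ nb_sym[of I P Q] unfolding ready_def by force
      moreover have "\<tau> \<le> \<tau>'" using Q(2) P(1) PQ unfolding ready_def by force
      ultimately have "\<tau>' = \<tau>" by simp
      moreover have "d \<in> Z \<tau>" using inv2_rest(2)[OF inv PQm(1) P(1)] by simp
      moreover have "e \<in> Z \<tau>'" using inv2_rest(2)[OF inv PQm(2) Q(1)] by simp
      ultimately show ?thesis using Z_indep by blast
    qed
  qed
qed

lemma inv2_conf: "inv2 (conf t)"
  by (induction t) (auto simp only: conf.simps(2) inv2_init inv2_step)

text \<open>In a lockstep run every step would take the \<open>T + 3\<close> positions 0 to
  \<open>T + 2\<close>, and time \<open>t\<close> would be at position \<open>(i, j)\<close>. A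
  processor exactly at the lockstep position has nobody behind it and does not wait, so by induction
  nobody falls behind lockstep.\<close>

lemma progress1:
  assumes "t = i * (T + 3) + j" "j \<le> T + 2" "P < procs_m I" "conf t P = At i' j'"
  shows "\<not> before i' j' i j"
  using assms
proof (induction t arbitrary: i j P i' j')
  case 0
  then show ?case by (auto simp: before_def)
next
  case (Suc t)
  obtain i0 j0 where X: "conf t P = At i0 j0" "\<not> before i' j' i0 j0"
    using Suc.prems(4) unfolding conf.simps(2) by (rule pstep_At_ge)
  define i1 j1 where "i1 = (if j = 0 then i - 1 else i)" and "j1 = (if j = 0 then T + 2 else j - 1)"
  have t: "t = i1 * (T + 3) + j1" "j1 \<le> T + 2"
    using Suc.prems(1,2) by (cases i; auto simp: i1_def j1_def)+
  have ge: "\<not> before i' j' i1 j1" if "Q < procs_m I" "conf t Q = At i' j'" for Q i' j'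
    by (rule Suc.IH[OF t that])
  have j0: "j0 \<le> T + 2" using inv1_At[OF inv1_conf Suc.prems(3) X(1)] stop(2)[of P i0] by simp
  have ij: "(i = i1 \<and> j = Suc j1 \<and> j1 < T + 2) \<or> (i = Suc i1 \<and> j = 0 \<and> j1 = T + 2)"
    using Suc.prems(1,2) by (cases i) (auto simp: i1_def j1_def)
  show ?case
  proof (cases "i0 = i1 \<and> j0 = j1")
    case True
    have "\<not> waits (conf t) P i0 j0" using ge True unfolding waits_def nb_def by blast
    with X(1) show ?thesis
      by (cases rule: pstep_At)
        (use True ij Suc.prems(4) stop(2)[of P i0] in \<open>auto simp: before_def conf.simps(2)\<close>)
  next
    case False
    then show ?thesis using ge[OF Suc.prems(3) X(1)] X(2) ij j0 by (auto simp: before_def)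
  qed
qed

text \<open>Lockstep reaches the start of step \<open>num_steps\<close> at
  \<open>num_steps * (T + 3)\<close>; one further move discovers that nothing is
  unsatisfied.\<close>

definition fin_time :: nat where
  "fin_time = Suc (num_steps * (T + 3))"

lemma all_Fin:
  assumes "P < procs_m I"
  obtains k r c where "conf (fin_time + s) P = Fin k r c"
proof -
  have "\<exists>k r c. conf (fin_time + s) P = Fin k r c"
  proof (induction s)
    case 0
    let ?t = "num_steps * (T + 3)"
    show ?case
    proof (cases "conf ?t P")
      case (At i j)
      have ge: "i = num_steps \<and> j = 0" if "Q < procs_m I" "conf ?t Q = At i j" for Q i j
      proof -
        have "\<not> before i j num_steps 0" using progress1[of ?t num_steps 0] that by auto
        moreover have "i \<le> num_steps \<and> (0 < j \<longrightarrow> i < num_steps)"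
          by (rule inv1_At[OF inv1_conf that, THEN conjunct2])
        ultimately show ?thesis by (auto simp: before_def)
      qed
      have "\<not> waits (conf ?t) P i j"
        using ge[OF assms At] ge unfolding waits_def nb_def before_def by (metis less_irrefl)
      then show ?thesis using At ge[OF assms At] U_num_steps
        by (simp add: fin_time_def conf.simps(2) pstep_def)
    next
      case (Fin k r c)
      from Fin show ?thesis
        by (cases rule: pstep_Fin) (use Fin in \<open>auto simp: fin_time_def conf.simps(2)\<close>)
    qed
  next
    case (Suc s)
    then obtain k r c where F: "conf (fin_time + s) P = Fin k r c" by blast
    then show ?case
      by (cases rule: pstep_Fin) (use F in \<open>auto simp: conf.simps(2)\<close>)
  qed
  then show ?thesis using that by blast
qed

text \<open>A processor whose undecided head has the largest step possible after \<open>s\<close>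
  rounds is ready, since the heads of its undecided neighbours are at most equal. Thus the bound on
  undecided steps drops in every round.\<close>

lemma progress2:
  assumes "P < procs_m I" "conf (fin_time + s) P = Fin k r None" "r \<noteq> []"
  shows "snd (hd r) + s < num_steps"
  using assms
proof (induction s arbitrary: P k r)
  case 0
  have "k \<le> num_steps" using inv1_Fin[OF inv1_conf 0(1,2)] by blast
  moreover have "(fst (hd r), snd (hd r)) \<in> set r" using 0 by simp
  then have "snd (hd r) < k" using inv2_rest(2)[OF inv2_conf 0(1,2)] by blast
  ultimately show ?case by simp
next
  case (Suc s)
  let ?X = "conf (fin_time + s)"
  obtain k0 r0 c0 where X: "?X P = Fin k0 r0 c0" using all_Fin[OF Suc.prems(1)] by blast
  have p: "pstep ?X P = Fin k r None" using Suc.prems(2) by (simp add: conf.simps(2))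
  from X show ?case
  proof (cases rule: pstep_Fin)
    case stay
    then have c: "k0 = k" "r0 = r" "c0 = None" using p X by auto
    then have nr: "\<not> ready ?X P (snd (hd r))" using stay Suc.prems(3) by simp
    have lt: "snd (hd r) + s < num_steps" using Suc.IH[OF Suc.prems(1)] X c Suc.prems(3) by blast
    have "snd (hd r) + Suc s \<noteq> num_steps"
    proof
      assume eq: "snd (hd r) + Suc s = num_steps"
      have "ready ?X P (snd (hd r))" unfolding ready_def
      proof (intro allI impI)
        fix Q assume "nb I Q P"
        then have Q: "Q < procs_m I" by (simp add: nb_def)
        obtain kq rq cq where XQ: "?X Q = Fin kq rq cq" using all_Fin[OF Q] by blast
        have "cq \<noteq> None \<or> rq = [] \<or> snd (hd rq) \<le> snd (hd r)"
          using Suc.IH[OF Q, of kq rq] XQ eq by (cases cq; cases "rq = []") auto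
        then show "\<exists>k r' c. ?X Q = Fin k r' c \<and> (c \<noteq> None \<or> r' = [] \<or> snd (hd r') \<le> snd (hd r))"
          using XQ by blast
      qed
      then show False using nr by blast
    qed
    then show ?thesis using lt by simp
  next
    case (drop d \<tau> r')
    then have r: "?X P = Fin k0 ((d, \<tau>) # r) None" using p X by auto
    then have "\<tau> + s < num_steps" using Suc.IH[OF Suc.prems(1) r] by simp
    moreover have "snd (hd r) < \<tau>"
      using inv2_rest(1)[OF inv2_conf Suc.prems(1) r] Suc.prems(3) by (cases r) auto
    ultimately show ?thesis by simp
  qed (use p in auto)
qed

definition end_time :: nat where
  "end_time = fin_time + num_steps"

lemma end_Fin:
  assumes "P < procs_m I"
  obtains k r c where "conf end_time P = Fin k r c" "c \<noteq> None \<or> r = []"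
proof -
  obtain k r c where *: "conf end_time P = Fin k r c"
    using all_Fin[OF assms] unfolding end_time_def by blast
  then have "c \<noteq> None \<or> r = []" using progress2[OF assms, of num_steps k r] unfolding end_time_def by (cases c; cases "r = []") auto
  then show ?thesis using * that by blast
qed

section \<open>Feasibility and profit of the selected instances\<close>

definition selected :: "dinst set" where
  "selected = {d. \<exists>P<procs_m I. \<exists>k r. conf end_time P = Fin k r (Some d)}"

lemma selected_inst: "selected \<subseteq> instances I"
proof
  fix d assume "d \<in> selected"
  then obtain P k r where "P < procs_m I" "conf end_time P = Fin k r (Some d)"
    unfolding selected_def by blast
  then obtain j where "d \<in> Z j" using inv2_chosen[OF inv2_conf] by blast
  then show "d \<in> instances I" using Z_inst by blast
qed

lemma selected_feasible: "feasible I selected"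
  unfolding feasible_iff[OF wf]
proof (intro conjI ballI selected_inst)
  fix d e assume de: "d \<in> selected" "e \<in> selected"
  obtain P k r where P: "P < procs_m I" "conf end_time P = Fin k r (Some d)"
    using de unfolding selected_def by blast
  obtain Q k' r' where Q: "Q < procs_m I" "conf end_time Q = Fin k' r' (Some e)"
    using de unfolding selected_def by blast
  have dem: "demand_of d = P" "demand_of e = Q"
    using inv2_chosen[OF inv2_conf P] inv2_chosen[OF inv2_conf Q] by blast+
  show "\<not> conflict I d e"
  proof
    assume c: "conflict I d e"
    then have "d \<noteq> e" by (auto simp: conflict_def)
    then have "P \<noteq> Q" using P Q by auto
    then have "nb I P Q" using conflict_nb[OF _ _ c] de selected_inst dem by blast
    then show False using inv2_nb_conflict[OF inv2_conf _ P(2) Q(2)] c by blast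
  qed
qed

text \<open>A raised instance was dropped, selected, or left behind in the list of its processor. A
  dropped one has a later blocker; one left behind conflicts with the choice for the same demand,
  which stands earlier in the list and was thus raised later.\<close>

lemma selected_profit:
  assumes "feasible I Opt"
  shows "(1 - \<theta>) / 4 * total_profit I Opt \<le> total_profit I selected"
proof (rule approximation[OF _ _ _ assms])
  show "selected \<subseteq> (\<Union>i. Z i)"
  proof
    fix d assume "d \<in> selected"
    then obtain P k r where "P < procs_m I" "conf end_time P = Fin k r (Some d)"
      unfolding selected_def by blast
    then obtain j where "d \<in> Z j" using inv2_chosen[OF inv2_conf] by metis
    then show "d \<in> (\<Union>i. Z i)" by blast
  qed
  show "finite selected" using finite_instances[OF wf] selected_inst finite_subset by blast
  fix i e assume e: "e \<in> Z i"
  define P where "P = demand_of e"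
  have inst: "e \<in> instances I" using e Z_inst by blast
  then have P: "P < procs_m I" by (auto simp: P_def instances_def)
  obtain k r c where X: "conf end_time P = Fin k r c" "c \<noteq> None \<or> r = []" using end_Fin[OF P] by blast
  have sat: "\<forall>d\<in>set (own I P). d \<notin> U k" using inv1_Fin[OF inv1_conf P X(1)] by blast
  have "e \<in> set (own I P)" using set_own[OF wf P] inst P_def by simp
  then have "e \<notin> U k" using sat by blast
  moreover have "e \<in> U i" using e Z_U by blast
  ultimately have "i < k" using U_antimono[of k i] by (cases "i < k") auto
  then have ek: "(e, i) \<in> set (raised P k)" using e set_raised[OF P] P_def by blast
  have later: "\<exists>d\<in>selected. \<exists>j. d \<in> Z j \<and> i < j \<and> conflict I e d" if lb: "later_blocker (conf end_time) (e, i)"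
  proof -
    obtain Q k r d j where *: "Q < procs_m I" "conf end_time Q = Fin k r (Some d)" "d \<in> Z j" "i < j"
      "conflict I e d" using lb unfolding later_blocker_def fst_conv snd_conv by blast
    have "d \<in> selected" unfolding selected_def using *(1,2) by blast
    then show ?thesis using * by blast
  qed
  show "e \<in> selected \<or> (\<exists>d\<in>selected. \<exists>j. d \<in> Z j \<and> i < j \<and> conflict I e d)"
  proof (cases c)
    case None
    then obtain dr where "raised P k = dr @ r" "\<forall>a\<in>set dr. later_blocker (conf end_time) a"
      using inv2_None[OF inv2_conf P] X(1) by blast
    moreover have "r = []" using X(2) None by simp
    ultimately show ?thesis using ek later by auto
  next
    case (Some d)
    then obtain dr j where dr: "raised P k = dr @ (d, j) # r" "\<forall>a\<in>set dr. later_blocker (conf end_time) a"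
      using inv2_Some[OF inv2_conf P] X(1) by blast
    have d: "d \<in> selected" using P X(1) Some unfolding selected_def by blast
    have dZ: "demand_of d = P" "d \<in> Z j" using set_raised[OF P, of d j k] dr by auto
    from ek have "(e, i) \<in> set dr \<union> {(d, j)} \<union> set r" unfolding dr(1) by auto
    then consider "(e, i) \<in> set dr" | "e = d" | "(e, i) \<in> set r" by blast
    then show ?thesis
    proof cases
      case 3
      then have ij: "i < j" using raised_sorted[OF P, of k] dr(1) by (auto simp: sorted_wrt_append)
      then have "e \<noteq> d" using e dZ Z_unique by blast
      then have "conflict I e d" using dZ P_def by (simp add: conflict_def)
      then show ?thesis using d dZ ij by blast
    next
      case 1
      then show ?thesis using dr(2) later by blast
    qed (use d in blast)
  qed
qed

end

section \<open>Encodings\<close>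

abbreviation NumN :: "nat \<Rightarrow> val" where
  "NumN k \<equiv> Num (real k)"

text \<open>A mixed radix number with digits demand, resource and slot, the slot shifted because
  timeslots start at 1. All identifiers lie below \<open>num_vertices I\<close>, the size for which
  the rounds of \<open>M\<close> are counted.\<close>

definition vid :: "line_network \<Rightarrow> dinst \<Rightarrow> nat" where
  "vid I d = demand_of d * (slots_n I * ress_r I) + resource_of d * slots_n I + (start_of d - 1)"

definition num_vertices :: "line_network \<Rightarrow> nat" where
  "num_vertices I = slots_n I * procs_m I * ress_r I"

lemma mixed_radix_inj:
  fixes a b a' b' k :: nat
  assumes "a * k + b = a' * k + b'" "b < k" "b' < k"
  shows "a = a' \<and> b = b'"
proof -
  have "(a * k + b) div k = a" "(a' * k + b') div k = a'" using assms(2,3) by auto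
  then show ?thesis using assms(1) by simp
qed

lemma mixed_radix_less:
  fixes a b k m :: nat
  assumes "a < m" "b < k"
  shows "a * k + b < m * k"
proof -
  have "a * k + b < Suc a * k" using assms(2) by simp
  also have "\<dots> \<le> m * k" using assms(1) by (intro mult_le_mono1) simp
  finally show ?thesis .
qed

lemma inj_on_vid:
  assumes "wf_line I"
  shows "inj_on (vid I) (instances I)"
proof (rule inj_onI, safe)
  fix P R s P' R' s'
  assume *: "(P, R, s) \<in> instances I" "(P', R', s') \<in> instances I" "vid I (P, R, s) = vid I (P', R', s')"
  note b = instances_bounds[OF assms *(1)] instances_bounds[OF assms *(2)]
  have "R * slots_n I + (s - 1) < ress_r I * slots_n I" "R' * slots_n I + (s' - 1) < ress_r I * slots_n I"
    by (rule mixed_radix_less; use b in auto)+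
  then have "P = P' \<and> R * slots_n I + (s - 1) = R' * slots_n I + (s' - 1)"
    using *(3) by (intro mixed_radix_inj) (auto simp: vid_def ac_simps)
  moreover then have "R = R' \<and> s - 1 = s' - 1" using b by (intro mixed_radix_inj) auto
  ultimately show "P = P'" "R = R'" "s = s'" using b by auto
qed

lemma vid_less:
  assumes "wf_line I" "d \<in> instances I"
  shows "vid I d < num_vertices I"
proof (cases d)
  case (fields P R s)
  note b = instances_bounds[OF assms(1) assms(2)[unfolded fields]]
  have "R * slots_n I + (s - 1) < ress_r I * slots_n I"
    by (rule mixed_radix_less; use b in auto)
  then have "P * (ress_r I * slots_n I) + (R * slots_n I + (s - 1)) < procs_m I * (ress_r I * slots_n I)"
    using b by (intro mixed_radix_less) auto
  then show ?thesis by (simp add: fields vid_def num_vertices_def ac_simps)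
qed

lemma vid_eq_iff: "wf_line I \<Longrightarrow> d \<in> instances I \<Longrightarrow> e \<in> instances I \<Longrightarrow> vid I d = vid I e \<longleftrightarrow> d = e"
  using inj_on_vid inj_on_eq_iff by metis

lemma card_instances_le:
  assumes "wf_line I"
  shows "card (instances I) \<le> num_vertices I"
proof -
  have "card (instances I) = card (vid I ` instances I)" using inj_on_vid[OF assms] by (simp add: card_image)
  also have "\<dots> \<le> card {..<num_vertices I}" using vid_less[OF assms] by (intro card_mono) auto
  finally show ?thesis by simp
qed

text \<open>Contains all that neighbours need for conflicts and critical points, in particular the
  length, as they do not know each other's demands. The identifier makes equality of instances a
  single comparison.\<close>

definition einst :: "line_network \<Rightarrow> dinst \<Rightarrow> val" where
  "einst I d = vlist [NumN (vid I d), NumN (demand_of d), NumN (resource_of d), NumN (start_of d),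
     NumN (len_of I d)]"

lemma eval_sel_einst [simp]:
  "eval (sel 0) (einst I d) = NumN (vid I d)"
  "eval (sel (Suc 0)) (einst I d) = NumN (demand_of d)"
  "eval (sel 2) (einst I d) = NumN (resource_of d)"
  "eval (sel 3) (einst I d) = NumN (start_of d)"
  "eval (sel 4) (einst I d) = NumN (len_of I d)"
  by (simp_all add: einst_def del: sel.simps)

lemma einst_not_Null [simp]: "einst I d \<noteq> Null"
  by (simp add: einst_def)

definition inp :: "line_network \<Rightarrow> nat \<Rightarrow> val" where
  "inp I P = input (line_comm I) P"

lemma eval_sel_inp [simp]:
  "eval (sel 0) (inp I P) = NumN (slots_n I)"
  "eval (sel (Suc 0)) (inp I P) = NumN (procs_m I)"
  "eval (sel 2) (inp I P) = NumN (ress_r I)"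
  "eval (sel 3) (inp I P) = NumN P"
  "eval (sel 4) (inp I P) = NumN (rt I P)"
  "eval (sel 5) (inp I P) = NumN (dl I P)"
  "eval (sel 6) (inp I P) = NumN (ptime I P)"
  "eval (sel 7) (inp I P) = Num (profit I P)"
  "eval (sel 8) (inp I P) = vlist (map (\<lambda>R. NumN R) (sorted_list_of_set (Acc I P)))"
  by (simp_all add: inp_def line_comm_def del: sel.simps)

declare sel.simps [simp del] tup.simps [simp del]

section \<open>Programs for single instances\<close>

definition addp :: "prog \<Rightarrow> prog \<Rightarrow> prog" where "addp = arithp Add"
definition mulp :: "prog \<Rightarrow> prog \<Rightarrow> prog" where "mulp = arithp Mul"

lemma eval_addp [simp]: "eval p x = Num a \<Longrightarrow> eval q x = Num b \<Longrightarrow> eval (addp p q) x = Num (a + b)"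
  by (simp add: addp_def)

lemma eval_mulp [simp]: "eval p x = Num a \<Longrightarrow> eval q x = Num b \<Longrightarrow> eval (mulp p q) x = Num (a * b)"
  by (simp add: mulp_def)

lemma loopfree_addp [simp]: "loopfree (addp p q) \<longleftrightarrow> loopfree p \<and> loopfree q"
  "loopfree (mulp p q) \<longleftrightarrow> loopfree p \<and> loopfree q"
  by (simp_all add: addp_def mulp_def)

definition boolp :: "prog \<Rightarrow> prog" where
  "boolp p = Cond p (Const (Num 1)) (Const (Num 0))"

lemma eval_boolp [simp]: "eval p x = vbool b \<Longrightarrow> eval (boolp p) x = Num (of_bool b)"
  by (simp add: boolp_def)

lemma loopfree_boolp [simp]: "loopfree (boolp p) = loopfree p"
  by (simp add: boolp_def)

definition endp :: "prog \<Rightarrow> prog" where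
  "endp p = addp (Seq p (sel 3)) (Seq p (sel 4))"

lemma eval_endp [simp]: "eval p x = einst I d \<Longrightarrow> eval (endp p) x = NumN (end_of I d)"
  by (simp add: endp_def end_of_def)

lemma loopfree_endp [simp]: "loopfree (endp p) = loopfree p"
  by (simp add: endp_def)

text \<open>The arguments of the next two programs are programs that return encoded instances.\<close>

definition hitsp :: "prog \<Rightarrow> prog \<Rightarrow> prog" where
  "hitsp p q = (let same = eqp (Seq p (sel 2)) (Seq q (sel 2)); mid = addp (Seq p (sel 3)) (endp p) in
     addp (addp (addp (boolp (eqp (Seq p (sel 1)) (Seq q (sel 1))))
       (boolp (andp same (andp (notp (lessp (Seq p (sel 3)) (Seq q (sel 3))))
          (lessp (Seq p (sel 3)) (endp q))))))
       (boolp (andp same (andp (notp (lessp mid (addp (Seq q (sel 3)) (Seq q (sel 3)))))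
          (lessp mid (addp (endp q) (endp q)))))))
       (boolp (andp same (andp (lessp (Seq q (sel 3)) (endp p)) (notp (lessp (endp q) (endp p)))))))"

lemma eval_hitsp [simp]:
  assumes "eval p x = einst I e" "eval q x = einst I d"
  shows "eval (hitsp p q) x = Num (hits I e d)"
proof -
  have *: "real a + real b < 2 * real c \<longleftrightarrow> a + b < c + c" for a b c :: nat
    by linarith
  \<comment> \<open>The program adds start and end, which is twice the midpoint, and compares with
    doubled end points, so nothing is halved.\<close>
  have "2 * start_of d \<le> 2 * start_of e + len_of I e \<longleftrightarrow> \<not> start_of e + end_of I e < start_of d + start_of d"
    "2 * start_of e + len_of I e < 2 * end_of I d \<longleftrightarrow> start_of e + end_of I e < end_of I d + end_of I d"
    by (auto simp: end_of_def)
  then have "hits I e d = of_bool (demand_of e = demand_of d) +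
     of_bool (resource_of e = resource_of d \<and> \<not> start_of e < start_of d \<and> start_of e < end_of I d) +
     of_bool (resource_of e = resource_of d \<and> \<not> start_of e + end_of I e < start_of d + start_of d
        \<and> start_of e + end_of I e < end_of I d + end_of I d) +
     of_bool (resource_of e = resource_of d \<and> start_of d < end_of I e \<and> \<not> end_of I d < end_of I e)"
    unfolding hits_def by (simp only: not_less)
  then show ?thesis using assms
    by (simp add: hitsp_def Let_def * del: of_bool_conj)
qed

lemma loopfree_hitsp [simp]: "loopfree (hitsp p q) \<longleftrightarrow> loopfree p \<and> loopfree q"
  by (auto simp: hitsp_def Let_def)

definition conflictp :: "prog \<Rightarrow> prog \<Rightarrow> prog" where
  "conflictp p q = andp (notp (eqp (Seq p (sel 0)) (Seq q (sel 0))))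
     (orp (eqp (Seq p (sel 1)) (Seq q (sel 1))) (andp (eqp (Seq p (sel 2)) (Seq q (sel 2)))
       (andp (lessp (Seq p (sel 3)) (endp q)) (lessp (Seq q (sel 3)) (endp p)))))"

lemma eval_conflictp [simp]:
  assumes "eval p x = einst I e" "eval q x = einst I d"
    and "wf_line I" "e \<in> instances I" "d \<in> instances I"
  shows "eval (conflictp p q) x = vbool (conflict I e d)"
proof -
  have *: "real a < real b + real c \<longleftrightarrow> a < b + c" for a b c :: nat by linarith
  show ?thesis using assms
    by (simp add: conflictp_def conflict_def vid_eq_iff *)
qed

lemma loopfree_conflictp [simp]: "loopfree (conflictp p q) \<longleftrightarrow> loopfree p \<and> loopfree q"
  by (auto simp: conflictp_def)

text \<open>\<open>M\<close> may output any value, and \<open>eqp\<close> would accept everything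
  that is not a number because both comparisons fail on it. Hence the preceding
  \<open>IsNum\<close>.\<close>

definition isonep :: "prog \<Rightarrow> prog" where
  "isonep p = andp (Seq p IsNum) (eqp p (Const (Num 1)))"

lemma eval_isonep: "eval (isonep p) x = vbool (eval p x = Num 1)"
  by (cases "eval p x") (simp_all add: isonep_def andp_def vbool_def)

lemma runs_isonep: "runs B p x v \<Longrightarrow> runs B (isonep p) x (vbool (v = Num 1))"
  using eval_isonep[of p x]
  by (cases v) (auto simp: runs_def isonep_def eqp_def notp_def andp_def orp_def lessp_def)


section \<open>Local programs\<close>

definition instp :: prog where
  "instp = Seq (Tuple (sel 8) Id) (bindp (Seq
     (Tuple (Seq (addp (Seq Second (sel 0)) (Const (Num 1))) rangep) Id)
     (bindp (let f = (\<lambda>k. Seq Second (Seq Second (sel k))); s = First; R = Seq Second First in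
        Cond (andp (notp (lessp s (f 4))) (notp (lessp (addp (f 5) (Const (Num 1))) (addp s (f 6)))))
          (tup [tup [addp (addp (mulp (f 3) (mulp (f 0) (f 2))) (mulp R (f 0))) (arithp Sub s (Const (Num 1))),
             f 3, R, s, f 6]])
          (Const Null)))))"

lemma length_own_le:
  assumes "wf_line I" "P < procs_m I"
  shows "length (own I P) \<le> num_vertices I"
proof -
  have "length (own I P) = card (set (own I P))" using distinct_own distinct_card by metis
  also have "\<dots> \<le> card (instances I)"
    using set_own[OF assms] finite_instances[OF assms(1)] by (intro card_mono) auto
  finally show ?thesis using card_instances_le[OF assms(1)] by simp
qed

lemma runs_instp:
  assumes wf: "wf_line I" and P: "P < procs_m I"
    and B: "Suc (slots_n I) \<le> B" "ress_r I \<le> B" "num_vertices I \<le> B"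
  shows "runs B instp (inp I P) (vlist (map (einst I) (own I P)))"
proof -
  let ?s = "filter (\<lambda>s. rt I P \<le> s \<and> s + ptime I P \<le> Suc (dl I P)) [0..<Suc (slots_n I)]"
  define body where "body = (let f = (\<lambda>k. Seq Second (Seq Second (sel k))); s = First; R = Seq Second First in
        Cond (andp (notp (lessp s (f 4))) (notp (lessp (addp (f 5) (Const (Num 1))) (addp s (f 6)))))
          (tup [tup [addp (addp (mulp (f 3) (mulp (f 0) (f 2))) (mulp R (f 0))) (arithp Sub s (Const (Num 1))),
             f 3, R, s, f 6]])
          (Const Null))"
  have lf: "loopfree body" by (simp add: body_def Let_def)
  have rt: "1 \<le> rt I P" using wf P by (simp add: wf_line_def)
  have ev: "eval body (Pair (NumN s) (Pair (NumN R) (inp I P))) =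
     (if rt I P \<le> s \<and> s + ptime I P \<le> Suc (dl I P) then vlist [einst I (P, R, s)] else Null)" for s R
  proof -
    have "real (dl I P) + 1 < real s + real (ptime I P) \<longleftrightarrow> \<not> s + ptime I P \<le> Suc (dl I P)" by linarith
    then show ?thesis using rt
      by (auto simp: body_def Let_def einst_def vid_def len_of_def of_nat_diff add_diff_eq)
  qed
  have inner: "runs B (bindp body) (Pair (vlist (map (\<lambda>s. NumN s) [0..<Suc (slots_n I)])) (Pair (NumN R) (inp I P)))
     (vlist (map (einst I) (map (\<lambda>s. (P, R, s)) ?s)))" for R
    by (rule runs_bindp_filter) (use runs_loopfree[OF lf ev] B in auto)
  let ?b = "Seq (Tuple (Seq (addp (Seq Second (sel 0)) (Const (Num 1))) rangep) Id) (bindp body)"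
  have outer: "runs B ?b (Pair (NumN R) (inp I P)) (vlist (map (einst I) (map (\<lambda>s. (P, R, s)) ?s)))" for R
  proof (rule runs_Seq[OF runs_Tuple[OF runs_Seq] inner])
    show "runs B (addp (Seq Second (sel 0)) (Const (Num 1))) (Pair (NumN R) (inp I P)) (NumN (Suc (slots_n I)))"
      by (rule runs_loopfree) simp_all
    show "runs B rangep (NumN (Suc (slots_n I))) (vlist (map (\<lambda>s. NumN s) [0..<Suc (slots_n I)]))"
      using runs_rangep[OF B(1)] .
    show "runs B Id (Pair (NumN R) (inp I P)) (Pair (NumN R) (inp I P))" by (rule runs_loopfree) simp_all
  qed
  have "length (sorted_list_of_set (Acc I P)) = card (Acc I P)" by simp
  also have "\<dots> \<le> card {..<ress_r I}" using wf P by (intro card_mono) (auto simp: wf_line_def)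
  finally have len: "length (sorted_list_of_set (Acc I P)) \<le> B" using B by simp
  have "runs B (bindp ?b) (Pair (vlist (map (\<lambda>R. NumN R) (sorted_list_of_set (Acc I P)))) (inp I P))
     (vlist (map (einst I) (own I P)))"
    unfolding own_def by (rule runs_bindp[OF outer len])
      (use length_own_le[OF wf P] B(3) in \<open>simp add: own_def\<close>)
  then show ?thesis unfolding instp_def body_def[symmetric]
    by (intro runs_Seq[OF runs_Tuple]) (auto intro: runs_loopfree)
qed

lemma loops_le_macros [simp]:
  "loops_le B (letp p q) x \<longleftrightarrow> loops_le B p x \<and> loops_le B q (Pair (eval p x) x)"
  "loops_le B (addp p q) x \<longleftrightarrow> loops_le B p x \<and> loops_le B q x"
  "loops_le B (mulp p q) x \<longleftrightarrow> loops_le B p x \<and> loops_le B q x"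
  "loops_le B (arithp Sub p q) x \<longleftrightarrow> loops_le B p x \<and> loops_le B q x"
  "loops_le B (lessp p q) x \<longleftrightarrow> loops_le B p x \<and> loops_le B q x"
  "loops_le B (notp p) x \<longleftrightarrow> loops_le B p x"
  "loops_le B (andp p q) x \<longleftrightarrow> loops_le B p x \<and> (eval p x \<noteq> Null \<longrightarrow> loops_le B q x)"
  by (auto simp: letp_def addp_def mulp_def arithp_def lessp_def notp_def andp_def)

lemma loops_le_tup [simp]: "loops_le B (tup ps) x \<longleftrightarrow> (\<forall>p\<in>set ps. loops_le B p x)"
  by (induction ps) (auto simp: tup.simps)

declare loopfree_loops_le [simp]

section \<open>The distributed algorithm\<close>

text \<open>A state is \<open>[input, i, j, raised, cur, prev, fin]\<close>.\<close>

abbreviation (input) st :: "nat \<Rightarrow> prog" where "st k \<equiv> Seq Second (Seq First (sel k))"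
abbreviation (input) own_st :: "nat \<Rightarrow> prog" where "own_st k \<equiv> Seq First (sel k)"
text \<open>\<open>own_st k\<close> reads a field of the own state from
  \<open>Pair state inbox\<close>, \<open>st k\<close> does so below a locally bound value, and
  \<open>st' k\<close> reads a neighbour's field from an inbox entry, which pairs the sender with
  its state.\<close>

abbreviation (input) st' :: "nat \<Rightarrow> prog" where "st' k \<equiv> Seq First (Seq Second (sel k))"

text \<open>The inbox lacks the processor's own state; it is prepended in the format of a message,
  with \<open>Null\<close> in place of the sender.\<close>

definition everyonep :: prog where
  "everyonep = Tuple (Tuple (Const Null) First) Second"

definition allraisedp :: prog where
  "allraisedp = Seq (Tuple everyonep Id) (bindp (st' 3))"

text \<open>A neighbour at the same position shows its current data, one that is a move ahead its
  previous data. A finished neighbour has no unsatisfied instance left and contributes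
  nothing.\<close>

definition viewp :: prog where
  "viewp = Cond (st' 6) (Const Null)
     (Cond (andp (eqp (st' 1) (st 1)) (eqp (st' 2) (st 2))) (st' 4) (st' 5))"

definition alldatap :: prog where
  "alldatap = Seq (Tuple everyonep Id) (bindp viewp)"

definition readyp :: prog where
  "readyp = Seq (Tuple Second Id) (allp (orp (st' 6)
     (notp (orp (lessp (st' 1) (st 1)) (andp (notp (lessp (st 1) (st' 1))) (lessp (st' 2) (st 2)))))))"

text \<open>The slack is recomputed from scratch out of the raises known in the neighbourhood, each
  of which carries its amount.\<close>

definition slackp :: prog where
  "slackp = arithp Sub (Seq Second (Seq Second (sel 7)))
     (Seq (Tuple (Seq Second First) First)
        (sump (mulp (Seq First (sel 2)) (hitsp (Seq First (sel 0)) Second))))"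

definition keyp :: "nat \<Rightarrow> prog" where
  "keyp b = (let f = (\<lambda>k. Seq Second (Seq Second (Seq Second (sel k)))) in
     addp (mulp (Seq (Tuple (f 0) (Tuple (Const (Num 1)) (f 6))) (powcountp 2)) (Const (NumN (Suc b))))
       (Seq (Tuple (Const (NumN b)) (Tuple First (f 7))) (powcountp (9/8))))"

definition unsatp :: "real \<Rightarrow> nat \<Rightarrow> prog" where
  "unsatp \<theta> b = letp allraisedp (Seq
     (Tuple (Seq Second (Seq First (Seq (sel 0) instp))) (Tuple First (Seq Second (Seq First (sel 0)))))
     (bindp (letp slackp
        (Cond (lessp (mulp (Const (Num \<theta>)) (Seq Second (Seq Second (Seq Second (sel 7))))) First)
           (tup [tup [Seq Second First, First, keyp b]]) (Const Null)))))"

definition minimalp :: prog where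
  "minimalp = notp (andp (conflictp (Seq First (sel 0)) (Seq Second (sel 0)))
     (lessp (Seq First (sel 2)) (Seq Second (sel 2))))"

definition numvp :: prog where
  "numvp = mulp (mulp (sel 0) (sel 1)) (sel 2)"

text \<open>Each active instance becomes a vertex of the graph for \<open>M\<close>, run by its
  owner. The pair of number of vertices and identifier is the input of that vertex.\<close>

definition activep :: prog where
  "activep = letp alldatap (Seq
     (Tuple (st 4) (Tuple First (Seq Second (Seq First (sel 0)))))
     (bindp (Cond (Seq (Tuple (Seq Second First) First) (allp minimalp))
        (tup [tup [Seq First (sel 0), Seq First (sel 1),
           Tuple (Seq Second (Seq Second numvp)) (Seq First (Seq (sel 0) (sel 0)))]])
        (Const Null))))"

definition entryp :: "algorithm \<Rightarrow> prog" where
  "entryp M = Cond (andp (eqp (Seq First (Seq (sel 0) (sel 0))) (Seq Second First))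
        (conflictp (Seq First (sel 0)) (Seq Second (Seq Second (sel 0)))))
     (tup [Tuple (Seq Second First) (Seq First (Seq (sel 2) (send M)))]) (Const Null)"

text \<open>\<open>M\<close> expects messages in increasing order of senders. Looping over all
  identifiers and searching the neighbourhood data for each produces this order without
  sorting.\<close>

definition inboxp :: "algorithm \<Rightarrow> prog" where
  "inboxp M = Seq (Tuple (Seq Second (Seq Second (Seq numvp rangep))) (Tuple (Seq Second First) First))
     (bindp (Seq (Tuple (Seq Second First) (Tuple First (Seq Second Second))) (bindp (entryp M))))"

definition roundp :: "algorithm \<Rightarrow> prog" where
  "roundp M = letp alldatap (Seq
     (Tuple (st 4) (Tuple First (Seq Second (Seq First (sel 0)))))
     (bindp (let mst = Seq First (sel 2) in
        tup [tup [Seq First (sel 0), Seq First (sel 1),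
          Cond (Seq mst (out M)) mst (Seq (Tuple mst (inboxp M)) (step M))]])))"

definition stoppedp :: "algorithm \<Rightarrow> prog" where
  "stoppedp M = Seq (Tuple (own_st 4) Id) (allp (notp (notp (Seq First (Seq (sel 2) (out M))))))"

definition startp :: "real \<Rightarrow> nat \<Rightarrow> prog" where
  "startp \<theta> b = letp (unsatp \<theta> b) (Cond First
     (tup [st 0, st 1, Const (Num 1), st 3, First, st 4, Const Null])
     (tup [st 0, st 1, Const (Num 0), st 3, Const Null, Const Null, Tuple (st 3) (Const Null)]))"

definition activatep :: prog where
  "activatep = tup [own_st 0, own_st 1, Const (Num 2), own_st 3, activep, own_st 4, Const Null]"

definition advancep :: "algorithm \<Rightarrow> prog" where
  "advancep M = tup [own_st 0, own_st 1, addp (own_st 2) (Const (Num 1)), own_st 3, roundp M, own_st 4, Const Null]"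

definition newraisedp :: "algorithm \<Rightarrow> prog" where
  "newraisedp M = Seq (Tuple (own_st 4) (own_st 1))
     (bindp (Cond (isonep (Seq First (Seq (sel 2) (out M))))
        (tup [tup [Seq First (sel 0), Second, mulp (Seq First (sel 1)) (Const (Num (1/4)))]])
        (Const Null)))"

definition nextp :: "algorithm \<Rightarrow> prog" where
  "nextp M = tup [own_st 0, addp (own_st 1) (Const (Num 1)), Const (Num 0),
     Seq (Tuple (newraisedp M) (own_st 3)) appendp, Const Null, own_st 4, Const Null]"

definition decidablep :: prog where
  "decidablep = (let fin = st' 6 in
     andp fin (orp (Seq fin Second) (orp (notp (Seq fin First))
       (notp (lessp (Seq Second (Seq First (sel 1))) (Seq fin (Seq First (Seq First (sel 1)))))))))"

definition unblockedp :: prog where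
  "unblockedp = (let ch = Seq (st' 6) Second in
     notp (andp ch (conflictp ch (Seq Second (Seq First (sel 0))))))"

definition decidep :: prog where
  "decidep = letp (Seq First (Seq (sel 6) (Seq First First))) (
     let state = (\<lambda>p. tup [st 0, st 1, st 2, st 3, st 4, st 5, Tuple (Seq (st 6) (Seq First Second)) p]);
         box = Tuple (Seq Second Second) Id in
     Cond (Seq box (allp decidablep))
       (Cond (Seq box (allp unblockedp)) (state (Seq First (sel 0))) (state (Const Null)))
       (Seq Second First))"

definition mainp :: "algorithm \<Rightarrow> real \<Rightarrow> nat \<Rightarrow> prog" where
  "mainp M \<theta> b = Cond (own_st 6) decidep (Cond readyp
     (Cond (eqp (own_st 2) (Const (Num 0))) (startp \<theta> b)
       (Cond (eqp (own_st 2) (Const (Num 1))) activatep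
         (Cond (stoppedp M) (nextp M) (advancep M))))
     First)"

text \<open>In the first round the state is still the raw input, whose first component is a number,
  whereas a proper state begins with the whole input list. This round only sets up the
  state.\<close>

definition stepp :: "algorithm \<Rightarrow> real \<Rightarrow> nat \<Rightarrow> prog" where
  "stepp M \<theta> b = Cond (Seq First (Seq First IsNum))
     (tup [First, Const (Num 0), Const (Num 0), Const Null, Const Null, Const Null, Const Null])
     (mainp M \<theta> b)"

text \<open>With fewer than two possible vertices \<open>M\<close> may take 0 rounds, so the answer
  must be given on the raw input. At most one instance exists then.\<close>

definition outp :: prog where
  "outp = Cond (Seq First IsNum)
     (Cond (lessp numvp (Const (Num 2)))
        (Seq instp (Cond Id (Seq First (Tuple (sel 2) (sel 3))) (Const (Num 0)))) (Const Null))
     (Cond (sel 6) (Cond (Seq (sel 6) Second) (Seq (sel 6) (Seq Second (Tuple (sel 2) (sel 3))))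
        (Cond (Seq (sel 6) First) (Const Null) (Const (Num 0)))) (Const Null))"

definition line_algorithm :: "algorithm \<Rightarrow> real \<Rightarrow> nat \<Rightarrow> algorithm" where
  "line_algorithm M \<theta> b = \<lparr>send = Id, step = stepp M \<theta> b, out = outp\<rparr>"


section \<open>Local views\<close>

lemma halted_stays:
  assumes "halted A (state A G t v)" "t \<le> t'"
  shows "state A G t' v = state A G t v"
  using assms(2)
proof (induction t' rule: dec_induct)
  case (step n)
  then show ?case using assms(1) by simp
qed simp

locale line_run =
  fixes I :: line_network and M :: algorithm and TM :: "nat \<Rightarrow> nat" and \<theta> :: real and b :: nat
  assumes wf: "wf_line I"
    and M: "mis_algorithm M TM"
    and \<theta>: "0 < \<theta>" "\<theta> < 1" "1 \<le> \<theta> * (9/8) ^ Suc b"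
begin

text \<open>The graph lives on all \<open>num_vertices I\<close> identifiers, the vertex set on
  which \<open>M\<close> is run. Identifiers without an instance in \<open>A\<close> are isolated,
  so they exchange no message with the simulated vertices.\<close>

definition vadj :: "dinst set \<Rightarrow> nat \<Rightarrow> nat \<Rightarrow> bool" where
  "vadj A u v \<longleftrightarrow> (\<exists>d\<in>A. \<exists>e\<in>A. vid I d = u \<and> vid I e = v \<and> conflict I d e)"

abbreviation "G A \<equiv> mis_network (num_vertices I) (vadj A)"
abbreviation "rounds \<equiv> TM (num_vertices I)"

definition mst :: "dinst set \<Rightarrow> nat \<Rightarrow> dinst \<Rightarrow> val" where
  "mst A k d = state M (G A) k (vid I d)"

definition misA :: "dinst set \<Rightarrow> dinst set" where
  "misA A = {d \<in> A. eval (out M) (mst A rounds d) = Num 1}"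

lemma vadj_iff:
  "A \<subseteq> instances I \<Longrightarrow> d \<in> A \<Longrightarrow> e \<in> A \<Longrightarrow> vadj A (vid I d) (vid I e) \<longleftrightarrow> conflict I d e"
  unfolding vadj_def using vid_eq_iff[OF wf] by (metis subsetD)

lemma simple_vadj: "A \<subseteq> instances I \<Longrightarrow> simple_graph {..<num_vertices I} (vadj A)"
  unfolding simple_graph_def vadj_def using vid_eq_iff[OF wf] conflict_sym conflict_irrefl
  by (metis subsetD)

lemma mst_halted:
  assumes "A \<subseteq> instances I" "d \<in> A"
  shows "halted M (mst A rounds d)"
  using M simple_vadj[OF assms(1)] vid_less[OF wf, of d] assms
  by (auto simp: mis_algorithm_def finished_def mst_def mis_network_def)

lemma misA:
  assumes A: "A \<subseteq> instances I"
  shows "maximal_independent_set {..<num_vertices I} (vadj A)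
    {v. v < num_vertices I \<and> node_output M (G A) rounds v = Num 1}"
  using M simple_vadj[OF A] by (auto simp: mis_algorithm_def)

text \<open>Isolated identifiers cannot block: if neither \<open>d\<close> nor an instance in
  conflict with it were chosen, \<open>vid I d\<close> could be added to the maximal set.\<close>

lemma mis_props:
  assumes A: "A \<subseteq> instances I"
  shows "d \<in> misA A \<Longrightarrow> e \<in> misA A \<Longrightarrow> \<not> conflict I d e"
    and "d \<in> A \<Longrightarrow> d \<in> misA A \<or> (\<exists>e\<in>misA A. conflict I e d)"
proof -
  let ?S = "{v. v < num_vertices I \<and> node_output M (G A) rounds v = Num 1}"
  have ind: "independent_set {..<num_vertices I} (vadj A) ?S"
    and mx: "\<And>S'. independent_set {..<num_vertices I} (vadj A) S' \<Longrightarrow> ?S \<subseteq> S' \<Longrightarrow> S' = ?S"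
    using misA[OF A] unfolding maximal_independent_set_def by blast+
  have mem: "d \<in> misA A \<longleftrightarrow> vid I d \<in> ?S" if "d \<in> A" for d
    using that A vid_less[OF wf, of d] by (auto simp: misA_def node_output_def mst_def)
  show "\<not> conflict I d e" if "d \<in> misA A" "e \<in> misA A"
  proof -
    have "d \<in> A" "e \<in> A" using that by (auto simp: misA_def)
    then show ?thesis using ind that mem vadj_iff[OF A, of d e] unfolding independent_set_def by blast
  qed
  show "d \<in> misA A \<or> (\<exists>e\<in>misA A. conflict I e d)" if d: "d \<in> A"
  proof (rule ccontr)
    assume n: "\<not> ?thesis"
    have no: "\<not> vadj A u (vid I d) \<and> \<not> vadj A (vid I d) u" if u: "u \<in> ?S" for u
    proof (rule ccontr)
      assume "\<not> ?thesis"
      then obtain e where e: "e \<in> A" "vid I e = u" "conflict I e d"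
        using d A vid_eq_iff[OF wf] conflict_sym unfolding vadj_def by (metis subsetD)
      then show False using n mem[OF e(1)] u by blast
    qed
    have "\<not> vadj A (vid I d) (vid I d)" using vadj_iff[OF A d d] by simp
    then have "independent_set {..<num_vertices I} (vadj A) (insert (vid I d) ?S)"
      using ind no vid_less[OF wf, of d] A d unfolding independent_set_def by auto
    then have "insert (vid I d) ?S = ?S" using mx by blast
    then have "vid I d \<in> ?S" by blast
    then show False using n mem[OF d] by blast
  qed
qed

sublocale schedule I misA \<theta> b
proof
  show "misA A \<subseteq> A" for A by (auto simp: misA_def)
qed (use wf \<theta> mis_props in auto)

definition quiet :: "nat \<Rightarrow> nat \<Rightarrow> nat \<Rightarrow> bool" where
  "quiet P i k \<longleftrightarrow> (\<forall>d\<in>set (own I P). d \<in> Act i \<longrightarrow> halted M (mst (Act i) k d))"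

text \<open>The state before round \<open>k\<close> of \<open>M\<close> is held at position
  \<open>k + 2\<close>. Halted vertices stay halted, so the first quiet moment is a safe one to
  leave.\<close>

definition stop :: "nat \<Rightarrow> nat \<Rightarrow> nat" where
  "stop P i = (LEAST k. quiet P i k) + 2"

lemma quiet_rounds: "quiet P i rounds"
  unfolding quiet_def by (auto intro: mst_halted[OF Act_inst])

lemma mst_frozen: "halted M (mst A k d) \<Longrightarrow> k \<le> k' \<Longrightarrow> mst A k' d = mst A k d"
  unfolding mst_def by (rule halted_stays)

lemma quiet_mono:
  assumes "quiet P i k" "k \<le> k'"
  shows "quiet P i k'"
  unfolding quiet_def
proof (intro ballI impI)
  fix d assume "d \<in> set (own I P)" "d \<in> Act i"
  then have "halted M (mst (Act i) k d)" using assms(1) by (simp add: quiet_def)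
  then show "halted M (mst (Act i) k' d)" using mst_frozen[OF _ assms(2)] by simp
qed

lemma stop_le_iff: "stop P i \<le> k + 2 \<longleftrightarrow> quiet P i k"
proof
  assume "stop P i \<le> k + 2"
  moreover have "quiet P i (LEAST k. quiet P i k)" using quiet_rounds by (rule LeastI)
  ultimately show "quiet P i k" unfolding stop_def by (auto elim: quiet_mono)
qed (simp add: stop_def Least_le)

sublocale sync I misA \<theta> b stop rounds
proof
  show "2 \<le> stop P i" for P i by (simp add: stop_def)
  show "stop P i \<le> rounds + 2" for P i using stop_le_iff quiet_rounds by blast
qed

section \<open>Encoding of configurations\<close>

definition content :: "nat \<Rightarrow> nat \<Rightarrow> nat \<Rightarrow> dinst list" where
  "content P i j = (if j = 0 then [] else
     filter (\<lambda>d. d \<in> (if j = 1 then U i else Act i)) (own I P))"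

definition eentry :: "nat \<Rightarrow> nat \<Rightarrow> dinst \<Rightarrow> val" where
  "eentry i j d = vlist [einst I d, Num (slack i d),
     (if j = 1 then NumN (K i d) else mst (Act i) (j - 2) d)]"

definition econtent :: "nat \<Rightarrow> nat \<Rightarrow> nat \<Rightarrow> val" where
  "econtent P i j = vlist (map (eentry i j) (content P i j))"

definition eraised :: "dinst \<times> nat \<Rightarrow> val" where
  "eraised a = vlist [einst I (fst a), NumN (snd a), Num (slack (snd a) (fst a) / 4)]"

text \<open>Before position 0 comes the last position of the preceding step, whose data slower
  neighbours may still need.\<close>

definition eprev :: "nat \<Rightarrow> nat \<Rightarrow> nat \<Rightarrow> val" where
  "eprev P i j = (if 0 < j then econtent P i (j - 1) else
     if 0 < i then econtent P (i - 1) (stop P (i - 1)) else Null)"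

definition echoice :: "dinst option \<Rightarrow> val" where
  "echoice c = (case c of None \<Rightarrow> Null | Some d \<Rightarrow> einst I d)"

definition econf :: "nat \<Rightarrow> pst \<Rightarrow> val" where
  "econf P x = (case x of
     At i j \<Rightarrow> vlist [inp I P, NumN i, NumN j, vlist (map eraised (raised P i)), econtent P i j, eprev P i j, Null]
   | Fin k r c \<Rightarrow> vlist [inp I P, NumN k, Num 0, vlist (map eraised (raised P k)), Null, Null,
       Pair (vlist (map eraised r)) (echoice c)])"

lemma eval_sel_At [simp]:
  "eval (sel 0) (econf P (At i j)) = inp I P"
  "eval (sel (Suc 0)) (econf P (At i j)) = NumN i"
  "eval (sel 2) (econf P (At i j)) = NumN j"
  "eval (sel 3) (econf P (At i j)) = vlist (map eraised (raised P i))"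
  "eval (sel 4) (econf P (At i j)) = econtent P i j"
  "eval (sel 5) (econf P (At i j)) = eprev P i j"
  "eval (sel 6) (econf P (At i j)) = Null"
  by (simp_all add: econf_def)

lemma eval_sel_Fin [simp]:
  "eval (sel 0) (econf P (Fin k r c)) = inp I P"
  "eval (sel (Suc 0)) (econf P (Fin k r c)) = NumN k"
  "eval (sel 2) (econf P (Fin k r c)) = Num 0"
  "eval (sel 3) (econf P (Fin k r c)) = vlist (map eraised (raised P k))"
  "eval (sel 4) (econf P (Fin k r c)) = Null"
  "eval (sel 5) (econf P (Fin k r c)) = Null"
  "eval (sel 6) (econf P (Fin k r c)) = Pair (vlist (map eraised r)) (echoice c)"
  by (simp_all add: econf_def)

lemma eval_sel_eentry [simp]:
  "eval (sel 0) (eentry i j d) = einst I d"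
  "eval (sel (Suc 0)) (eentry i j d) = Num (slack i d)"
  "eval (sel 2) (eentry i 1 d) = NumN (K i d)"
  "eval (sel 2) (eentry i (Suc 0) d) = NumN (K i d)"
  "eval (sel 2) (eentry i (Suc (Suc k)) d) = mst (Act i) k d"
  by (simp_all add: eentry_def)

lemma eval_sel_eraised [simp]:
  "eval (sel 0) (eraised a) = einst I (fst a)"
  "eval (sel (Suc 0)) (eraised a) = NumN (snd a)"
  "eval (sel 2) (eraised a) = Num (slack (snd a) (fst a) / 4)"
  by (simp_all add: eraised_def)

definition nbl :: "nat \<Rightarrow> nat list" where
  "nbl P = sorted_list_of_set {Q. nb I Q P}"

lemma set_nbl [simp]: "set (nbl P) = {Q. nb I Q P}"
  unfolding nbl_def by (rule set_sorted_list_of_set) (auto intro: finite_subset[of _ "{..<procs_m I}"] simp: nb_def)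

definition ebox :: "(nat \<Rightarrow> pst) \<Rightarrow> nat \<Rightarrow> val" where
  "ebox X P = vlist (map (\<lambda>Q. Pair (NumN Q) (econf Q (X Q))) (nbl P))"

definition around :: "nat \<Rightarrow> nat list" where
  "around P = P # nbl P"

lemma around:
  assumes "P < procs_m I"
  shows "set (around P) \<subseteq> {..<procs_m I}" "distinct (around P)" "length (around P) \<le> procs_m I"
    "length (nbl P) \<le> procs_m I"
proof -
  show 1: "set (around P) \<subseteq> {..<procs_m I}" using assms by (auto simp: around_def nb_def)
  show 2: "distinct (around P)" unfolding around_def by (auto simp: nb_def) (simp add: nbl_def)
  have "length (around P) = card (set (around P))" using 2 distinct_card by metis
  also have "\<dots> \<le> card {..<procs_m I}" using 1 by (intro card_mono) auto
  finally show "length (around P) \<le> procs_m I" by simp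
  then show "length (nbl P) \<le> procs_m I" by (simp add: around_def)
qed

lemma own_props: "Q < procs_m I \<Longrightarrow> d \<in> set (own I Q) \<Longrightarrow> d \<in> instances I \<and> demand_of d = Q"
  using set_own[OF wf] by blast

lemma own_around: "P < procs_m I \<Longrightarrow> Q \<in> set (around P) \<Longrightarrow> d \<in> set (own I Q) \<Longrightarrow> d \<in> instances I \<and> demand_of d = Q"
  using own_props[of Q d] around(1)[of P] by auto

text \<open>The instances of different processors are disjoint, so data collected from a whole
  neighbourhood still have at most \<open>num_vertices I\<close> entries.\<close>

lemma length_concat_around:
  assumes P: "P < procs_m I" and f: "\<And>Q. Q \<in> set (around P) \<Longrightarrow> length (f Q) \<le> length (own I Q)"
  shows "length (concat (map f (around P))) \<le> num_vertices I"
proof -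
  have "length (concat (map f (around P))) = (\<Sum>Q\<leftarrow>around P. length (f Q))"
    by (simp add: length_concat comp_def)
  also have "\<dots> \<le> (\<Sum>Q\<leftarrow>around P. length (own I Q))" using f by (rule sum_list_mono)
  also have "\<dots> = (\<Sum>Q\<in>set (around P). card (set (own I Q)))"
    using around(2)[OF P] by (simp add: sum_list_distinct_conv_sum_set distinct_card[OF distinct_own])
  also have "\<dots> = card (\<Union>Q\<in>set (around P). set (own I Q))"
  proof (rule card_UN_disjoint[symmetric])
    show "\<forall>i\<in>set (around P). \<forall>j\<in>set (around P). i \<noteq> j \<longrightarrow> set (own I i) \<inter> set (own I j) = {}"
    proof (intro ballI impI)
      fix i j assume ij: "i \<in> set (around P)" "j \<in> set (around P)" "i \<noteq> j"
      have "d \<notin> set (own I j)" if "d \<in> set (own I i)" for d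
        using own_around[OF P ij(1) that] own_around[OF P ij(2), of d] ij(3) by auto
      then show "set (own I i) \<inter> set (own I j) = {}" by blast
    qed
  qed auto
  also have "\<dots> \<le> card (instances I)"
    by (rule card_mono[OF finite_instances[OF wf]]) (use own_around[OF P] in blast)
  finally show ?thesis using card_instances_le[OF wf] by simp
qed

lemma set_content: "d \<in> set (content P i j) \<longleftrightarrow>
    0 < j \<and> d \<in> set (own I P) \<and> d \<in> (if j = 1 then U i else Act i)"
  by (auto simp: content_def)

lemma length_content_le: "length (content P i j) \<le> length (own I P)"
  by (simp add: content_def)

lemma length_raised_le:
  assumes "P < procs_m I"
  shows "length (raised P i) \<le> length (own I P)"
proof -
  have "sorted_wrt (\<lambda>a b. snd b < snd a) xs \<Longrightarrow> distinct xs" for xs :: "(dinst \<times> nat) list"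
    by (induction xs) auto
  then have d: "distinct (raised P i)" using raised_sorted[OF assms] by blast
  have mem: "demand_of (fst a) = P \<and> fst a \<in> Z (snd a)" if "a \<in> set (raised P i)" for a
    using that set_raised[OF assms, of "fst a" "snd a" i] by (metis prod.collapse)
  then have "fst a \<in> set (own I P)" if "a \<in> set (raised P i)" for a
    using that set_own[OF wf assms] Z_inst[of "snd a"] by blast
  moreover have "inj_on fst (set (raised P i))"
  proof (rule inj_onI)
    fix a a' assume a: "a \<in> set (raised P i)" "a' \<in> set (raised P i)" "fst a = fst a'"
    then have "fst a \<in> Z (snd a)" "fst a' \<in> Z (snd a')" using mem by blast+
    then have "snd a = snd a'" using Z_unique[of "fst a" "snd a" "snd a'"] a(3) by simp
    then show "a = a'" using a(3) by (simp add: prod_eq_iff)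
  qed
  ultimately have "card (set (raised P i)) \<le> card (set (own I P))"
    by (intro card_inj_on_le[of fst]) auto
  then show ?thesis using d by (simp add: distinct_card distinct_own)
qed


text \<open>One number that bounds every loop of the programs: list lengths, the counters of
  \<open>powcountp\<close> and, through the cost of \<open>M\<close> on all conflict graphs, the
  simulated calls.\<close>

definition big :: "nat \<Rightarrow> bool" where
  "big B \<longleftrightarrow> Suc (slots_n I) \<le> B \<and> ress_r I \<le> B \<and> num_vertices I \<le> B \<and> procs_m I \<le> B \<and> b \<le> B \<and>
     (\<forall>A. A \<subseteq> instances I \<longrightarrow> local_cost_le M (G A) B)"

lemma runs_M:
  assumes "big B" "A \<subseteq> instances I" "d \<in> A"
  shows "runs B (send M) (mst A k d) (eval (send M) (mst A k d))"
    "runs B (out M) (mst A k d) (eval (out M) (mst A k d))"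
    "\<not> halted M (mst A k d) \<Longrightarrow>
      runs B (step M) (Pair (mst A k d) (inbox M (G A) (state M (G A) k) (vid I d))) (mst A (Suc k) d)"
proof -
  have v: "vid I d < num_vertices I" using vid_less[OF wf] assms by blast
  have "local_cost_le M (G A) B" using assms by (simp add: big_def)
  moreover have "vid I d \<in> nodes (G A)" using v by (simp add: mis_network_def)
  ultimately have c: "cost (send M) (mst A k d) \<le> B \<and> cost (out M) (mst A k d) \<le> B \<and>
     (\<not> halted M (mst A k d) \<longrightarrow>
       cost (step M) (Pair (mst A k d) (inbox M (G A) (state M (G A) k) (vid I d))) \<le> B)"
    unfolding local_cost_le_def Let_def mst_def by blast
  then show "runs B (send M) (mst A k d) (eval (send M) (mst A k d))"
    "runs B (out M) (mst A k d) (eval (out M) (mst A k d))"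
    by (simp_all add: runs_def loops_le_cost)
  show "\<not> halted M (mst A k d) \<Longrightarrow>
      runs B (step M) (Pair (mst A k d) (inbox M (G A) (state M (G A) k) (vid I d))) (mst A (Suc k) d)"
    using c by (simp add: runs_def loops_le_cost mst_def)
qed

section \<open>Correctness of the programs on encoded configurations\<close>

lemma runs_readyp:
  assumes B: "big B" and P: "P < procs_m I" "X P = At i j"
  shows "runs B readyp (Pair (econf P (X P)) (ebox X P)) (vbool (\<not> waits X P i j))"
proof -
  define body where "body = orp (st' 6)
     (notp (orp (lessp (st' 1) (st 1)) (andp (notp (lessp (st 1) (st' 1))) (lessp (st' 2) (st 2)))))"
  have lf: "loopfree body" by (simp add: body_def)
  define ok where "ok Q \<longleftrightarrow> (\<forall>i' j'. X Q = At i' j' \<longrightarrow> \<not> before i' j' i j)" for Q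
  have ev: "eval body (Pair (Pair (NumN Q) (econf Q (X Q))) (Pair (econf P (X P)) (ebox X P))) = vbool (ok Q)" for Q
    unfolding P(2) by (cases "X Q") (auto simp: body_def ok_def before_def)
  have "runs B (allp body) (Pair (vlist (map (\<lambda>Q. Pair (NumN Q) (econf Q (X Q))) (nbl P)))
      (Pair (econf P (X P)) (ebox X P))) (vbool (\<forall>Q\<in>set (nbl P). ok Q))"
    by (rule runs_allp) (use runs_loopfree[OF lf ev] around(4)[OF P(1)] B in \<open>auto simp: big_def\<close>)
  moreover have "(\<forall>Q\<in>set (nbl P). ok Q) \<longleftrightarrow> \<not> waits X P i j"
    unfolding ok_def waits_def by auto
  ultimately show ?thesis
    unfolding readyp_def body_def[symmetric] by (simp add: runs_def ebox_def)
qed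

definition eother :: "(nat \<Rightarrow> pst) \<Rightarrow> nat \<Rightarrow> nat \<Rightarrow> val" where
  "eother X P Q = Pair (if Q = P then Null else NumN Q) (econf Q (X Q))"

lemma eval_everyonep: "eval everyonep (Pair (econf P (X P)) (ebox X P)) = vlist (map (eother X P) (around P))"
proof -
  have "map (\<lambda>Q. Pair (NumN Q) (econf Q (X Q))) (nbl P) = map (eother X P) (nbl P)"
    by (auto simp: eother_def nb_def)
  then have "ebox X P = vlist (map (eother X P) (nbl P))" unfolding ebox_def by (rule arg_cong)
  then show ?thesis by (simp add: everyonep_def around_def vlist_simps) (simp add: eother_def)
qed

text \<open>A finished processor stops updating its list at step \<open>k\<close>; the list stays
  valid because none of its instances is raised from then on.\<close>

lemma raised_const:
  assumes "P < procs_m I" "\<forall>d\<in>set (own I P). d \<notin> U k" "k \<le> i"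
  shows "raised P i = raised P k"
  using assms(3)
proof (induction i rule: dec_induct)
  case (step n)
  have "filter (\<lambda>d. d \<in> Z n) (own I P) = []"
    using assms(2) Z_U[of n] U_antimono[OF step(1)] by (auto simp: filter_empty_conv)
  then show ?case using step by simp
qed simp

definition around_raised :: "nat \<Rightarrow> nat \<Rightarrow> (dinst \<times> nat) list" where
  "around_raised P i = concat (map (\<lambda>Q. raised Q i) (around P))"

definition around_content :: "nat \<Rightarrow> nat \<Rightarrow> nat \<Rightarrow> dinst list" where
  "around_content P i j = concat (map (\<lambda>Q. content Q i j) (around P))"

lemma length_around_raised: "P < procs_m I \<Longrightarrow> length (around_raised P i) \<le> num_vertices I"
  unfolding around_raised_def
  by (rule length_concat_around) (use around(1) length_raised_le in auto)

lemma length_around_content: "P < procs_m I \<Longrightarrow> length (around_content P i j) \<le> num_vertices I"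
  unfolding around_content_def
  by (rule length_concat_around) (auto intro: length_content_le)

text \<open>A running neighbour that is not behind the start of step \<open>i\<close> is at most one
  move ahead, hence still in step \<open>i\<close>, during which its list of raised instances does
  not change.\<close>

lemma raised_view:
  assumes "inv1 X" "P < procs_m I" "X P = At i 0" "\<not> waits X P i 0" "Q \<in> set (around P)"
  shows "eval (sel 3) (econf Q (X Q)) = vlist (map eraised (raised Q i))"
proof (cases "Q = P")
  case False
  then have nb: "nb I P Q" using assms(5) nb_sym by (auto simp: around_def)
  then have Q: "Q < procs_m I" by (simp add: nb_def)
  note inv = inv1_nb[OF assms(1) nb assms(3)]
  show ?thesis
  proof (cases "X Q")
    case (At i' j')
    have "\<not> before i' j' i 0" using assms(4) At nb nb_sym unfolding waits_def by blast
    then have "i' = i"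
      using inv(1)[of i' "j' - 1"] inv(2)[of "i' - 1"] At stop(1)[of Q "i' - 1"]
      by (cases j'; cases i') (auto simp: before_def)
    then show ?thesis using At by simp
  next
    case (Fin k r c)
    have "raised Q i = raised Q k"
      using inv(3)[OF Fin] inv1_Fin[OF assms(1) Q Fin] by (intro raised_const[OF Q]) auto
    then show ?thesis using Fin by simp
  qed
qed (use assms in simp)

lemma runs_allraisedp:
  assumes "big B" "inv1 X" "P < procs_m I" "X P = At i 0" "\<not> waits X P i 0"
  shows "runs B allraisedp (Pair (econf P (X P)) (ebox X P)) (vlist (map eraised (around_raised P i)))"
proof -
  let ?e = "Pair (econf P (X P)) (ebox X P)"
  have "runs B (bindp (st' 3)) (Pair (vlist (map (eother X P) (around P))) ?e)
    (vlist (map eraised (around_raised P i)))"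
    unfolding around_raised_def
  proof (rule runs_bindp)
    show "runs B (st' 3) (Pair (eother X P Q) ?e) (vlist (map eraised (raised Q i)))"
      if "Q \<in> set (around P)" for Q
      using raised_view[OF assms(2-5) that] by (intro runs_loopfree) (simp_all add: eother_def)
  qed (use assms(1) length_around_raised[OF assms(3), of i] around(3)[OF assms(3)]
      in \<open>auto simp: big_def around_raised_def\<close>)
  then show ?thesis unfolding allraisedp_def
    by (simp add: runs_def eval_everyonep) (simp add: everyonep_def)
qed

text \<open>From the stopping position on, all simulated vertices of \<open>P\<close> have halted
  and keep sending the same message. Neighbours still in step \<open>i\<close> can go on using its
  last data.\<close>

lemma econtent_frozen:
  assumes "stop P i \<le> j"
  shows "econtent P i j = econtent P i (stop P i)"
proof -
  have 2: "2 \<le> stop P i" by (rule stop)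
  have "content P i j = content P i (stop P i)" using 2 assms by (simp add: content_def)
  moreover have "eentry i j d = eentry i (stop P i) d" if "d \<in> set (content P i (stop P i))" for d
  proof -
    have "quiet P i (stop P i - 2)" by (subst stop_le_iff[symmetric]) (use 2 in simp)
    moreover have "d \<in> set (own I P)" "d \<in> Act i" using that 2 by (auto simp: set_content)
    ultimately have "halted M (mst (Act i) (stop P i - 2) d)" by (simp add: quiet_def)
    then have "mst (Act i) (j - 2) d = mst (Act i) (stop P i - 2) d"
      by (rule mst_frozen) (use assms in simp)
    then show ?thesis using 2 assms by (simp add: eentry_def)
  qed
  ultimately show ?thesis by (simp add: econtent_def cong: map_cong)
qed

lemma content_view:
  assumes "inv1 X" "P < procs_m I" "X P = At i j" "0 < j" "\<not> waits X P i j" "Q \<in> set (around P)"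
  shows "eval viewp (Pair (eother X P Q) (Pair (econf P (X P)) v)) = econtent Q i j"
proof (cases "Q = P")
  case True
  then show ?thesis using assms(3) by (simp add: viewp_def eother_def)
next
  case False
  then have nb: "nb I P Q" using assms(6) nb_sym by (auto simp: around_def)
  then have Q: "Q < procs_m I" by (simp add: nb_def)
  note inv = inv1_nb[OF assms(1) nb assms(3)]
  show ?thesis
  proof (cases "X Q")
    case (At i' j')
    have nbef: "\<not> before i' j' i j" using assms(5) At nb nb_sym unfolding waits_def by blast
    have "eprev Q i' j' = econtent Q i j" if "\<not> (i' = i \<and> j' = j)"
    proof (cases j')
      case (Suc j'')
      then have "i' = i \<and> j'' = j" using inv(1)[of i' j''] At nbef that by (auto simp: before_def)
      then show ?thesis using Suc by (simp add: eprev_def)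
    next
      case 0
      then obtain i'' where i'': "i' = Suc i''" using nbef assms(4) by (cases i') (auto simp: before_def)
      have n0: "\<not> before i j i'' (stop Q i'')" using inv(2)[of i''] At 0 i'' by simp
      then have "i'' \<le> i" by (auto simp: before_def)
      moreover have "i \<le> i''" using nbef 0 i'' assms(4) by (auto simp: before_def)
      ultimately have e: "i'' = i" by simp
      then have "stop Q i \<le> j" using n0 by (auto simp: before_def)
      then show ?thesis using 0 i'' e econtent_frozen[of Q i j] by (simp add: eprev_def)
    qed
    then show ?thesis using At assms(3) by (auto simp: viewp_def eother_def)
  next
    case (Fin k r c)
    have "k \<le> i" "\<forall>d\<in>set (own I Q). d \<notin> U k" using inv(3)[OF Fin] inv1_Fin[OF assms(1) Q Fin] by auto
    then have "content Q i j = []"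
      using U_antimono[of k i] Act_U[of i] by (auto simp: content_def filter_empty_conv)
    then show ?thesis using Fin by (simp add: viewp_def eother_def econtent_def vlist_simps)
  qed
qed

lemma runs_alldatap:
  assumes "big B" "inv1 X" "P < procs_m I" "X P = At i j" "0 < j" "\<not> waits X P i j"
  shows "runs B alldatap (Pair (econf P (X P)) (ebox X P)) (vlist (map (eentry i j) (around_content P i j)))"
proof -
  let ?e = "Pair (econf P (X P)) (ebox X P)"
  have lf: "loopfree viewp" by (simp add: viewp_def)
  have "runs B (bindp viewp) (Pair (vlist (map (eother X P) (around P))) ?e)
    (vlist (map (eentry i j) (around_content P i j)))"
    unfolding around_content_def
  proof (rule runs_bindp)
    show "runs B viewp (Pair (eother X P Q) ?e) (vlist (map (eentry i j) (content Q i j)))"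
      if "Q \<in> set (around P)" for Q
      using content_view[OF assms(2-6) that] by (intro runs_loopfree[OF lf]) (simp add: econtent_def)
  qed (use assms(1) length_around_content[OF assms(3), of i j] around(3)[OF assms(3)]
      in \<open>auto simp: big_def around_content_def\<close>)
  then show ?thesis unfolding alldatap_def
    by (simp add: runs_def eval_everyonep) (simp add: everyonep_def)
qed

text \<open>Raises outside the neighbourhood miss \<open>d\<close>, since processors without a
  common resource have no conflicting instances. The local sum thus equals the global loss of
  slack.\<close>

lemma sum_list_around_raised:
  assumes P: "P < procs_m I" and d: "d \<in> set (own I P)"
  shows "(\<Sum>a\<leftarrow>around_raised P i. slack (snd a) (fst a) / 4 * hits I (fst a) d) =
    (\<Sum>k<i. \<Sum>e\<in>Z k. slack k e / 4 * hits I e d)"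
proof -
  let ?f = "\<lambda>e k. slack k e / 4 * hits I e d"
  have d': "d \<in> instances I" "demand_of d = P" using own_props[OF P d] by auto
  have one: "(\<Sum>a\<leftarrow>raised Q i. ?f (fst a) (snd a)) = (\<Sum>k<i. \<Sum>e\<in>{e \<in> Z k. demand_of e = Q}. ?f e k)"
    if Q: "Q < procs_m I" for Q
  proof (induction i)
    case (Suc i)
    have "(\<Sum>e\<leftarrow>filter (\<lambda>d. d \<in> Z i) (own I Q). ?f e i) = (\<Sum>e\<in>{e \<in> Z i. demand_of e = Q}. ?f e i)"
      using distinct_own set_own[OF wf Q] Z_inst[of i]
      by (subst sum_list_distinct_conv_sum_set) (auto intro!: sum.cong)
    then show ?case using Suc by (simp add: comp_def)
  qed simp
  have "(\<Sum>a\<leftarrow>around_raised P i. ?f (fst a) (snd a)) = (\<Sum>Q\<leftarrow>around P. \<Sum>a\<leftarrow>raised Q i. ?f (fst a) (snd a))"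
  proof -
    have "(\<Sum>a\<leftarrow>concat (map (\<lambda>Q. raised Q i) xs). ?f (fst a) (snd a)) = (\<Sum>Q\<leftarrow>xs. \<Sum>a\<leftarrow>raised Q i. ?f (fst a) (snd a))" for xs
      by (induction xs) simp_all
    then show ?thesis unfolding around_raised_def by blast
  qed
  also have "\<dots> = (\<Sum>Q\<in>set (around P). \<Sum>a\<leftarrow>raised Q i. ?f (fst a) (snd a))"
    using around(2)[OF P] by (simp add: sum_list_distinct_conv_sum_set)
  also have "\<dots> = (\<Sum>Q\<in>set (around P). \<Sum>k<i. \<Sum>e\<in>{e \<in> Z k. demand_of e = Q}. ?f e k)"
    using around(1)[OF P] one by (intro sum.cong) auto
  also have "\<dots> = (\<Sum>k<i. \<Sum>Q\<in>set (around P). \<Sum>e\<in>{e \<in> Z k. demand_of e = Q}. ?f e k)"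
    by (rule sum.swap)
  also have "\<dots> = (\<Sum>k<i. \<Sum>e\<in>{e \<in> Z k. demand_of e \<in> set (around P)}. ?f e k)"
  proof (intro sum.cong refl)
    fix k
    have "{e \<in> Z k. demand_of e \<in> set (around P)} = (\<Union>Q\<in>set (around P). {e \<in> Z k. demand_of e = Q})"
      by auto
    then show "(\<Sum>Q\<in>set (around P). \<Sum>e\<in>{e \<in> Z k. demand_of e = Q}. ?f e k) =
        (\<Sum>e\<in>{e \<in> Z k. demand_of e \<in> set (around P)}. ?f e k)"
      by (simp only:) (subst sum.UNION_disjoint, auto simp: finite_Z)
  qed
  also have "\<dots> = (\<Sum>k<i. \<Sum>e\<in>Z k. ?f e k)"
  proof (intro sum.cong[OF refl] sum.mono_neutral_left[OF finite_Z])
    show "{e \<in> Z k. demand_of e \<in> set (around P)} \<subseteq> Z k" for k by auto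
    show "\<forall>e\<in>Z k - {e \<in> Z k. demand_of e \<in> set (around P)}. ?f e k = 0" for k
    proof
    fix e assume e: "e \<in> Z k - {e \<in> Z k. demand_of e \<in> set (around P)}"
    then have inst: "e \<in> instances I" and n: "demand_of e \<noteq> P" "\<not> nb I (demand_of e) P"
      using Z_inst[of k] by (auto simp: around_def)
    then have "e \<noteq> d" "\<not> conflict I e d" using conflict_nb[OF inst d'(1)] d'(2) by auto
    then show "?f e k = 0" using hits_zero[OF len_of_pos[OF wf inst]] by simp
    qed
  qed
  finally show ?thesis .
qed

lemma runs_slackp:
  assumes B: "big B" and P: "P < procs_m I" and d: "d \<in> set (own I P)"
  shows "runs B slackp (Pair (einst I d) (Pair (vlist (map eraised (around_raised P i))) (inp I P)))
    (Num (slack i d))"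
proof -
  define body where "body = mulp (Seq First (sel 2)) (hitsp (Seq First (sel 0)) Second)"
  have lf: "loopfree body" by (simp add: body_def)
  have ev: "eval body (Pair (eraised a) (einst I d)) = Num (slack (snd a) (fst a) / 4 * hits I (fst a) d)" for a
    unfolding body_def by (rule eval_mulp) (simp, rule eval_hitsp, simp_all)
  have "runs B (sump body) (Pair (vlist (map eraised (around_raised P i))) (einst I d))
     (Num (\<Sum>a\<leftarrow>around_raised P i. slack (snd a) (fst a) / 4 * hits I (fst a) d))"
    by (rule runs_sump) (use B length_around_raised[OF P, of i] runs_loopfree[OF lf ev] in
        \<open>auto simp: big_def\<close>)
  moreover have "profit I P = pft I d" using own_props[OF P d] by (simp add: pft_def)
  ultimately show ?thesis
    unfolding slackp_def body_def[symmetric] sum_list_around_raised[OF P d]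
    by (simp add: runs_def slack_sum[of i d])
qed

lemma runs_keyp:
  assumes B: "big B" and P: "P < procs_m I" and d: "d \<in> set (own I P)"
  shows "runs B (keyp b) (Pair (Num (slack i d)) (Pair v (Pair w (inp I P)))) (NumN (K i d))"
proof -
  have 1: "runs B (powcountp 2) (Pair (NumN (slots_n I)) (Pair (Num 1) (NumN (ptime I P))))
     (NumN (len_class (slots_n I) (len_of I d)))"
    using runs_powcountp[of "slots_n I" B 2 1 "real (ptime I P)"] B own_props[OF P d]
    by (simp add: big_def len_class_def len_of_def)
  have 2: "runs B (powcountp (9/8)) (Pair (NumN b) (Pair (Num (slack i d)) (Num (profit I P))))
     (NumN (level (slack i d) (pft I d)))"
    using runs_powcountp[of b B "9/8" "slack i d" "profit I P"] B own_props[OF P d]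
    by (simp add: big_def level_def pft_def)
  show ?thesis using 1 2
    by (simp add: runs_def keyp_def Let_def key_def distrib_left)
qed

lemma runs_unsatp:
  assumes "big B" "inv1 X" "P < procs_m I" "X P = At i 0" "\<not> waits X P i 0"
  shows "runs B (unsatp \<theta> b) (Pair (econf P (X P)) (ebox X P)) (econtent P i (Suc 0))"
proof -
  note B = assms(1) and P = assms(3)
  let ?AR = "vlist (map eraised (around_raised P i))"
  let ?body = "letp slackp
        (Cond (lessp (mulp (Const (Num \<theta>)) (Seq Second (Seq Second (Seq Second (sel 7))))) First)
           (tup [tup [Seq Second First, First, keyp b]]) (Const Null))"
  have body: "runs B ?body (Pair (einst I d) (Pair ?AR (inp I P)))
     (if d \<in> U i then vlist [eentry i (Suc 0) d] else Null)" if d: "d \<in> set (own I P)" for d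
    using runs_slackp[OF B P d, of i] runs_keyp[OF B P d, of i "einst I d" ?AR] own_props[OF P d]
    by (simp add: runs_def unsat_def pft_def eentry_def)
  have "length (own I P) \<le> B" using length_own_le[OF wf P] B by (simp add: big_def)
  from runs_bindp_filter[where g = "\<lambda>d. d" and ey = "eentry i (Suc 0)", OF body this]
  have 1: "runs B (bindp ?body) (Pair (vlist (map (einst I) (own I P))) (Pair ?AR (inp I P)))
      (econtent P i (Suc 0))" by (simp add: econtent_def content_def)
  have 2: "runs B instp (inp I P) (vlist (map (einst I) (own I P)))"
    using runs_instp[OF wf P] B by (simp add: big_def)
  show ?thesis
    using 1 2 runs_allraisedp[OF assms] assms(4) unfolding unsatp_def
    by (simp add: runs_def)
qed

lemma mem_around_content:
  assumes P: "P < procs_m I" and e: "e \<in> set (around_content P i j)"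
  shows "e \<in> instances I" "0 < j" "e \<in> (if j = 1 then U i else Act i)"
proof -
  obtain Q where Q: "Q \<in> set (around P)" "e \<in> set (content Q i j)"
    using e by (auto simp: around_content_def)
  then show "e \<in> instances I" using own_around[OF P Q(1)] by (auto simp: set_content)
  show "0 < j" "e \<in> (if j = 1 then U i else Act i)" using Q(2) unfolding set_content by auto
qed

lemma conflict_mem_around_content:
  assumes P: "P < procs_m I" and d: "d \<in> set (own I P)" and e: "conflict I e d" "0 < j"
    "e \<in> (if j = 1 then U i else Act i)"
  shows "e \<in> set (around_content P i j)"
proof -
  have inst: "e \<in> instances I" using e(3) U_inst[of i] Act_inst[of i] by (auto split: if_splits)
  have d': "d \<in> instances I" "demand_of d = P" using own_props[OF P d] by auto
  have "demand_of e < procs_m I" using inst by (auto simp: instances_def)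
  then have "e \<in> set (own I (demand_of e))" using set_own[OF wf] inst by auto
  then have "e \<in> set (content (demand_of e) i j)" using e by (simp add: set_content)
  moreover have "demand_of e \<in> set (around P)"
    using conflict_nb[OF inst d'(1) e(1)] d'(2) by (auto simp: around_def)
  ultimately show ?thesis unfolding around_content_def by auto
qed

lemma distinct_around_content:
  assumes P: "P < procs_m I"
  shows "distinct (around_content P i j)"
proof -
  have *: "distinct (concat (map f xs))" if "distinct xs" "\<And>x. x \<in> set xs \<Longrightarrow> distinct (f x)"
    "\<And>x d. x \<in> set xs \<Longrightarrow> d \<in> set (f x) \<Longrightarrow> g d = x" for f :: "nat \<Rightarrow> dinst list" and g xs
    using that
  proof (induction xs)
    case (Cons x xs)
    have "distinct (concat (map f xs))" using Cons.prems by (intro Cons.IH) auto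
    moreover have "d \<notin> set (f x)" if "y \<in> set xs" "d \<in> set (f y)" for y d
      using Cons.prems(1) Cons.prems(3)[of x d] Cons.prems(3)[of y d] that by auto
    ultimately show ?case using Cons.prems(2)[of x] by auto
  qed simp
  show ?thesis unfolding around_content_def
  proof (rule *[OF around(2)[OF P]])
    show "distinct (content Q i j)" for Q unfolding content_def using distinct_own by simp
    show "demand_of d = Q" if "Q \<in> set (around P)" "d \<in> set (content Q i j)" for Q d
      using own_around[OF P that(1), of d] that(2) by (simp add: set_content)
  qed
qed

lemma eval_numvp: "eval numvp (inp I P) = NumN (num_vertices I)"
  by (simp add: numvp_def num_vertices_def)

lemma loopfree_numvp [simp]: "loopfree numvp"
  by (simp add: numvp_def)

lemma length_content: "big B \<Longrightarrow> P < procs_m I \<Longrightarrow> length (content P i j) \<le> B"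
  using length_content_le[of P i j] length_own_le[OF wf, of P] by (simp add: big_def)

lemma runs_activep:
  assumes B: "big B" and inv: "inv1 X" and P: "P < procs_m I" and X: "X P = At i 1" "\<not> waits X P i 1"
  shows "runs B activep (Pair (econf P (X P)) (ebox X P)) (econtent P i 2)"
proof -
  let ?AD = "vlist (map (eentry i 1) (around_content P i 1))"
  let ?body = "Cond (Seq (Tuple (Seq Second First) First) (allp minimalp))
        (tup [tup [Seq First (sel 0), Seq First (sel 1),
           Tuple (Seq Second (Seq Second numvp)) (Seq First (Seq (sel 0) (sel 0)))]])
        (Const Null)"
  have lf: "loopfree minimalp" by (simp add: minimalp_def)
  have body: "runs B ?body (Pair (eentry i 1 d) (Pair ?AD (inp I P)))
     (if d \<in> Act i then vlist [eentry i 2 d] else Null)" if d: "d \<in> set (content P i 1)" for d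
  proof -
    have d': "d \<in> set (own I P)" "d \<in> U i" "d \<in> instances I"
      using d own_props[OF P, of d] by (auto simp: set_content)
    have ev: "eval minimalp (Pair (eentry i 1 e) (eentry i 1 d)) = vbool (\<not> (conflict I e d \<and> K i e < K i d))"
      if e: "e \<in> instances I" for e
    proof -
      have "eval (conflictp (Seq First (sel 0)) (Seq Second (sel 0))) (Pair (eentry i 1 e) (eentry i 1 d)) =
          vbool (conflict I e d)"
        by (rule eval_conflictp) (use wf e d' in simp_all)
      then show ?thesis by (simp add: minimalp_def)
    qed
    have 1: "runs B (allp minimalp) (Pair ?AD (eentry i 1 d))
       (vbool (\<forall>e\<in>set (around_content P i 1). \<not> (conflict I e d \<and> K i e < K i d)))"
      by (rule runs_allp)
        (use runs_loopfree[OF lf ev] mem_around_content(1)[OF P] length_around_content[OF P, of i 1] B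
          in \<open>auto simp: big_def\<close>)
    have "(\<forall>e\<in>set (around_content P i 1). \<not> (conflict I e d \<and> K i e < K i d)) \<longleftrightarrow> d \<in> Act i"
    proof
      assume *: "\<forall>e\<in>set (around_content P i 1). \<not> (conflict I e d \<and> K i e < K i d)"
      have "K i d \<le> K i e" if "e \<in> U i" "conflict I e d" for e
        using conflict_mem_around_content[OF P d'(1) that(2), of 1 i] that * by (auto simp: not_less)
      then show "d \<in> Act i" using d'(2) by (simp add: active_def)
    next
      assume "d \<in> Act i"
      then have *: "\<And>e. e \<in> U i \<Longrightarrow> conflict I e d \<Longrightarrow> K i d \<le> K i e" by (simp add: active_def)
      show "\<forall>e\<in>set (around_content P i 1). \<not> (conflict I e d \<and> K i e < K i d)"
        using mem_around_content(3)[OF P, of _ i 1] * by (auto simp: not_less)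
    qed
    moreover have "eentry i 2 d = vlist [einst I d, Num (slack i d), Pair (NumN (num_vertices I)) (NumN (vid I d))]"
      by (simp add: eentry_def mst_def mis_network_def)
    ultimately show ?thesis using 1 by (simp add: runs_def eval_numvp)
  qed
  have "filter (\<lambda>d. d \<in> Act i) (content P i 1) = content P i 2"
    using Act_U[of i] by (auto simp: content_def intro!: filter_cong)
  with runs_bindp_filter[where xs = "content P i 1" and g = "\<lambda>d. d" and ey = "eentry i 2", OF body length_content[OF B P]]
  have 1: "runs B (bindp ?body) (Pair (econtent P i 1) (Pair ?AD (inp I P))) (econtent P i 2)"
    by (simp add: econtent_def)
  show ?thesis
    using 1 runs_alldatap[OF B inv P X(1) _ X(2)] X(1) unfolding activep_def
    by (simp add: runs_def)
qed

lemma filter_unique: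
  assumes "distinct xs" "\<And>x y. x \<in> set xs \<Longrightarrow> y \<in> set xs \<Longrightarrow> P x \<Longrightarrow> P y \<Longrightarrow> x = y" "x \<in> set xs" "P x"
  shows "filter P xs = [x]"
proof -
  have "set (filter P xs) = {x}"
  proof
    show "set (filter P xs) \<subseteq> {x}" using assms(2)[OF _ assms(3) _ assms(4)] by auto
  qed (use assms(3,4) in simp)
  moreover have "distinct (filter P xs)" using assms(1) by simp
  ultimately show ?thesis by (metis distinct_card card_1_singleton_iff One_nat_def length_0_conv length_Suc_conv list.set_intros(1) singletonD)
qed

lemma runs_inboxp:
  assumes B: "big B" and P: "P < procs_m I" and d: "d \<in> set (own I P)" "d \<in> Act i" and j: "j = Suc (Suc k)"
  shows "runs B (inboxp M) (Pair (eentry i j d) (Pair (vlist (map (eentry i j) (around_content P i j))) (inp I P)))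
    (inbox M (G (Act i)) (state M (G (Act i)) k) (vid I d))"
proof -
  let ?A = "Act i"
  let ?AC = "around_content P i j"
  let ?AD = "vlist (map (eentry i j) ?AC)"
  let ?adj = "\<lambda>u. vadj ?A u (vid I d)"
  let ?msg = "\<lambda>u. Pair (NumN u) (eval (send M) (state M (G ?A) k u))"
  have d': "d \<in> instances I" using own_props[OF P d(1)] by blast
  have AC: "e \<in> instances I" "e \<in> ?A" if "e \<in> set ?AC" for e
    using mem_around_content[OF P that] j by auto
  have entry: "runs B (entryp M) (Pair (eentry i j e) (Pair (NumN u) (eentry i j d)))
     (if vid I e = u \<and> conflict I e d then vlist [?msg u] else Null)" if e: "e \<in> set ?AC" for e u
  proof -
    have c: "eval (conflictp (Seq First (sel 0)) (Seq Second (Seq Second (sel 0))))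
        (Pair (eentry i j e) (Pair (NumN u) (eentry i j d))) = vbool (conflict I e d)"
      by (rule eval_conflictp) (use wf AC[OF e] d' in simp_all)
    have 1: "eval (andp (eqp (Seq First (Seq (sel 0) (sel 0))) (Seq Second First))
        (conflictp (Seq First (sel 0)) (Seq Second (Seq Second (sel 0)))))
        (Pair (eentry i j e) (Pair (NumN u) (eentry i j d))) = vbool (vid I e = u \<and> conflict I e d)"
      using c by simp
    have 2: "loopfree (andp (eqp (Seq First (Seq (sel 0) (sel 0))) (Seq Second First))
        (conflictp (Seq First (sel 0)) (Seq Second (Seq Second (sel 0)))))" by simp
    have 3: "runs B (send M) (mst ?A k e) (eval (send M) (mst ?A k e))"
      by (rule runs_M(1)[OF B Act_inst AC(2)[OF e]])
    show ?thesis unfolding entryp_def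
    proof (rule runs_Cond[OF runs_loopfree[OF 2 1]])
      assume "vid I e = u \<and> conflict I e d"
      then have "state M (G ?A) k u = mst ?A k e" by (simp add: mst_def)
      then show "runs B (tup [Tuple (Seq Second First) (Seq First (Seq (sel 2) (send M)))])
        (Pair (eentry i j e) (Pair (NumN u) (eentry i j d))) (vlist [?msg u])"
        using 3 j by (simp add: runs_def)
    qed (simp add: runs_def)
  qed
  let ?inner = "\<lambda>u. map (\<lambda>e. ?msg u) (filter (\<lambda>e. vid I e = u \<and> conflict I e d) ?AC)"
  have inner: "runs B (bindp (entryp M)) (Pair ?AD (Pair (NumN u) (eentry i j d))) (vlist (map (\<lambda>x. x) (?inner u)))" for u
    by (rule runs_bindp_filter[where xs = ?AC and ex = "eentry i j" and e = "Pair (NumN u) (eentry i j d)"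
          and P = "\<lambda>e. vid I e = u \<and> conflict I e d" and g = "\<lambda>e. ?msg u" and ey = "\<lambda>x. x", OF entry])
      (use length_around_content[OF P, of i j] B in \<open>simp_all add: big_def\<close>)
  \<comment> \<open>Identifiers are injective and the collected list has no repetitions, so each
    sender matches at most one entry.\<close>
  have inner_eq: "?inner u = (if ?adj u then [?msg u] else [])" for u
  proof (cases "?adj u")
    case True
    then obtain e where e: "e \<in> ?A" "vid I e = u" "conflict I e d"
      unfolding vadj_def using vid_eq_iff[OF wf] d' Act_inst by (metis subsetD)
    have "e \<in> set ?AC" using conflict_mem_around_content[OF P d(1) e(3), of j i] e(1) j by simp
    then have "filter (\<lambda>e. vid I e = u \<and> conflict I e d) ?AC = [e]"
      using e vid_eq_iff[OF wf] AC(1) by (intro filter_unique[OF distinct_around_content[OF P]]) blast+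
    then show ?thesis using True by simp
  next
    case False
    have "filter (\<lambda>e. vid I e = u \<and> conflict I e d) ?AC = []"
      unfolding filter_empty_conv
    proof (intro ballI notI)
      fix e assume "e \<in> set ?AC" "vid I e = u \<and> conflict I e d"
      then show False using False AC(2) d(2) unfolding vadj_def by blast
    qed
    then show ?thesis using False by simp
  qed
  let ?b = "Seq (Tuple (Seq Second First) (Tuple First (Seq Second Second))) (bindp (entryp M))"
  have mid: "runs B ?b (Pair (NumN u) (Pair ?AD (eentry i j d))) (vlist (map (\<lambda>x. x) (?inner u)))" for u
    using inner[of u] by (simp add: runs_def)
  have "concat (map ?inner [0..<num_vertices I]) = map ?msg (filter ?adj [0..<num_vertices I])"
    unfolding inner_eq by (rule concat_filter)
  moreover have "length (map ?msg (filter ?adj [0..<num_vertices I])) \<le> num_vertices I"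
    using length_filter_le[of ?adj "[0..<num_vertices I]"] by simp
  ultimately have outer: "runs B (bindp ?b) (Pair (vlist (map (\<lambda>u. NumN u) [0..<num_vertices I])) (Pair ?AD (eentry i j d)))
     (vlist (map ?msg (filter ?adj [0..<num_vertices I])))"
    using runs_bindp[where ey = "\<lambda>x. x" and f = ?inner and xs = "[0..<num_vertices I]", OF mid] B by (simp add: big_def)
  have "sorted_list_of_set {u \<in> {..<num_vertices I}. ?adj u} = filter ?adj [0..<num_vertices I]"
    by (rule sorted_distinct_set_unique) (auto simp: sorted_wrt_filter)
  then have inbox: "inbox M (G ?A) (state M (G ?A) k) (vid I d) = vlist (map ?msg (filter ?adj [0..<num_vertices I]))"
    by (simp add: inbox_def mis_network_def)
  have "runs B rangep (NumN (num_vertices I)) (vlist (map (\<lambda>u. NumN u) [0..<num_vertices I]))"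
    by (rule runs_rangep) (use B in \<open>simp add: big_def\<close>)
  then show ?thesis using outer unfolding inboxp_def inbox
    by (simp add: runs_def eval_numvp)
qed

lemma runs_roundp:
  assumes B: "big B" and inv: "inv1 X" and P: "P < procs_m I" and X: "X P = At i j" "\<not> waits X P i j"
    and j: "j = Suc (Suc k)"
  shows "runs B (roundp M) (Pair (econf P (X P)) (ebox X P)) (econtent P i (Suc j))"
proof -
  let ?AD = "vlist (map (eentry i j) (around_content P i j))"
  let ?mst = "Seq First (sel 2)"
  let ?body = "tup [tup [Seq First (sel 0), Seq First (sel 1),
          Cond (Seq ?mst (out M)) ?mst (Seq (Tuple ?mst (inboxp M)) (step M))]]"
  have body: "runs B ?body (Pair (eentry i j d) (Pair ?AD (inp I P)))
     (if True then vlist [eentry i (Suc j) d] else Null)" if "d \<in> set (content P i j)" for d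
  proof -
    have d: "d \<in> set (own I P)" "d \<in> Act i" using that j by (auto simp: set_content)
    note M = runs_M[OF B Act_inst d(2), of k]
    have suc: "mst (Act i) (Suc k) d = (if eval (out M) (mst (Act i) k d) \<noteq> Null then mst (Act i) k d
       else eval (step M) (Pair (mst (Act i) k d) (inbox M (G (Act i)) (state M (G (Act i)) k) (vid I d))))"
      by (simp add: mst_def halted_def)
    show ?thesis
      using M runs_inboxp[OF B P d j] j by (auto simp: runs_def eentry_def suc halted_def)
  qed
  have "content P i j = content P i (Suc j)" using j by (simp add: content_def)
  with runs_bindp_filter[where xs = "content P i j" and g = "\<lambda>d. d" and ey = "eentry i (Suc j)", OF body length_content[OF B P]]
  have "runs B (bindp ?body) (Pair (econtent P i j) (Pair ?AD (inp I P))) (econtent P i (Suc j))"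
    by (simp add: econtent_def)
  then show ?thesis
    using runs_alldatap[OF B inv P X(1) _ X(2)] X(1) j unfolding roundp_def Let_def
    by (simp add: runs_def)
qed

lemma runs_stoppedp:
  assumes B: "big B" and P: "P < procs_m I" and X: "X P = At i j" and j: "j = Suc (Suc k)"
  shows "runs B (stoppedp M) (Pair (econf P (X P)) v) (vbool (stop P i \<le> j))"
proof -
  let ?body = "notp (notp (Seq First (Seq (sel 2) (out M))))"
  have body: "runs B ?body (Pair (eentry i j d) w) (vbool (halted M (mst (Act i) k d)))"
    if "d \<in> set (content P i j)" for d w
  proof -
    have d: "d \<in> Act i" using that j by (auto simp: set_content)
    show ?thesis using runs_M(2)[OF B Act_inst d, of k] j by (simp add: runs_def halted_def)
  qed
  have "runs B (allp ?body) (Pair (vlist (map (eentry i j) (content P i j))) w)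
     (vbool (\<forall>d\<in>set (content P i j). halted M (mst (Act i) k d)))" for w
    by (rule runs_allp[OF body length_content[OF B P]])
  moreover have "(\<forall>d\<in>set (content P i j). halted M (mst (Act i) k d)) \<longleftrightarrow> stop P i \<le> j"
    using stop_le_iff[of P i k] j by (auto simp: quiet_def set_content)
  ultimately show ?thesis using X unfolding stoppedp_def
    by (simp add: runs_def econtent_def)
qed

lemma runs_newraisedp:
  assumes B: "big B" and P: "P < procs_m I" and X: "X P = At i j" "stop P i \<le> j"
  shows "runs B (newraisedp M) (Pair (econf P (X P)) v)
    (vlist (map eraised (map (\<lambda>d. (d, i)) (filter (\<lambda>d. d \<in> Z i) (own I P)))))"
proof -
  obtain k where k: "j = Suc (Suc k)" using X(2) stop(1)[of P i] by (metis One_nat_def Suc_1 Suc_le_D le_trans Suc_le_mono)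
  have quiet: "quiet P i k" using X(2) k stop_le_iff[of P i k] by simp
  let ?body = "Cond (isonep (Seq First (Seq (sel 2) (out M))))
        (tup [tup [Seq First (sel 0), Second, mulp (Seq First (sel 1)) (Const (Num (1/4)))]])
        (Const Null)"
  have body: "runs B ?body (Pair (eentry i j d) (NumN i)) (if d \<in> Z i then vlist [eraised (d, i)] else Null)"
    if dc: "d \<in> set (content P i j)" for d
  proof -
    have d: "d \<in> set (own I P)" "d \<in> Act i" using dc k by (auto simp: set_content)
    then have h: "halted M (mst (Act i) k d)" using quiet by (simp add: quiet_def)
    have hr: "halted M (mst (Act i) rounds d)" by (rule mst_halted[OF Act_inst d(2)])
    \<comment> \<open>The vertex has halted by both rounds, so the states agree and the local
      stopping time yields the final output of \<open>M\<close>.\<close>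
    have "mst (Act i) k d = mst (Act i) rounds d"
      using mst_frozen[OF h, of rounds] mst_frozen[OF hr, of k] by (cases "k \<le> rounds") auto
    then have "eval (out M) (mst (Act i) k d) = Num 1 \<longleftrightarrow> d \<in> Z i"
      using d by (simp add: Z_def misA_def)
    then have iso: "runs B (isonep (Seq First (Seq (sel 2) (out M)))) (Pair (eentry i j d) (NumN i)) (vbool (d \<in> Z i))"
      using runs_isonep[of B "Seq First (Seq (sel 2) (out M))" "Pair (eentry i j d) (NumN i)" "eval (out M) (mst (Act i) k d)"]
        runs_M(2)[OF B Act_inst d(2), of k] k by (simp add: runs_def)
    have "eval (mulp (Seq First (sel 1)) (Const (Num (1/4)))) (Pair (eentry i j d) (NumN i)) = Num (slack i d / 4)"
      by (subst eval_mulp[where a = "slack i d" and b = "1/4"]) simp_all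
    then show ?thesis
      by (intro runs_Cond[OF iso]) (simp_all add: runs_def eraised_def)
  qed
  have "filter (\<lambda>d. d \<in> Z i) (content P i j) = filter (\<lambda>d. d \<in> Z i) (own I P)"
    using Z_Act[of i] k by (auto simp: content_def intro!: filter_cong)
  with runs_bindp_filter[where xs = "content P i j" and g = "\<lambda>d. (d, i)" and ey = eraised, OF body length_content[OF B P]]
  have "runs B (bindp ?body) (Pair (econtent P i j) (NumN i))
     (vlist (map eraised (map (\<lambda>d. (d, i)) (filter (\<lambda>d. d \<in> Z i) (own I P)))))"
    by (simp add: econtent_def)
  then show ?thesis using X(1) unfolding newraisedp_def by (simp add: runs_def)
qed


lemma econtent_0 [simp]: "econtent P i 0 = Null"
  by (simp add: econtent_def content_def vlist_simps)

lemma eprev_Suc [simp]: "eprev P i (Suc j) = econtent P i j"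
  by (simp add: eprev_def)

lemma runs_startp:
  assumes "big B" "inv1 X" "P < procs_m I" "X P = At i 0" "\<not> waits X P i 0"
  shows "runs B (startp \<theta> b) (Pair (econf P (X P)) (ebox X P)) (econf P (pstep X P))"
proof -
  have "econtent P i (Suc 0) = Null \<longleftrightarrow> (\<forall>d\<in>set (own I P). d \<notin> U i)"
    by (auto simp: econtent_def content_def filter_empty_conv)
  moreover have "pstep X P = (if \<forall>d\<in>set (own I P). d \<notin> U i then Fin i (raised P i) None else At i 1)"
    using assms(4,5) by (simp add: pstep_def)
  ultimately show ?thesis
    using runs_unsatp[OF assms] assms(4)
    by (simp add: runs_def startp_def) (simp add: econf_def echoice_def vlist_simps)
qed

lemma runs_activatep:
  assumes "big B" "inv1 X" "P < procs_m I" "X P = At i 1" "\<not> waits X P i 1"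
  shows "runs B activatep (Pair (econf P (X P)) (ebox X P)) (econf P (pstep X P))"
proof -
  have "pstep X P = At i 2" using assms(4,5) stop(1)[of P i] by (simp add: pstep_def numeral_2_eq_2)
  moreover have "eprev P i 2 = econtent P i (Suc 0)" by (simp add: eprev_def)
  ultimately show ?thesis
    using runs_activep[OF assms] assms(4)
    by (simp add: runs_def activatep_def) (simp add: econf_def)
qed

lemma runs_advancep:
  assumes "big B" "inv1 X" "P < procs_m I" "X P = At i j" "\<not> waits X P i j" "2 \<le> j" "j < stop P i"
  shows "runs B (advancep M) (Pair (econf P (X P)) (ebox X P)) (econf P (pstep X P))"
proof -
  obtain k where k: "j = Suc (Suc k)" using assms(6) by (metis add_2_eq_Suc le_Suc_ex)
  have "pstep X P = At i (Suc j)" using assms(4-7) by (simp add: pstep_def)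
  then show ?thesis
    using runs_roundp[OF assms(1-5) k] assms(4)
    by (simp add: runs_def advancep_def) (simp add: econf_def add.commute)
qed

lemma runs_nextp:
  assumes B: "big B" and inv: "inv1 X" and P: "P < procs_m I" and X: "X P = At i j" "\<not> waits X P i j" "stop P i \<le> j"
  shows "runs B (nextp M) (Pair (econf P (X P)) (ebox X P)) (econf P (pstep X P))"
proof -
  let ?new = "map (\<lambda>d. (d, i)) (filter (\<lambda>d. d \<in> Z i) (own I P))"
  have step: "pstep X P = At (Suc i) 0" using X stop(1)[of P i] by (simp add: pstep_def)
  have prev: "eprev P (Suc i) 0 = econtent P i j" using econtent_frozen[OF X(3)] by (simp add: eprev_def)
  have "length (map eraised ?new) \<le> B"
    using length_own_le[OF wf P] B by (auto simp: big_def intro: le_trans[OF length_filter_le])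
  from runs_appendp[OF this, of "map eraised (raised P i)"]
  have "runs B appendp (Pair (vlist (map eraised ?new)) (vlist (map eraised (raised P i))))
    (vlist (map eraised (raised P (Suc i))))" by simp
  then show ?thesis
    using runs_newraisedp[where X = X and v = "ebox X P", OF B P X(1,3)] X(1) step prev
    by (simp add: runs_def nextp_def) (simp add: econf_def add.commute)
qed

lemma runs_decidep:
  assumes B: "big B" and inv: "inv2 X" and P: "P < procs_m I" and X: "X P = Fin k ((d, \<tau>) # r) None"
  shows "runs B decidep (Pair (econf P (X P)) (ebox X P)) (econf P (pstep X P))"
proof -
  let ?env = "Pair (eraised (d, \<tau>)) (Pair (econf P (X P)) (ebox X P))"
  let ?entry = "\<lambda>Q. Pair (NumN Q) (econf Q (X Q))"
  have inst: "d \<in> instances I" using inv2_rest(2)[OF inv P X, of d \<tau>] Z_inst by auto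
  have lf: "loopfree decidablep" "loopfree unblockedp"
    by (simp_all add: decidablep_def unblockedp_def Let_def)
  have 1: "eval decidablep (Pair (?entry Q) ?env) =
      vbool (\<exists>k r c. X Q = Fin k r c \<and> (c \<noteq> None \<or> r = [] \<or> snd (hd r) \<le> \<tau>))" for Q
  proof (cases "X Q")
    case (At i j)
    then show ?thesis by (simp add: decidablep_def Let_def andp_def)
  next
    case (Fin kq rq cq)
    show ?thesis
    proof (cases cq)
      case None
      show ?thesis
      proof (cases rq)
        case Nil
        then show ?thesis using Fin None
          by (simp add: decidablep_def Let_def andp_def orp_def echoice_def vlist_simps vbool_def notp_def)
      next
        case (Cons a rq')
        then show ?thesis using Fin None
          by (simp add: decidablep_def Let_def echoice_def vlist_simps not_less)
      qed
    next
      case (Some e)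
      then show ?thesis using Fin
        by (simp add: decidablep_def Let_def andp_def orp_def echoice_def vbool_def del: not_None_eq)
    qed
  qed
  have 2: "eval unblockedp (Pair (?entry Q) ?env) =
      vbool (\<forall>k r e. X Q = Fin k r (Some e) \<longrightarrow> \<not> conflict I e d)" if Q: "Q < procs_m I" for Q
  proof (cases "X Q")
    case (At i j)
    then show ?thesis by (simp add: unblockedp_def Let_def andp_def)
  next
    case (Fin kq rq cq)
    show ?thesis
    proof (cases cq)
      case None
      then show ?thesis using Fin by (simp add: unblockedp_def Let_def andp_def echoice_def)
    next
      case (Some e)
      then obtain j where "e \<in> Z j" using inv2_chosen[OF inv Q] Fin by metis
      then have e: "e \<in> instances I" using Z_inst by blast
      have "eval (conflictp (Seq (st' 6) Second) (Seq Second (Seq First (sel 0)))) (Pair (?entry Q) ?env) =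
          vbool (conflict I e d)"
        by (rule eval_conflictp) (use wf e inst Fin Some in \<open>simp_all add: echoice_def\<close>)
      then show ?thesis using Fin Some by (simp add: unblockedp_def Let_def echoice_def del: split_paired_All)
    qed
  qed
  have len: "length (nbl P) \<le> B" using around(4)[OF P] B by (simp add: big_def)
  have all1: "runs B (allp decidablep) (Pair (ebox X P) ?env) (vbool (ready X P \<tau>))"
  proof -
    have "ready X P \<tau> \<longleftrightarrow> (\<forall>Q\<in>set (nbl P). \<exists>k r c. X Q = Fin k r c \<and> (c \<noteq> None \<or> r = [] \<or> snd (hd r) \<le> \<tau>))"
      by (simp add: ready_def)
    moreover have "runs B (allp decidablep) (Pair (vlist (map ?entry (nbl P))) ?env)
       (vbool (\<forall>Q\<in>set (nbl P). \<exists>k r c. X Q = Fin k r c \<and> (c \<noteq> None \<or> r = [] \<or> snd (hd r) \<le> \<tau>)))"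
      by (rule runs_allp, rule runs_loopfree[OF lf(1) 1], rule len)
    ultimately show ?thesis by (simp only: ebox_def)
  qed
  have all2: "runs B (allp unblockedp) (Pair (ebox X P) ?env) (vbool (\<not> blocked X P d))"
  proof -
    have "\<not> blocked X P d \<longleftrightarrow> (\<forall>Q\<in>set (nbl P). \<forall>k r e. X Q = Fin k r (Some e) \<longrightarrow> \<not> conflict I e d)"
      unfolding blocked_def by auto
    moreover have "Q < procs_m I" if "Q \<in> set (nbl P)" for Q using that by (simp add: nb_def)
    then have "runs B (allp unblockedp) (Pair (vlist (map ?entry (nbl P))) ?env)
       (vbool (\<forall>Q\<in>set (nbl P). \<forall>k r e. X Q = Fin k r (Some e) \<longrightarrow> \<not> conflict I e d))"
      by (intro runs_allp runs_loopfree[OF lf(2) 2] len)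
    ultimately show ?thesis by (simp only: ebox_def)
  qed
  have step: "pstep X P = (if ready X P \<tau> then if blocked X P d then Fin k r None else Fin k r (Some d) else X P)"
    using X by (simp add: pstep_def)
  have case_vlist: "(case vlist (x # xs) of Pair a b \<Rightarrow> b | _ \<Rightarrow> Null) = vlist xs"
    "(case vlist (x # xs) of Pair a b \<Rightarrow> a | _ \<Rightarrow> Null) = x" for x xs
    by (simp_all add: vlist_simps)
  let ?state = "\<lambda>p. tup [st 0, st 1, st 2, st 3, st 4, st 5, Tuple (Seq (st 6) (Seq First Second)) p]"
  let ?box = "Tuple (Seq Second Second) Id"
  have state: "runs B (?state p) ?env (econf P (Fin k r c))"
    if "loopfree p" "eval p ?env = echoice c" for p c
  proof (rule runs_loopfree)
    show "loopfree (?state p)" using that by simp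
    have "eval (?state p) ?env = vlist [inp I P, NumN k, Num 0, vlist (map eraised (raised P k)), Null, Null,
       Pair (vlist (map eraised r)) (echoice c)]"
      using that(2) unfolding X by (simp add: case_vlist)
    then show "eval (?state p) ?env = econf P (Fin k r c)" by (simp only: econf_def pst.case)
  qed
  have s1: "runs B (?state (Seq First (sel 0))) ?env (econf P (Fin k r (Some d)))"
    and s2: "runs B (?state (Const Null)) ?env (econf P (Fin k r None))"
    by (rule state; simp add: echoice_def)+
  have box: "runs B ?box ?env (Pair (ebox X P) ?env)" by (rule runs_loopfree) simp_all
  have keep: "runs B (Seq Second First) ?env (econf P (X P))" by (rule runs_loopfree) simp_all
  have head: "runs B (Seq First (Seq (sel 6) (Seq First First))) (Pair (econf P (X P)) (ebox X P)) (eraised (d, \<tau>))"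
    by (rule runs_loopfree) (simp_all add: X case_vlist)
  have "runs B (Cond (Seq ?box (allp decidablep)) (Cond (Seq ?box (allp unblockedp))
      (?state (Seq First (sel 0))) (?state (Const Null))) (Seq Second First)) ?env
    (if ready X P \<tau> then (if \<not> blocked X P d then econf P (Fin k r (Some d)) else econf P (Fin k r None))
       else econf P (X P))"
    by (rule runs_Cond[OF runs_Seq[OF box all1] runs_Cond[OF runs_Seq[OF box all2] s1 s2] keep])
  from runs_letp[OF head this] show ?thesis
    unfolding decidep_def Let_def step by (simp split: if_splits)
qed

section \<open>Simulation of the abstract run by the algorithm\<close>

definition decided :: "pst \<Rightarrow> bool" where
  "decided x \<longleftrightarrow> (\<exists>k r c. x = Fin k r c \<and> (c \<noteq> None \<or> r = []))"

lemma First_econf [simp]: "(case econf P x of Pair a b \<Rightarrow> a | _ \<Rightarrow> Null) = inp I P"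
  by (cases x) (simp_all add: econf_def vlist_simps)

lemma First_inp [simp]: "(case inp I P of Pair a b \<Rightarrow> a | _ \<Rightarrow> Null) = NumN (slots_n I)"
  by (simp add: inp_def line_comm_def vlist_simps)

lemma IsNum_inp [simp]: "(case inp I P of Num a \<Rightarrow> Num 1 | _ \<Rightarrow> Null) = Null"
  by (simp add: inp_def line_comm_def vlist_simps)

lemma runs_stepp:
  assumes B: "big B" and inv: "inv1 X" "inv2 X" and P: "P < procs_m I" and nd: "\<not> decided (X P)"
  shows "runs B (stepp M \<theta> b) (Pair (econf P (X P)) (ebox X P)) (econf P (pstep X P))"
proof -
  let ?e = "Pair (econf P (X P)) (ebox X P)"
  have "runs B (mainp M \<theta> b) ?e (econf P (pstep X P))"
  proof (cases "X P")
    case (Fin k r c)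
    then obtain d \<tau> r' where X: "X P = Fin k ((d, \<tau>) # r') None" using nd
      by (cases r; cases c) (auto simp: decided_def)
    then show ?thesis using runs_decidep[OF B inv(2) P X] by (simp add: runs_def mainp_def)
  next
    case (At i j)
    note ready = runs_readyp[where X = X, OF B P At]
    have fin: "eval (own_st 6) ?e = Null" using At by simp
    show ?thesis
    proof (cases "waits X P i j")
      case True
      then have "pstep X P = X P" using At by (simp add: pstep_def)
      then show ?thesis using ready True fin by (simp add: runs_def mainp_def)
    next
      case nw: False
      consider "j = 0" | "j = 1" | "2 \<le> j" by linarith
      then show ?thesis
      proof cases
        case 1
        then show ?thesis using ready nw fin At runs_startp[OF B inv(1) P, of i] by (simp add: runs_def mainp_def)
      next
        case 2
        then show ?thesis using ready nw fin At runs_activatep[OF B inv(1) P, of i] by (simp add: runs_def mainp_def)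
      next
        case 3
        obtain k where k: "j = Suc (Suc k)" using 3 by (metis add_2_eq_Suc le_Suc_ex)
        note stopped = runs_stoppedp[where X = X and v = "ebox X P", OF B P At k]
        show ?thesis
        proof (cases "stop P i \<le> j")
          case True
          then show ?thesis using ready nw fin At stopped 3 runs_nextp[OF B inv(1) P At nw]
            by (simp add: runs_def mainp_def)
        next
          case False
          then show ?thesis using ready nw fin At stopped 3 runs_advancep[OF B inv(1) P At nw]
            by (simp add: runs_def mainp_def)
        qed
      qed
    qed
  qed
  then show ?thesis by (simp add: runs_def stepp_def)
qed

lemma eval_outp_econf:
  "eval outp (econf P (At i j)) = Null"
  "eval outp (econf P (Fin k r (Some d))) = Pair (NumN (resource_of d)) (NumN (start_of d))"
  "eval outp (econf P (Fin k r None)) = (if r = [] then Num 0 else Null)"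
  by (simp_all add: outp_def echoice_def)

lemma runs_outp_inp:
  assumes B: "big B" and P: "P < procs_m I"
  shows "runs B outp (inp I P) (if num_vertices I < 2 then
    case own I P of [] \<Rightarrow> Num 0 | d # _ \<Rightarrow> Pair (NumN (resource_of d)) (NumN (start_of d)) else Null)"
proof -
  have 1: "runs B instp (inp I P) (vlist (map (einst I) (own I P)))"
    using runs_instp[OF wf P] B by (simp add: big_def)
  have 2: "eval (lessp numvp (Const (Num 2))) (inp I P) = vbool (num_vertices I < 2)"
    using eval_numvp[of P] by simp
  have 3: "eval (Seq First IsNum) (inp I P) \<noteq> Null" by simp
  show ?thesis
  proof (cases "own I P")
    case Nil
    then show ?thesis using 1 2 3 by (simp add: runs_def outp_def vlist_simps)
  next
    case (Cons d ds)
    then show ?thesis using 1 2 3 by (simp add: runs_def outp_def vlist_simps)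
  qed
qed

abbreviation "A \<equiv> line_algorithm M \<theta> b"

lemma sel_A [simp]: "send A = Id" "step A = stepp M \<theta> b" "out A = outp"
  by (simp_all add: line_algorithm_def)

lemma inbox_ebox:
  assumes P: "P < procs_m I" and s: "\<And>Q. Q < procs_m I \<Longrightarrow> s Q = econf Q (X Q)"
  shows "inbox A (line_comm I) s P = ebox X P"
proof -
  have "{u \<in> nodes (line_comm I). linked (line_comm I) u P} = {Q. nb I Q P}"
    using P by (auto simp: line_comm_def nb_def)
  moreover have "map (\<lambda>Q. Pair (NumN Q) (s Q)) (nbl P) = map (\<lambda>Q. Pair (NumN Q) (econf Q (X Q))) (nbl P)"
    using s by (auto simp: nb_def)
  ultimately show ?thesis by (simp only: inbox_def ebox_def nbl_def sel_A eval.simps)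
qed

lemma halted_econf: "halted A (econf P x) \<longleftrightarrow> decided x"
proof (cases x)
  case (At i j)
  then show ?thesis by (simp add: halted_def eval_outp_econf decided_def)
next
  case (Fin k r c)
  then show ?thesis by (cases c) (simp_all add: halted_def eval_outp_econf decided_def del: not_None_eq)
qed

lemma pstep_decided: "decided (X P) \<Longrightarrow> pstep X P = X P"
  by (auto simp: decided_def pstep_def split: list.split)

lemma big_exists: obtains B where "big B"
proof -
  obtain c k where "\<forall>N E. simple_graph {..<N} E \<longrightarrow> local_cost_le M (mis_network N E) (c * N ^ k)"
    using M unfolding mis_algorithm_def by blast
  then have c: "local_cost_le M (G A) (c * num_vertices I ^ k)" if "A \<subseteq> instances I" for A
    using simple_vadj[OF that] by blast
  have mono: "local_cost_le M (G A) B'" if "local_cost_le M (G A) B" "B \<le> B'" for A B B'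
    using that unfolding local_cost_le_def Let_def by (meson le_trans)
  have "big (Suc (slots_n I) + ress_r I + num_vertices I + procs_m I + b + c * num_vertices I ^ k)"
    using mono[OF c] by (simp add: big_def)
  then show ?thesis using that by blast
qed

text \<open>The shift by one round is the set-up of the state. A \<open>big\<close> bound is fetched
  only to extract the computed values from the \<open>runs\<close> statements.\<close>

lemma simulation:
  assumes N: "2 \<le> num_vertices I" and P: "P < procs_m I"
  shows "state A (line_comm I) (Suc t) P = econf P (conf t P)"
  using P
proof (induction t arbitrary: P)
  case 0
  obtain B where "big B" by (rule big_exists)
  then have "\<not> halted A (inp I P)" using runs_outp_inp[of B P] 0 N by (simp add: halted_def runs_def)
  then show ?case by (simp add: inp_def[symmetric] stepp_def) (simp add: econf_def vlist_simps eprev_def)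
next
  case (Suc t)
  let ?s = "state A (line_comm I) (Suc t)"
  have box: "inbox A (line_comm I) ?s P = ebox (conf t) P"
    by (rule inbox_ebox[OF Suc.prems Suc.IH])
  obtain B where B: "big B" by (rule big_exists)
  have "state A (line_comm I) (Suc (Suc t)) P = (if decided (conf t P) then econf P (conf t P)
     else eval (stepp M \<theta> b) (Pair (econf P (conf t P)) (ebox (conf t) P)))"
    unfolding state.simps(2)[of _ _ "Suc t"] box Suc.IH[OF Suc.prems] halted_econf by simp
  then show ?case
    using runs_stepp[OF B inv1_conf inv2_conf Suc.prems, of t] pstep_decided[of "conf t" P]
    by (simp add: runs_def conf.simps(2))
qed

text \<open>The tuple merely adds up the bounds for \<open>send\<close>, \<open>out\<close> and
  \<open>step\<close>.\<close>

lemma local_cost_A: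
  assumes B: "big B"
  shows "local_cost_le A (line_comm I) (cost_bound B (Tuple Id (Tuple outp (stepp M \<theta> b))))"
  unfolding local_cost_le_def Let_def
proof (intro ballI allI)
  fix P t assume "P \<in> nodes (line_comm I)"
  then have P: "P < procs_m I" by (simp add: line_comm_def)
  let ?C = "cost_bound B (Tuple Id (Tuple outp (stepp M \<theta> b)))"
  let ?s = "state A (line_comm I) t P"
  have key: "loops_le B outp ?s \<and> (\<not> halted A ?s \<longrightarrow>
      loops_le B (stepp M \<theta> b) (Pair ?s (inbox A (line_comm I) (state A (line_comm I) t) P)))"
  proof (cases "t = 0 \<or> num_vertices I < 2")
    case True
    have h: "halted A (inp I P)" if "num_vertices I < 2"
      using runs_outp_inp[OF B P] that by (simp add: halted_def runs_def split: list.splits)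
    have s: "?s = inp I P"
    proof (cases "t = 0")
      case False
      then have "num_vertices I < 2" using True by simp
      then have "halted A (state A (line_comm I) 0 P)" using h by (simp add: inp_def)
      from halted_stays[OF this, of t] show ?thesis by (simp add: inp_def)
    qed (simp add: inp_def)
    have "loops_le B (stepp M \<theta> b) (Pair (inp I P) v)" for v
      by (simp add: stepp_def)
    then show ?thesis using runs_outp_inp[OF B P] unfolding s by (simp add: runs_def)
  next
    case False
    then obtain t' where t: "t = Suc t'" "2 \<le> num_vertices I" by (cases t) auto
    have s: "?s = econf P (conf t' P)" unfolding t(1) by (rule simulation[OF t(2) P])
    have box: "inbox A (line_comm I) (state A (line_comm I) t) P = ebox (conf t') P"
      unfolding t(1) by (rule inbox_ebox[OF P simulation[OF t(2)]])
    have "loops_le B outp (econf P x)" for x by (simp add: outp_def)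
    then show ?thesis
      using runs_stepp[OF B inv1_conf inv2_conf P, of t'] unfolding s box halted_econf
      by (simp add: runs_def)
  qed
  then have "cost outp ?s \<le> cost_bound B outp" using cost_le_cost_bound by blast
  moreover have "cost (stepp M \<theta> b) (Pair ?s (inbox A (line_comm I) (state A (line_comm I) t) P))
     \<le> cost_bound B (stepp M \<theta> b)" if "\<not> halted A ?s" using key that cost_le_cost_bound by blast
  ultimately show "cost (send A) ?s \<le> ?C \<and> cost (out A) ?s \<le> ?C \<and> (\<not> halted A ?s \<longrightarrow>
     cost (step A) (Pair ?s (inbox A (line_comm I) (state A (line_comm I) t) P)) \<le> ?C)"
    by auto
qed

lemma finished_end:
  assumes N: "2 \<le> num_vertices I"
  shows "finished A (line_comm I) (Suc end_time)"
  unfolding finished_def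
proof
  fix P assume "P \<in> nodes (line_comm I)"
  then have P: "P < procs_m I" by (simp add: line_comm_def)
  obtain k r c where "conf end_time P = Fin k r c" "c \<noteq> None \<or> r = []" by (rule end_Fin[OF P])
  then have "decided (conf end_time P)" unfolding decided_def by blast
  then show "halted A (state A (line_comm I) (Suc end_time) P)"
    unfolding simulation[OF N P] halted_econf .
qed

lemma solution_end:
  assumes N: "2 \<le> num_vertices I"
  shows "solution A I (Suc end_time) = selected"
proof -
  have "node_output A (line_comm I) (Suc end_time) P = Pair (NumN R) (NumN s) \<longleftrightarrow>
      (\<exists>k r. conf end_time P = Fin k r (Some (P, R, s)))" if P: "P < procs_m I" for P R s
  proof -
    have o: "node_output A (line_comm I) (Suc end_time) P = eval outp (econf P (conf end_time P))"
      unfolding node_output_def simulation[OF N P] by simp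
    obtain k r c where F: "conf end_time P = Fin k r c" "c \<noteq> None \<or> r = []" by (rule end_Fin[OF P])
    show ?thesis
    proof (cases c)
      case None
      then show ?thesis using F o by (simp add: eval_outp_econf)
    next
      case (Some d)
      have "demand_of d = P" using inv2_chosen[OF inv2_conf P, of end_time k r d] F(1) Some by metis
      then show ?thesis using F(1) o Some by (cases d) (auto simp: eval_outp_econf)
    qed
  qed
  note out = this
  have dem: "demand_of d = P" if "P < procs_m I" "conf end_time P = Fin k r (Some d)" for P k r d
    using inv2_chosen[OF inv2_conf that] by metis
  show ?thesis
  proof (rule set_eqI)
    fix d :: dinst
    obtain P R s where d: "d = (P, R, s)" by (cases d)
    have "d \<in> selected \<longleftrightarrow> P < procs_m I \<and> (\<exists>k r. conf end_time P = Fin k r (Some (P, R, s)))"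
      using dem unfolding selected_def d by fastforce
    also have "\<dots> \<longleftrightarrow> d \<in> solution A I (Suc end_time)"
      using out[of P R s] unfolding solution_def d by auto
    finally show "d \<in> solution A I (Suc end_time) \<longleftrightarrow> d \<in> selected" by simp
  qed
qed

lemma small_case:
  assumes N: "num_vertices I < 2"
  shows "finished A (line_comm I) 0" "solution A I 0 = instances I" "feasible I (instances I)"
proof -
  obtain B where B: "big B" by (rule big_exists)
  have o: "node_output A (line_comm I) 0 P = (case own I P of [] \<Rightarrow> Num 0
      | d # _ \<Rightarrow> Pair (NumN (resource_of d)) (NumN (start_of d)))" if "P < procs_m I" for P
    using runs_outp_inp[OF B that] N by (simp add: node_output_def runs_def inp_def)
  then show "finished A (line_comm I) 0"
    by (auto simp: finished_def line_comm_def halted_def node_output_def split: list.splits)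
  have card: "card (instances I) \<le> 1" using card_instances_le[OF wf] N by simp
  have eq: "d = e" if "d \<in> instances I" "e \<in> instances I" for d e
    using card that finite_instances[OF wf] by (metis card_le_Suc0_iff_eq One_nat_def)
  then show "feasible I (instances I)" by (auto simp: feasible_def)
  have "node_output A (line_comm I) 0 P = Pair (NumN R) (NumN s) \<longleftrightarrow> (P, R, s) \<in> instances I"
    if P: "P < procs_m I" for P R s
  proof (cases "own I P")
    case Nil
    then have "(P, R, s) \<notin> instances I" using set_own[OF wf P] by force
    then show ?thesis using o[OF P] Nil by simp
  next
    case (Cons d ds)
    then have "d \<in> set (own I P)" by simp
    then have d: "d \<in> instances I" "demand_of d = P" using own_props[OF P] by auto
    then have "(P, R, s) \<in> instances I \<longleftrightarrow> d = (P, R, s)" using eq[OF d(1)] by metis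
    then show ?thesis using o[OF P] Cons d(2) by (cases d) auto
  qed
  then show "solution A I 0 = instances I"
    unfolding solution_def by (auto simp: instances_def)
qed

end

section \<open>Number of rounds and local cost\<close>

text \<open>Without communication the empty and the complete graph cannot be told apart.\<close>

lemma mis_rounds_pos:
  assumes M: "mis_algorithm M T" and N: "2 \<le> N"
  shows "1 \<le> T N"
proof (rule ccontr)
  assume "\<not> ?thesis"
  then have T: "T N = 0" by simp
  let ?S = "{v. v < N \<and> eval (out M) (Pair (NumN N) (NumN v)) = Num 1}"
  have S: "maximal_independent_set {..<N} E ?S" if "simple_graph {..<N} E" for E
  proof -
    have "maximal_independent_set {..<N} E {v. v < N \<and> node_output M (mis_network N E) (T N) v = Num 1}"
      using M that unfolding mis_algorithm_def by blast
    then show ?thesis by (simp add: node_output_def mis_network_def T)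
  qed
  have "maximal_independent_set {..<N} (\<lambda>_ _. False) ?S" by (rule S) (simp add: simple_graph_def)
  then have "{..<N} = ?S"
    unfolding maximal_independent_set_def independent_set_def by blast
  moreover have "maximal_independent_set {..<N} (\<lambda>u v. u \<noteq> v) ?S" by (rule S) (auto simp: simple_graph_def)
  ultimately have "\<forall>u<N. \<forall>v<N. u = v"
    unfolding maximal_independent_set_def independent_set_def by auto
  then have "(0::nat) = 1" using N by (metis less_le_trans one_less_numeral_iff pos2 semiring_norm(76))
  then show False by simp
qed

lemma opt_profit_attained:
  assumes "wf_line I"
  obtains Opt where "feasible I Opt" "opt_profit I = total_profit I Opt"
proof -
  have "{S. feasible I S} \<subseteq> Pow (instances I)" by (auto simp: feasible_def)
  then have "finite {S. feasible I S}" using finite_instances[OF assms] finite_subset by blast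
  moreover have "feasible I {}" by (simp add: feasible_def)
  ultimately have "opt_profit I \<in> total_profit I ` {S. feasible I S}"
    unfolding opt_profit_def by (intro Max_in) auto
  then show ?thesis using that by auto
qed

lemma total_profit_mono:
  assumes "wf_line I" "S \<subseteq> S'" "S' \<subseteq> instances I"
  shows "0 \<le> total_profit I S" "total_profit I S \<le> total_profit I S'"
proof -
  have pos: "0 \<le> profit I (demand_of d)" if "d \<in> S'" for d
    using that assms by (force simp: wf_line_def instances_def)
  then show "0 \<le> total_profit I S" unfolding total_profit_def using assms(2) by (intro sum_nonneg) auto
  have "finite S'" using finite_instances[OF assms(1)] assms(3) finite_subset by blast
  then show "total_profit I S \<le> total_profit I S'"
    unfolding total_profit_def using pos assms(2) by (intro sum_mono2) auto
qed

lemma lg_ge_1: "1 \<le> lg x"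
  by (simp add: lg_def)

text \<open>\<open>(9/8) ^ 8\<close> exceeds 2, so 8 levels halve the slack, and 8 times the rounded
  binary logarithm of (4 + \<epsilon>) / \<epsilon> is enough. That logarithm is at most
  \<open>3 + lg (1 / \<epsilon>)\<close>; rounding up and \<open>lg\<close> being at least 1 give 1
  + 8 * 5 = 41.\<close>

lemma levels_exist:
  fixes \<epsilon> :: real
  assumes \<epsilon>: "0 < \<epsilon>"
  obtains b where "1 \<le> \<epsilon> / (4 + \<epsilon>) * (9/8) ^ Suc b" "real (Suc b) \<le> 41 * lg (1 / \<epsilon>)"
proof -
  define x where "x = (4 + \<epsilon>) / \<epsilon>"
  define c where "c = nat \<lceil>log 2 x\<rceil>"
  have x: "1 \<le> x" using \<epsilon> by (simp add: x_def)
  have l: "0 \<le> log 2 x" using x by (subst zero_le_log_cancel_iff) auto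
  have "x = 2 powr log 2 x" using x by simp
  also have "\<dots> \<le> 2 powr real c" using l unfolding c_def by (intro powr_mono) linarith+
  also have "\<dots> = 2 ^ c" by (simp add: powr_realpow)
  also have "\<dots> \<le> ((9/8) ^ 8) ^ c" by (intro power_mono) (simp_all add: power_divide)
  also have "\<dots> = (9/8 :: real) ^ (8 * c)" by (simp only: power_mult)
  also have "\<dots> \<le> (9/8) ^ Suc (8 * c)" by (intro power_increasing) auto
  finally have "x \<le> (9/8) ^ Suc (8 * c)" .
  then have "\<epsilon> / (4 + \<epsilon>) * x \<le> \<epsilon> / (4 + \<epsilon>) * (9/8) ^ Suc (8 * c)" using \<epsilon> by (intro mult_left_mono) auto
  then have 1: "1 \<le> \<epsilon> / (4 + \<epsilon>) * (9/8) ^ Suc (8 * c)" using \<epsilon> by (simp add: x_def)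
  have "log 2 x \<le> 3 + lg (1 / \<epsilon>)"
  proof (cases "1 \<le> \<epsilon>")
    case True
    then have "x \<le> 2 ^ 3" using \<epsilon> by (simp add: x_def divide_le_eq)
    then have "log 2 x \<le> log 2 (2 ^ 3)" using x by (subst log_le_cancel_iff) auto
    also have "\<dots> = 3" by (subst log_nat_power) auto
    finally show ?thesis using lg_ge_1[of "1 / \<epsilon>"] by linarith
  next
    case False
    then have "x \<le> 2 ^ 3 * (1 / \<epsilon>)" using \<epsilon> by (simp add: x_def divide_right_mono)
    then have "log 2 x \<le> log 2 (2 ^ 3 * (1 / \<epsilon>))" using x \<epsilon> by (subst log_le_cancel_iff) auto
    also have "\<dots> = log 2 (2 ^ 3) + log 2 (1 / \<epsilon>)" using \<epsilon> by (subst log_mult) auto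
    also have "log 2 (2 ^ 3 :: real) = 3" by (subst log_nat_power) auto
    finally show ?thesis by (simp add: lg_def)
  qed
  moreover have "real c \<le> log 2 x + 1" using l unfolding c_def by linarith
  ultimately have "real (Suc (8 * c)) \<le> 41 * lg (1 / \<epsilon>)" using lg_ge_1[of "1 / \<epsilon>"] by simp
  then show ?thesis using 1 that by blast
qed

lemma poly_local_line_algorithm:
  assumes M: "mis_algorithm M T" and \<theta>: "0 < \<theta>" "\<theta> < 1" "1 \<le> \<theta> * (9/8) ^ Suc b"
  shows "poly_local (line_algorithm M \<theta> b)"
proof -
  let ?p = "Tuple Id (Tuple outp (stepp M \<theta> b))"
  obtain cM kM where cM: "\<And>N E. simple_graph {..<N} E \<Longrightarrow> local_cost_le M (mis_network N E) (cM * N ^ kM)"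
    using M unfolding mis_algorithm_def by blast
  obtain c k where ck: "\<And>B. cost_bound B ?p \<le> c * (B + 1) ^ k" using cost_bound_poly by blast
  \<comment> \<open>The number of vertices is at most the cube of the input size, so the cost of
    \<open>M\<close> contributes degree \<open>3 * kM\<close>; the remaining 3 covers the number of
    vertices itself.\<close>
  define e where "e = 3 * kM + 3"
  have "local_cost_le (line_algorithm M \<theta> b) (line_comm I)
      (c * (b + cM + 3) ^ k * (slots_n I + procs_m I + ress_r I) ^ (e * k))" if wf: "wf_line I" for I
  proof -
    interpret line_run I M T \<theta> b by unfold_locales (use wf M \<theta> in auto)
    define S where "S = slots_n I + procs_m I + ress_r I"
    have S: "1 \<le> S" using wf by (simp add: S_def wf_line_def)
    define B where "B = (b + cM + 2) * S ^ e"
    have "num_vertices I \<le> S * S * S"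
      unfolding num_vertices_def S_def by (intro mult_le_mono) auto
    then have NS: "num_vertices I \<le> S ^ 3" by (simp add: power3_eq_cube)
    have Se: "S ^ 3 \<le> S ^ e" "S ^ 1 \<le> S ^ e" "1 \<le> S ^ e"
      using S power_increasing[of 3 e S] power_increasing[of 1 e S] one_le_power[of S e]
      by (simp_all add: e_def)
    have two: "2 * S ^ e \<le> B" "b * S ^ e \<le> B" "cM * S ^ e \<le> B"
      unfolding B_def by (intro mult_le_mono1; simp)+
    have "S \<le> S ^ e" using Se by simp
    have "big B" unfolding big_def
    proof (intro conjI allI impI)
      show "Suc (slots_n I) \<le> B" using two(1) Se \<open>S \<le> S ^ e\<close> unfolding S_def by linarith
      show "ress_r I \<le> B" "procs_m I \<le> B" using two(1) \<open>S \<le> S ^ e\<close> unfolding S_def by linarith+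
      show "num_vertices I \<le> B" using NS two(1) Se by linarith
      have "b * 1 \<le> b * S ^ e" using Se(3) by (rule mult_le_mono2)
      then show "b \<le> B" using two(2) by linarith
      fix A assume "A \<subseteq> instances I"
      from cM[OF simple_vadj[OF this]]
      have lc: "local_cost_le M (G A) (cM * num_vertices I ^ kM)" .
      have "num_vertices I ^ kM \<le> (S ^ 3) ^ kM" using NS by (rule power_mono) simp
      also have "\<dots> = S ^ (3 * kM)" by (simp add: power_mult)
      also have "\<dots> \<le> S ^ e" using S unfolding e_def by (intro power_increasing) auto
      finally have "cM * num_vertices I ^ kM \<le> B" using two(3) by (meson le_trans mult_le_mono2)
      then show "local_cost_le M (G A) B" using lc unfolding local_cost_le_def Let_def by (meson le_trans)
    qed
    from local_cost_A[OF this]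
    have 1: "local_cost_le (line_algorithm M \<theta> b) (line_comm I) (cost_bound B ?p)" .
    have "B + 1 \<le> (b + cM + 3) * S ^ e" using Se(3) by (simp add: B_def algebra_simps)
    then have "(B + 1) ^ k \<le> ((b + cM + 3) * S ^ e) ^ k" by (rule power_mono) simp
    then have "c * (B + 1) ^ k \<le> c * ((b + cM + 3) * S ^ e) ^ k" by (rule mult_le_mono2)
    also have "\<dots> = c * (b + cM + 3) ^ k * S ^ (e * k)" by (simp add: power_mult_distrib power_mult)
    finally have "cost_bound B ?p \<le> c * (b + cM + 3) ^ k * S ^ (e * k)" using ck[of B] by linarith
    then show ?thesis using 1 unfolding local_cost_le_def Let_def S_def by (meson le_trans)
  qed
  then show ?thesis unfolding poly_local_def by blast
qed

context line_run
begin

text \<open>The run takes \<open>num_steps * (rounds + 4) + 2\<close> rounds. Because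
  \<open>rounds\<close> is at least 1, this is at most 5 times \<open>rounds\<close> per step plus
  twice \<open>rounds\<close>, and 6 * 5 + 2 = 32.\<close>

lemma end_time_le:
  assumes N: "2 \<le> num_vertices I"
  shows "real (Suc end_time) \<le> 32 * real rounds * real (Suc b) *
    lg (real (L_max I) / real (L_min I)) * lg (p_max I / p_min I)"
proof -
  let ?L = "lg (real (L_max I) / real (L_min I))" and ?p = "lg (p_max I / p_min I)"
  let ?s = "real (Suc b) * ?L * ?p"
  have T: "1 \<le> real rounds" using mis_rounds_pos[OF M N] by simp
  have "1 * 1 * 1 \<le> ?s" by (intro mult_mono) (simp_all add: lg_ge_1 lg_def)
  then have s: "1 \<le> ?s" by simp
  have n: "real num_steps \<le> 6 * ?s" using num_steps_le by (simp add: algebra_simps)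
  have "real (Suc end_time) = real num_steps * (real rounds + 4) + 2"
    by (simp add: end_time_def fin_time_def algebra_simps)
  also have "\<dots> \<le> real num_steps * (5 * real rounds) + 2 * real rounds"
    using T by (intro add_mono mult_left_mono) auto
  also have "\<dots> \<le> 6 * ?s * (5 * real rounds) + 2 * (?s * real rounds)"
  proof (intro add_mono mult_right_mono[OF n])
    have "1 * real rounds \<le> ?s * real rounds" using s T by (intro mult_right_mono) auto
    then show "2 * real rounds \<le> 2 * (?s * real rounds)" by simp
  qed (use T in simp)
  also have "\<dots> = 32 * real rounds * real (Suc b) * ?L * ?p" by (simp add: algebra_simps)
  finally show ?thesis .
qed

end

theorem theorem3:
  shows "\<exists>C::real. C > 0 \<and>
    (\<forall>M T_MIS. mis_algorithm M T_MIS \<longrightarrow>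
      (\<forall>\<epsilon>::real. \<epsilon> > 0 \<longrightarrow>
        (\<exists>A. poly_local A \<and>
          (\<forall>I. wf_line I \<longrightarrow>
            (\<exists>t. finished A (line_comm I) t \<and>
                 real t \<le> C * real (T_MIS (slots_n I * procs_m I * ress_r I)) * lg (1 / \<epsilon>)
                            * lg (real (L_max I) / real (L_min I)) * lg (p_max I / p_min I) \<and>
                 feasible I (solution A I t) \<and>
                 total_profit I (solution A I t) \<ge> opt_profit I / (4 + \<epsilon>))))))"
proof (intro exI[of _ "1312"] conjI allI impI)
  fix M :: algorithm and T :: "nat \<Rightarrow> nat" and \<epsilon> :: real
  assume M: "mis_algorithm M T" and \<epsilon>: "\<epsilon> > 0"
  define \<theta> where "\<theta> = \<epsilon> / (4 + \<epsilon>)"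
  obtain b where b: "1 \<le> \<theta> * (9/8) ^ Suc b" "real (Suc b) \<le> 41 * lg (1 / \<epsilon>)"
    using levels_exist[OF \<epsilon>] unfolding \<theta>_def by blast
  have th: "0 < \<theta>" "\<theta> < 1" "(1 - \<theta>) / 4 = 1 / (4 + \<epsilon>)" using \<epsilon> by (auto simp: \<theta>_def field_simps)
  let ?A = "line_algorithm M \<theta> b"
  show "\<exists>A. poly_local A \<and>
          (\<forall>I. wf_line I \<longrightarrow>
            (\<exists>t. finished A (line_comm I) t \<and>
                 real t \<le> 1312 * real (T (slots_n I * procs_m I * ress_r I)) * lg (1 / \<epsilon>)
                            * lg (real (L_max I) / real (L_min I)) * lg (p_max I / p_min I) \<and>
                 feasible I (solution A I t) \<and>
                 total_profit I (solution A I t) \<ge> opt_profit I / (4 + \<epsilon>)))"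
  proof (intro exI[of _ ?A] conjI allI impI)
    show "poly_local ?A" by (rule poly_local_line_algorithm[OF M th(1,2) b(1)])
    fix I assume wf: "wf_line I"
    interpret line_run I M T \<theta> b by unfold_locales (use wf M th b in auto)
    let ?L = "lg (real (L_max I) / real (L_min I))" and ?p = "lg (p_max I / p_min I)"
    obtain Opt where Opt: "feasible I Opt" "opt_profit I = total_profit I Opt"
      by (rule opt_profit_attained[OF wf])
    show "\<exists>t. finished ?A (line_comm I) t \<and>
                 real t \<le> 1312 * real (T (slots_n I * procs_m I * ress_r I)) * lg (1 / \<epsilon>) * ?L * ?p \<and>
                 feasible I (solution ?A I t) \<and> total_profit I (solution ?A I t) \<ge> opt_profit I / (4 + \<epsilon>)"
    proof (cases "num_vertices I < 2")
      case True
      have "Opt \<subseteq> instances I" using Opt(1) by (simp add: feasible_def)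
      note profit = total_profit_mono[OF wf this order_refl]
      have "total_profit I Opt * 1 \<le> total_profit I (instances I) * (4 + \<epsilon>)"
        using profit \<epsilon> by (intro mult_mono) auto
      then have "opt_profit I / (4 + \<epsilon>) \<le> total_profit I (solution ?A I 0)"
        using \<epsilon> unfolding Opt(2) small_case(2)[OF True] by (simp add: divide_le_eq)
      moreover have "0 \<le> lg x" for x using lg_ge_1[of x] by linarith
      ultimately show ?thesis
        using small_case[OF True] by (intro exI[of _ 0]) auto
    next
      case False
      then have N: "2 \<le> num_vertices I" by simp
      have pos: "0 \<le> 32 * real rounds" "0 \<le> ?L" "0 \<le> ?p" using lg_ge_1 order_trans[OF zero_le_one] by auto
      have "real (Suc end_time) \<le> 32 * real rounds * real (Suc b) * ?L * ?p" by (rule end_time_le[OF N])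
      \<comment> \<open>The 32 of the time bound meets the 41 of the number of levels; their product
        is the constant 1312.\<close>
      also have "\<dots> \<le> 32 * real rounds * (41 * lg (1 / \<epsilon>)) * ?L * ?p"
        using pos by (intro mult_right_mono mult_left_mono b(2))
      finally have "real (Suc end_time) \<le>
          1312 * real (T (slots_n I * procs_m I * ress_r I)) * lg (1 / \<epsilon>) * ?L * ?p"
        by (simp add: num_vertices_def)
      moreover have "opt_profit I / (4 + \<epsilon>) \<le> total_profit I selected"
      proof -
        have "1 / (4 + \<epsilon>) * total_profit I Opt \<le> total_profit I selected"
          using selected_profit[OF Opt(1)] unfolding th(3) .
        then show ?thesis unfolding Opt(2) by simp
      qed
      ultimately show ?thesis
        using finished_end[OF N] selected_feasible unfolding solution_end[OF N, symmetric] by blast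
    qed
  qed
qed simp

end
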